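(* For any 2-category $\mathfrak B$ there is a 2-equivalence $$\mathbf{D2Fib}(\mathfrak B)\simeq T\mathbf{Alg},$$ where $\mathbf{D2Fib}(\mathfrak B)$ is the 2-category of discrete 2-fibrations over $\mathfrak B$ and $T\mathbf{Alg}$ is the 2-category of algebras for the 2-monad $T$ on the strict slice $\mathbf{Cat}/|\mathfrak B|$ given by pulling back along $\mathrm{tgt}\colon|\mathbf{Sq}(\mathfrak B)|\to|\mathfrak B|$ and then composing with $\mathrm{src}\colon|\mathbf{Sq}(\mathfrak B)|\to|\mathfrak B|$.
   Context: 2-categories and 2-functors are strict; $|\cdot|$ denotes the underlying 1-category or functor. $\mathbf{Cat}$ is the 2-category of categories small with respect to a universe chosen so that the 2-categories considered are small. Discrete 2-fibrations. For a functor $p\colon\mathscr E\to\mathscr C$, an arrow $\phi\colon Y\to X$ is cartesian if for all $h\colon Z\to X$ and $w\colon pZ\to pY$ with $p(\phi)w=p(h)$ there is a unique $\hat w\colon Z\to Y$ with $p\hat w=w$ and $\phi\hat w=h$. A split fibration is a functor $p$ with a chosen cartesian arrow $\phi(f,X)\colon f^*X\to X$ over each $f\colon C\to pX$, such that $\phi(1,X)=1_X$ and $\phi(gf,X)=\phi(g,X)\phi(f,g^*X)$. A discrete opfibration is a functor $p$ such that for each object $X$ and arrow $f\colon pX\to D$ there is a unique arrow with domain $X$ over $f$. A discrete 2-fibration is a 2-functor $P\colon\mathfrak E\to\mathfrak B$ such that $|P|$ is a split fibration and each $P\colon\mathfrak E(X,Y)\to\mathfrak B(PX,PY)$ is a discrete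 opfibration. $\mathbf{D2Fib}(\mathfrak B)$ has as objects discrete 2-fibrations over $\mathfrak B$ (with splittings), as arrows 2-functors strictly over $\mathfrak B$ preserving the chosen cartesian arrows, as 2-cells 2-natural transformations with vertical components (sent to identities in $\mathfrak B$). Squares. $|\mathbf{Sq}(\mathfrak B)|$ is the category whose objects are arrows $f$ of $\mathfrak B$ and whose arrows from $f\colon B\to C$ to $g\colon A\to D$ are triples $(h,k,\alpha)$ with $h\colon B\to A$, $k\colon C\to D$ and a 2-cell $\alpha\colon kf\Rightarrow gh$, composed by pasting. The functor $\mathrm{src}$ sends $f$ to its domain and $(h,k,\alpha)$ to $h$; $\mathrm{tgt}$ sends $f$ to its codomain and $(h,k,\alpha)$ to $k$. "Horizontal" composition pastes squares $(h,k,\alpha)$ and $(k,l,\beta)$ along the common arrow $k$; on objects it is composition of arrows of $\mathfrak B$. The 2-monad. $\mathbf{Cat}/|\mathfrak B|$ is the strict slice 2-category: objects are functors $\mathscr C\to|\mathfrak B|$, arrows are strictly commuting functors, 2-cells are natural transformations with vertical components. $T$ sends $F\colon\mathscr C\to|\mathfrak B|$ to $|\mathbf{Sq}(\mathfrak B)|\times_{|\mathfrak B|}\mathscr C$ (pullback of $F$ along $\mathrm{tgt}$), regarded over $|\mathfrak B|$ via $\mathrm{src}$. The multiplication $\mu_F$ is horizontal composition of squares times the identity of $\mathscr C$; the unit $\eta_F$ inserts identity squares for horizontal composition ($X\mapsto(1_{FX},X)$ on objects). Algebras. A $T$-algebra is an object $Q\colon\mathscr A\to|\mathfrak B|$ with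 an arrow $M\colon TQ\to Q$ over $|\mathfrak B|$ such that $M\mu=M\,T(M)$ and $M\eta=1$; a morphism is an arrow $H$ of $\mathbf{Cat}/|\mathfrak B|$ strictly commuting with the structure maps; a 2-cell $\theta\colon H\Rightarrow K$ of morphisms $(A,a)\to(B,b)$ is a 2-cell of $\mathbf{Cat}/|\mathfrak B|$ with $\theta\ast a=b\ast T\theta$. These form the 2-category $T\mathbf{Alg}$. *)

theory Defs
  imports "HOL-Library.FuncSet" "HOL-Library.Equipollence"
begin

section \<open>Categories and strict 2-categories\<close>

text \<open>\<open>Comp C g f\<close> is the composite \<open>g \<circ> f\<close>. Operations are total HOL functions that matter only
  on the carriers; records differing only off the carriers are isomorphic via an identity map.
  Functors and transformations, on the other hand, are made extensional (\<open>\<rightarrow>\<^sub>E\<close>), so that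
  equality of arrows and 2-cells is the intended one.\<close>

record ('o, 'a) cat =
  Ob :: "'o set"
  Ar :: "'a set"
  Dom :: "'a \<Rightarrow> 'o"
  Cod :: "'a \<Rightarrow> 'o"
  Idn :: "'o \<Rightarrow> 'a"
  Comp :: "'a \<Rightarrow> 'a \<Rightarrow> 'a"

locale category =
  fixes C :: "('o, 'a, 'm) cat_scheme"
  assumes Dom_Ob: "f \<in> Ar C \<Longrightarrow> Dom C f \<in> Ob C"
    and Cod_Ob: "f \<in> Ar C \<Longrightarrow> Cod C f \<in> Ob C"
    and Idn_Ar: "X \<in> Ob C \<Longrightarrow> Idn C X \<in> Ar C"
    and Dom_Idn: "X \<in> Ob C \<Longrightarrow> Dom C (Idn C X) = X"
    and Cod_Idn: "X \<in> Ob C \<Longrightarrow> Cod C (Idn C X) = X"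
    and Comp_Ar: "\<lbrakk>f \<in> Ar C; g \<in> Ar C; Dom C g = Cod C f\<rbrakk> \<Longrightarrow> Comp C g f \<in> Ar C"
    and Dom_Comp: "\<lbrakk>f \<in> Ar C; g \<in> Ar C; Dom C g = Cod C f\<rbrakk> \<Longrightarrow> Dom C (Comp C g f) = Dom C f"
    and Cod_Comp: "\<lbrakk>f \<in> Ar C; g \<in> Ar C; Dom C g = Cod C f\<rbrakk> \<Longrightarrow> Cod C (Comp C g f) = Cod C g"
    and Comp_Idn: "f \<in> Ar C \<Longrightarrow> Comp C f (Idn C (Dom C f)) = f"
    and Idn_Comp: "f \<in> Ar C \<Longrightarrow> Comp C (Idn C (Cod C f)) f = f"
    and Comp_assoc: "\<lbrakk>f \<in> Ar C; g \<in> Ar C; h \<in> Ar C; Dom C g = Cod C f; Dom C h = Cod C g\<rbrakk>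
      \<Longrightarrow> Comp C h (Comp C g f) = Comp C (Comp C h g) f"

definition iso_arrow :: "('o, 'a, 'm) cat_scheme \<Rightarrow> 'a \<Rightarrow> bool" where
  "iso_arrow C f \<longleftrightarrow> f \<in> Ar C \<and>
     (\<exists>g\<in>Ar C. Dom C g = Cod C f \<and> Cod C g = Dom C f \<and>
        Comp C g f = Idn C (Dom C f) \<and> Comp C f g = Idn C (Cod C f))"

text \<open>In a 2-category \<open>Ar\<close> are the 1-cells and \<open>Ce\<close> the 2-cells; \<open>Dom2\<close>, \<open>Cod2\<close> give the source
  and target 1-cell of a 2-cell.\<close>

record ('o, 'a, 'c) twocat = "('o, 'a) cat" +
  Ce :: "'c set"
  Dom2 :: "'c \<Rightarrow> 'a"
  Cod2 :: "'c \<Rightarrow> 'a"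
  Idn2 :: "'a \<Rightarrow> 'c"
  VComp :: "'c \<Rightarrow> 'c \<Rightarrow> 'c"
  HComp :: "'c \<Rightarrow> 'c \<Rightarrow> 'c"

definition under :: "('o, 'a, 'c) twocat \<Rightarrow> ('o, 'a) cat" where
  "under B = cat.truncate B"

definition vert_cat :: "('o, 'a, 'c) twocat \<Rightarrow> ('a, 'c) cat" where
  "vert_cat B = \<lparr>Ob = Ar B, Ar = Ce B, Dom = Dom2 B, Cod = Cod2 B, Idn = Idn2 B, Comp = VComp B\<rparr>"

definition horiz_cat :: "('o, 'a, 'c) twocat \<Rightarrow> ('o, 'c) cat" where
  "horiz_cat B = \<lparr>Ob = Ob B, Ar = Ce B,
     Dom = (\<lambda>\<alpha>. Dom B (Dom2 B \<alpha>)), Cod = (\<lambda>\<alpha>. Cod B (Dom2 B \<alpha>)),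
     Idn = (\<lambda>X. Idn2 B (Idn B X)), Comp = HComp B\<rparr>"

definition hom_cat :: "('o, 'a, 'c) twocat \<Rightarrow> 'o \<Rightarrow> 'o \<Rightarrow> ('a, 'c) cat" where
  "hom_cat B X Y = \<lparr>Ob = {f \<in> Ar B. Dom B f = X \<and> Cod B f = Y},
     Ar = {\<alpha> \<in> Ce B. Dom B (Dom2 B \<alpha>) = X \<and> Cod B (Dom2 B \<alpha>) = Y},
     Dom = Dom2 B, Cod = Cod2 B, Idn = Idn2 B, Comp = VComp B\<rparr>"

locale two_category =
  fixes B :: "('o, 'a, 'c) twocat"
  assumes under: "category (under B)"
    and vert: "category (vert_cat B)"
    and horiz: "category (horiz_cat B)"
    and Dom_globular: "\<alpha> \<in> Ce B \<Longrightarrow> Dom B (Cod2 B \<alpha>) = Dom B (Dom2 B \<alpha>)"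
    and Cod_globular: "\<alpha> \<in> Ce B \<Longrightarrow> Cod B (Cod2 B \<alpha>) = Cod B (Dom2 B \<alpha>)"
    and Dom2_HComp: "\<lbrakk>\<alpha> \<in> Ce B; \<beta> \<in> Ce B; Dom B (Dom2 B \<beta>) = Cod B (Dom2 B \<alpha>)\<rbrakk>
      \<Longrightarrow> Dom2 B (HComp B \<beta> \<alpha>) = Comp B (Dom2 B \<beta>) (Dom2 B \<alpha>)"
    and Cod2_HComp: "\<lbrakk>\<alpha> \<in> Ce B; \<beta> \<in> Ce B; Dom B (Dom2 B \<beta>) = Cod B (Dom2 B \<alpha>)\<rbrakk>
      \<Longrightarrow> Cod2 B (HComp B \<beta> \<alpha>) = Comp B (Cod2 B \<beta>) (Cod2 B \<alpha>)"
    and HComp_Idn2: "\<lbrakk>f \<in> Ar B; g \<in> Ar B; Dom B g = Cod B f\<rbrakk>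
      \<Longrightarrow> HComp B (Idn2 B g) (Idn2 B f) = Idn2 B (Comp B g f)"
    and interchange: "\<lbrakk>\<alpha> \<in> Ce B; \<alpha>' \<in> Ce B; \<beta> \<in> Ce B; \<beta>' \<in> Ce B;
        Dom2 B \<alpha>' = Cod2 B \<alpha>; Dom2 B \<beta>' = Cod2 B \<beta>; Dom B (Dom2 B \<beta>) = Cod B (Dom2 B \<alpha>)\<rbrakk>
      \<Longrightarrow> HComp B (VComp B \<beta>' \<beta>) (VComp B \<alpha>' \<alpha>) = VComp B (HComp B \<beta>' \<alpha>') (HComp B \<beta> \<alpha>)"


section \<open>Functors, transformations, 2-equivalence\<close>

record ('o, 'a, 'p, 'b) functr =
  FOb :: "'o \<Rightarrow> 'p"
  FAr :: "'a \<Rightarrow> 'b"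

record ('o, 'a, 'c, 'p, 'b, 'd) twofunctr = "('o, 'a, 'p, 'b) functr" +
  FCe :: "'c \<Rightarrow> 'd"

definition is_functor ::
  "('o, 'a, 'm) cat_scheme \<Rightarrow> ('p, 'b, 'n) cat_scheme \<Rightarrow> ('o, 'a, 'p, 'b, 'k) functr_scheme \<Rightarrow> bool"
where
  "is_functor C D F \<longleftrightarrow>
     FOb F \<in> Ob C \<rightarrow>\<^sub>E Ob D \<and> FAr F \<in> Ar C \<rightarrow>\<^sub>E Ar D \<and>
     (\<forall>f\<in>Ar C. Dom D (FAr F f) = FOb F (Dom C f) \<and> Cod D (FAr F f) = FOb F (Cod C f)) \<and>
     (\<forall>X\<in>Ob C. FAr F (Idn C X) = Idn D (FOb F X)) \<and>
     (\<forall>f\<in>Ar C. \<forall>g\<in>Ar C. Dom C g = Cod C f \<longrightarrow>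
        FAr F (Comp C g f) = Comp D (FAr F g) (FAr F f))"

definition is_two_functor ::
  "('o, 'a, 'c) twocat \<Rightarrow> ('p, 'b, 'd) twocat \<Rightarrow> ('o, 'a, 'c, 'p, 'b, 'd) twofunctr \<Rightarrow> bool"
where
  "is_two_functor C D F \<longleftrightarrow>
     is_functor C D F \<and> FCe F \<in> Ce C \<rightarrow>\<^sub>E Ce D \<and>
     (\<forall>\<alpha>\<in>Ce C. Dom2 D (FCe F \<alpha>) = FAr F (Dom2 C \<alpha>) \<and> Cod2 D (FCe F \<alpha>) = FAr F (Cod2 C \<alpha>)) \<and>
     (\<forall>f\<in>Ar C. FCe F (Idn2 C f) = Idn2 D (FAr F f)) \<and>
     (\<forall>\<alpha>\<in>Ce C. \<forall>\<beta>\<in>Ce C. Dom2 C \<beta> = Cod2 C \<alpha> \<longrightarrow>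
        FCe F (VComp C \<beta> \<alpha>) = VComp D (FCe F \<beta>) (FCe F \<alpha>)) \<and>
     (\<forall>\<alpha>\<in>Ce C. \<forall>\<beta>\<in>Ce C. Dom C (Dom2 C \<beta>) = Cod C (Dom2 C \<alpha>) \<longrightarrow>
        FCe F (HComp C \<beta> \<alpha>) = HComp D (FCe F \<beta>) (FCe F \<alpha>))"

definition fid :: "('o, 'a, 'm) cat_scheme \<Rightarrow> ('o, 'a, 'o, 'a) functr" where
  "fid C = \<lparr>FOb = (\<lambda>X\<in>Ob C. X), FAr = (\<lambda>f\<in>Ar C. f)\<rparr>"

definition fcomp :: "('o, 'a, 'm) cat_scheme \<Rightarrow> ('p, 'b, 'q, 'd, 'k) functr_scheme \<Rightarrow>
    ('o, 'a, 'p, 'b, 'l) functr_scheme \<Rightarrow> ('o, 'a, 'q, 'd) functr" where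
  "fcomp C G F = \<lparr>FOb = compose (Ob C) (FOb G) (FOb F), FAr = compose (Ar C) (FAr G) (FAr F)\<rparr>"

definition tfid :: "('o, 'a, 'c) twocat \<Rightarrow> ('o, 'a, 'c, 'o, 'a, 'c) twofunctr" where
  "tfid C = \<lparr>FOb = (\<lambda>X\<in>Ob C. X), FAr = (\<lambda>f\<in>Ar C. f), FCe = (\<lambda>\<alpha>\<in>Ce C. \<alpha>)\<rparr>"

definition tfcomp :: "('o, 'a, 'c) twocat \<Rightarrow> ('p, 'b, 'd, 'q, 'e, 'f) twofunctr \<Rightarrow>
    ('o, 'a, 'c, 'p, 'b, 'd) twofunctr \<Rightarrow> ('o, 'a, 'c, 'q, 'e, 'f) twofunctr" where
  "tfcomp C G F = \<lparr>FOb = compose (Ob C) (FOb G) (FOb F), FAr = compose (Ar C) (FAr G) (FAr F),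
     FCe = compose (Ce C) (FCe G) (FCe F)\<rparr>"

definition nat_trans ::
  "('o, 'a, 'm) cat_scheme \<Rightarrow> ('p, 'b, 'n) cat_scheme \<Rightarrow> ('o, 'a, 'p, 'b, 'k) functr_scheme \<Rightarrow>
   ('o, 'a, 'p, 'b, 'l) functr_scheme \<Rightarrow> ('o \<Rightarrow> 'b) \<Rightarrow> bool"
where
  "nat_trans C D F G \<theta> \<longleftrightarrow>
     \<theta> \<in> Ob C \<rightarrow>\<^sub>E Ar D \<and>
     (\<forall>X\<in>Ob C. Dom D (\<theta> X) = FOb F X \<and> Cod D (\<theta> X) = FOb G X) \<and>
     (\<forall>f\<in>Ar C. Comp D (FAr G f) (\<theta> (Dom C f)) = Comp D (\<theta> (Cod C f)) (FAr F f))"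

definition two_nat_trans ::
  "('o, 'a, 'c) twocat \<Rightarrow> ('p, 'b, 'd) twocat \<Rightarrow> ('o, 'a, 'c, 'p, 'b, 'd) twofunctr \<Rightarrow>
   ('o, 'a, 'c, 'p, 'b, 'd) twofunctr \<Rightarrow> ('o \<Rightarrow> 'b) \<Rightarrow> bool"
where
  "two_nat_trans C D F G \<theta> \<longleftrightarrow>
     nat_trans C D F G \<theta> \<and>
     (\<forall>\<alpha>\<in>Ce C. HComp D (FCe G \<alpha>) (Idn2 D (\<theta> (Dom C (Dom2 C \<alpha>)))) =
        HComp D (Idn2 D (\<theta> (Cod C (Dom2 C \<alpha>)))) (FCe F \<alpha>))"

definition two_nat_iso ::
  "('o, 'a, 'c) twocat \<Rightarrow> ('p, 'b, 'd) twocat \<Rightarrow> ('o, 'a, 'c, 'p, 'b, 'd) twofunctr \<Rightarrow>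
   ('o, 'a, 'c, 'p, 'b, 'd) twofunctr \<Rightarrow> ('o \<Rightarrow> 'b) \<Rightarrow> bool"
where
  "two_nat_iso C D F G \<theta> \<longleftrightarrow> two_nat_trans C D F G \<theta> \<and> (\<forall>X\<in>Ob C. iso_arrow D (\<theta> X))"

definition two_equivalent :: "('o, 'a, 'c) twocat \<Rightarrow> ('p, 'b, 'd) twocat \<Rightarrow> bool" where
  "two_equivalent C D \<longleftrightarrow> two_category C \<and> two_category D \<and>
     (\<exists>F G \<eta> \<epsilon>. is_two_functor C D F \<and> is_two_functor D C G \<and>
        two_nat_iso C C (tfid C) (tfcomp C G F) \<eta> \<and> two_nat_iso D D (tfcomp D F G) (tfid D) \<epsilon>)"


section \<open>The universe\<close>

text \<open>The universe of small sets is a family \<open>U\<close> of subsets of an infinite type \<open>'u\<close>. Of the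
  closure properties of a Grothendieck universe only subsets, replacement and binary products
  (here combined into one condition) are imposed. Since all cells of small categories live in
  \<open>'u\<close>, pullbacks of categories have to be carried back into \<open>'u\<close> along an injection \<open>enc\<close>; such
  injections exist for all types of tuples over an infinite \<open>'u\<close>.\<close>

definition universe :: "'u set set \<Rightarrow> bool" where
  "universe U \<longleftrightarrow> infinite (UNIV :: 'u set) \<and>
     (\<forall>X\<in>U. \<forall>Y\<in>U. \<forall>Z :: 'u set. Z \<lesssim> X \<times> Y \<longrightarrow> Z \<in> U)"

definition enc :: "'x \<Rightarrow> 'u" where
  "enc = (SOME e. inj e)"

definition dec :: "'u \<Rightarrow> 'x" where
  "dec = inv enc"

definition recode :: "('o, 'a) cat \<Rightarrow> ('u, 'u) cat" where
  "recode C = \<lparr>Ob = enc ` Ob C, Ar = enc ` Ar C,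
     Dom = (\<lambda>f. enc (Dom C (dec f))), Cod = (\<lambda>f. enc (Cod C (dec f))),
     Idn = (\<lambda>X. enc (Idn C (dec X))), Comp = (\<lambda>g f. enc (Comp C (dec g) (dec f)))\<rparr>"

definition small_category :: "'u set set \<Rightarrow> ('u, 'u) cat \<Rightarrow> bool" where
  "small_category U C \<longleftrightarrow> category C \<and> Ob C \<in> U \<and> Ar C \<in> U"

definition small_two_category :: "'u set set \<Rightarrow> ('u, 'u, 'u) twocat \<Rightarrow> bool" where
  "small_two_category U B \<longleftrightarrow> two_category B \<and> Ob B \<in> U \<and> Ar B \<in> U \<and> Ce B \<in> U"


section \<open>Arrows and 2-cells with their boundaries\<close>

text \<open>An arrow (or 2-cell) of a 2-category of structures is the underlying map together with its
  source and target.\<close>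

record ('x, 'm) tagged =
  Src :: 'x
  Tgt :: 'x
  Fn :: 'm


section \<open>The slice 2-category of small categories over a category\<close>

type_synonym 'u over = "('u, 'u) cat \<times> ('u, 'u, 'u, 'u) functr"
type_synonym 'u over_arr = "('u over, ('u, 'u, 'u, 'u) functr) tagged"
type_synonym 'u over_cell = "('u over_arr, 'u \<Rightarrow> 'u) tagged"

definition over_Ob :: "'u set set \<Rightarrow> ('u, 'u) cat \<Rightarrow> 'u over set" where
  "over_Ob U K = {(C, F). small_category U C \<and> is_functor C K F}"

definition over_Ar :: "'u set set \<Rightarrow> ('u, 'u) cat \<Rightarrow> 'u over_arr set" where
  "over_Ar U K = {H. Src H \<in> over_Ob U K \<and> Tgt H \<in> over_Ob U K \<and>
     is_functor (fst (Src H)) (fst (Tgt H)) (Fn H) \<and>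
     fcomp (fst (Src H)) (snd (Tgt H)) (Fn H) = snd (Src H)}"

definition over_Ce :: "'u set set \<Rightarrow> ('u, 'u) cat \<Rightarrow> 'u over_cell set" where
  "over_Ce U K = {\<theta>. Src \<theta> \<in> over_Ar U K \<and> Tgt \<theta> \<in> over_Ar U K \<and>
     Src (Tgt \<theta>) = Src (Src \<theta>) \<and> Tgt (Tgt \<theta>) = Tgt (Src \<theta>) \<and>
     nat_trans (fst (Src (Src \<theta>))) (fst (Tgt (Src \<theta>))) (Fn (Src \<theta>)) (Fn (Tgt \<theta>)) (Fn \<theta>) \<and>
     (\<forall>X\<in>Ob (fst (Src (Src \<theta>))).
        FAr (snd (Tgt (Src \<theta>))) (Fn \<theta> X) = Idn K (FOb (snd (Src (Src \<theta>))) X))}"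

definition over_comp :: "'u over_arr \<Rightarrow> 'u over_arr \<Rightarrow> 'u over_arr" where
  "over_comp G F = \<lparr>Src = Src F, Tgt = Tgt G, Fn = fcomp (fst (Src F)) (Fn G) (Fn F)\<rparr>"

definition Cat_over :: "'u set set \<Rightarrow> ('u, 'u) cat \<Rightarrow> ('u over, 'u over_arr, 'u over_cell) twocat"
where
  "Cat_over U K = \<lparr>
     Ob = over_Ob U K, Ar = over_Ar U K, Dom = Src, Cod = Tgt,
     Idn = (\<lambda>X. \<lparr>Src = X, Tgt = X, Fn = fid (fst X)\<rparr>),
     Comp = over_comp,
     Ce = over_Ce U K, Dom2 = Src, Cod2 = Tgt,
     Idn2 = (\<lambda>H. \<lparr>Src = H, Tgt = H,
       Fn = (\<lambda>X\<in>Ob (fst (Src H)). Idn (fst (Tgt H)) (FOb (Fn H) X))\<rparr>),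
     VComp = (\<lambda>\<tau> \<theta>. \<lparr>Src = Src \<theta>, Tgt = Tgt \<tau>,
       Fn = (\<lambda>X\<in>Ob (fst (Src (Src \<theta>))). Comp (fst (Tgt (Src \<theta>))) (Fn \<tau> X) (Fn \<theta> X))\<rparr>),
     HComp = (\<lambda>\<tau> \<theta>. \<lparr>Src = over_comp (Src \<tau>) (Src \<theta>), Tgt = over_comp (Tgt \<tau>) (Tgt \<theta>),
       Fn = (\<lambda>X\<in>Ob (fst (Src (Src \<theta>))). Comp (fst (Tgt (Src \<tau>)))
              (Fn \<tau> (FOb (Fn (Tgt \<theta>)) X)) (FAr (Fn (Src \<tau>)) (Fn \<theta> X)))\<rparr>)\<rparr>"


section \<open>Discrete 2-fibrations\<close>

definition cartesian ::
  "('o, 'a, 'm) cat_scheme \<Rightarrow> ('p, 'b, 'n) cat_scheme \<Rightarrow> ('o, 'a, 'p, 'b, 'k) functr_scheme \<Rightarrow>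
   'a \<Rightarrow> bool"
where
  "cartesian E C p \<phi> \<longleftrightarrow> \<phi> \<in> Ar E \<and>
     (\<forall>h\<in>Ar E. \<forall>w\<in>Ar C. Cod E h = Cod E \<phi> \<and>
        Dom C w = FOb p (Dom E h) \<and> Cod C w = FOb p (Dom E \<phi>) \<and> Comp C (FAr p \<phi>) w = FAr p h \<longrightarrow>
        (\<exists>!v. v \<in> Ar E \<and> Dom E v = Dom E h \<and> Cod E v = Dom E \<phi> \<and>
           FAr p v = w \<and> Comp E \<phi> v = h))"

text \<open>\<open>cl f X\<close> is the chosen cartesian arrow \<open>\<phi>(f, X)\<close>; its domain is \<open>f\<^sup>*X\<close>.\<close>

definition split_fibration ::
  "('o, 'a, 'm) cat_scheme \<Rightarrow> ('p, 'b, 'n) cat_scheme \<Rightarrow> ('o, 'a, 'p, 'b, 'k) functr_scheme \<Rightarrow>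
   ('b \<Rightarrow> 'o \<Rightarrow> 'a) \<Rightarrow> bool"
where
  "split_fibration E C p cl \<longleftrightarrow> is_functor E C p \<and>
     (\<forall>X\<in>Ob E. \<forall>f\<in>Ar C. Cod C f = FOb p X \<longrightarrow>
        cartesian E C p (cl f X) \<and> Cod E (cl f X) = X \<and> FAr p (cl f X) = f) \<and>
     (\<forall>X\<in>Ob E. cl (Idn C (FOb p X)) X = Idn E X) \<and>
     (\<forall>X\<in>Ob E. \<forall>g\<in>Ar C. \<forall>f\<in>Ar C. Cod C g = FOb p X \<and> Cod C f = Dom C g \<longrightarrow>
        cl (Comp C g f) X = Comp E (cl g X) (cl f (Dom E (cl g X))))"

definition discrete_opfibration ::
  "('o, 'a, 'm) cat_scheme \<Rightarrow> ('p, 'b, 'n) cat_scheme \<Rightarrow> ('o, 'a, 'p, 'b, 'k) functr_scheme \<Rightarrow> bool"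
where
  "discrete_opfibration E C p \<longleftrightarrow> is_functor E C p \<and>
     (\<forall>X\<in>Ob E. \<forall>f\<in>Ar C. Dom C f = FOb p X \<longrightarrow> (\<exists>!u. u \<in> Ar E \<and> Dom E u = X \<and> FAr p u = f))"

definition hom_functor :: "('o, 'a, 'c) twocat \<Rightarrow> ('o, 'a, 'c, 'p, 'b, 'd) twofunctr \<Rightarrow> 'o \<Rightarrow> 'o \<Rightarrow>
    ('a, 'c, 'b, 'd) functr" where
  "hom_functor E P X Y = \<lparr>FOb = restrict (FAr P) (Ob (hom_cat E X Y)),
     FAr = restrict (FCe P) (Ar (hom_cat E X Y))\<rparr>"

definition discrete_two_fibration ::
  "('o, 'a, 'c) twocat \<Rightarrow> ('p, 'b, 'd) twocat \<Rightarrow> ('o, 'a, 'c, 'p, 'b, 'd) twofunctr \<Rightarrow>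
   ('b \<Rightarrow> 'o \<Rightarrow> 'a) \<Rightarrow> bool"
where
  "discrete_two_fibration E B P cl \<longleftrightarrow>
     is_two_functor E B P \<and> split_fibration (under E) (under B) P cl \<and>
     (\<forall>X\<in>Ob E. \<forall>Y\<in>Ob E. discrete_opfibration (hom_cat E X Y) (hom_cat B (FOb P X) (FOb P Y))
        (hom_functor E P X Y))"

record 'u d2fib =
  Tot :: "('u, 'u, 'u) twocat"
  Proj :: "('u, 'u, 'u, 'u, 'u, 'u) twofunctr"
  Cl :: "'u \<Rightarrow> 'u \<Rightarrow> 'u"

type_synonym 'u d2fib_arr = "('u d2fib, ('u, 'u, 'u, 'u, 'u, 'u) twofunctr) tagged"
type_synonym 'u d2fib_cell = "('u d2fib_arr, 'u \<Rightarrow> 'u) tagged"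

definition d2fib_Ob :: "'u set set \<Rightarrow> ('u, 'u, 'u) twocat \<Rightarrow> 'u d2fib set" where
  "d2fib_Ob U B = {E. small_two_category U (Tot E) \<and>
     discrete_two_fibration (Tot E) B (Proj E) (Cl E)}"

definition d2fib_Ar :: "'u set set \<Rightarrow> ('u, 'u, 'u) twocat \<Rightarrow> 'u d2fib_arr set" where
  "d2fib_Ar U B = {H. Src H \<in> d2fib_Ob U B \<and> Tgt H \<in> d2fib_Ob U B \<and>
     is_two_functor (Tot (Src H)) (Tot (Tgt H)) (Fn H) \<and>
     tfcomp (Tot (Src H)) (Proj (Tgt H)) (Fn H) = Proj (Src H) \<and>
     (\<forall>X\<in>Ob (Tot (Src H)). \<forall>f\<in>Ar B. Cod B f = FOb (Proj (Src H)) X \<longrightarrow>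
        FAr (Fn H) (Cl (Src H) f X) = Cl (Tgt H) f (FOb (Fn H) X))}"

definition d2fib_Ce :: "'u set set \<Rightarrow> ('u, 'u, 'u) twocat \<Rightarrow> 'u d2fib_cell set" where
  "d2fib_Ce U B = {\<theta>. Src \<theta> \<in> d2fib_Ar U B \<and> Tgt \<theta> \<in> d2fib_Ar U B \<and>
     Src (Tgt \<theta>) = Src (Src \<theta>) \<and> Tgt (Tgt \<theta>) = Tgt (Src \<theta>) \<and>
     two_nat_trans (Tot (Src (Src \<theta>))) (Tot (Tgt (Src \<theta>))) (Fn (Src \<theta>)) (Fn (Tgt \<theta>)) (Fn \<theta>) \<and>
     (\<forall>X\<in>Ob (Tot (Src (Src \<theta>))).
        FAr (Proj (Tgt (Src \<theta>))) (Fn \<theta> X) = Idn B (FOb (Proj (Src (Src \<theta>))) X))}"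

definition d2fib_comp :: "'u d2fib_arr \<Rightarrow> 'u d2fib_arr \<Rightarrow> 'u d2fib_arr" where
  "d2fib_comp G F = \<lparr>Src = Src F, Tgt = Tgt G, Fn = tfcomp (Tot (Src F)) (Fn G) (Fn F)\<rparr>"

definition D2Fib ::
  "'u set set \<Rightarrow> ('u, 'u, 'u) twocat \<Rightarrow> ('u d2fib, 'u d2fib_arr, 'u d2fib_cell) twocat"
where
  "D2Fib U B = \<lparr>
     Ob = d2fib_Ob U B, Ar = d2fib_Ar U B, Dom = Src, Cod = Tgt,
     Idn = (\<lambda>E. \<lparr>Src = E, Tgt = E, Fn = tfid (Tot E)\<rparr>),
     Comp = d2fib_comp,
     Ce = d2fib_Ce U B, Dom2 = Src, Cod2 = Tgt,
     Idn2 = (\<lambda>H. \<lparr>Src = H, Tgt = H,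
       Fn = (\<lambda>X\<in>Ob (Tot (Src H)). Idn (Tot (Tgt H)) (FOb (Fn H) X))\<rparr>),
     VComp = (\<lambda>\<tau> \<theta>. \<lparr>Src = Src \<theta>, Tgt = Tgt \<tau>,
       Fn = (\<lambda>X\<in>Ob (Tot (Src (Src \<theta>))). Comp (Tot (Tgt (Src \<theta>))) (Fn \<tau> X) (Fn \<theta> X))\<rparr>),
     HComp = (\<lambda>\<tau> \<theta>. \<lparr>Src = d2fib_comp (Src \<tau>) (Src \<theta>), Tgt = d2fib_comp (Tgt \<tau>) (Tgt \<theta>),
       Fn = (\<lambda>X\<in>Ob (Tot (Src (Src \<theta>))). Comp (Tot (Tgt (Src \<tau>)))
              (Fn \<tau> (FOb (Fn (Tgt \<theta>)) X)) (FAr (Fn (Src \<tau>)) (Fn \<theta> X)))\<rparr>)\<rparr>"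


section \<open>Algebras for a 2-monad\<close>

text \<open>Only the data of a 2-monad enter the definition of its algebras; the arguments of \<open>Mult\<close>
  and \<open>Unit\<close> are the objects of the 2-category.\<close>

record ('o, 'a, 'c) monad_data =
  Tfun :: "('o, 'a, 'c, 'o, 'a, 'c) twofunctr"
  Mult :: "'o \<Rightarrow> 'a"
  Unit :: "'o \<Rightarrow> 'a"

type_synonym ('o, 'a) alg_arr = "('o \<times> 'a, 'a) tagged"
type_synonym ('o, 'a, 'c) alg_cell = "(('o, 'a) alg_arr, 'c) tagged"

definition alg_Ob :: "('o, 'a, 'c) twocat \<Rightarrow> ('o, 'a, 'c) monad_data \<Rightarrow> ('o \<times> 'a) set" where
  "alg_Ob K T = {(Q, M). Q \<in> Ob K \<and> M \<in> Ar K \<and> Dom K M = FOb (Tfun T) Q \<and> Cod K M = Q \<and>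
     Comp K M (Mult T Q) = Comp K M (FAr (Tfun T) M) \<and> Comp K M (Unit T Q) = Idn K Q}"

definition alg_Ar :: "('o, 'a, 'c) twocat \<Rightarrow> ('o, 'a, 'c) monad_data \<Rightarrow> ('o, 'a) alg_arr set" where
  "alg_Ar K T = {H. Src H \<in> alg_Ob K T \<and> Tgt H \<in> alg_Ob K T \<and>
     Fn H \<in> Ar K \<and> Dom K (Fn H) = fst (Src H) \<and> Cod K (Fn H) = fst (Tgt H) \<and>
     Comp K (Fn H) (snd (Src H)) = Comp K (snd (Tgt H)) (FAr (Tfun T) (Fn H))}"

definition alg_Ce :: "('o, 'a, 'c) twocat \<Rightarrow> ('o, 'a, 'c) monad_data \<Rightarrow> ('o, 'a, 'c) alg_cell set"
where
  "alg_Ce K T = {\<theta>. Src \<theta> \<in> alg_Ar K T \<and> Tgt \<theta> \<in> alg_Ar K T \<and>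
     Src (Tgt \<theta>) = Src (Src \<theta>) \<and> Tgt (Tgt \<theta>) = Tgt (Src \<theta>) \<and>
     Fn \<theta> \<in> Ce K \<and> Dom2 K (Fn \<theta>) = Fn (Src \<theta>) \<and> Cod2 K (Fn \<theta>) = Fn (Tgt \<theta>) \<and>
     HComp K (Fn \<theta>) (Idn2 K (snd (Src (Src \<theta>)))) =
       HComp K (Idn2 K (snd (Tgt (Src \<theta>)))) (FCe (Tfun T) (Fn \<theta>))}"

definition alg_comp ::
  "('o, 'a, 'c) twocat \<Rightarrow> ('o, 'a) alg_arr \<Rightarrow> ('o, 'a) alg_arr \<Rightarrow> ('o, 'a) alg_arr"
where
  "alg_comp K G F = \<lparr>Src = Src F, Tgt = Tgt G, Fn = Comp K (Fn G) (Fn F)\<rparr>"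

definition Alg :: "('o, 'a, 'c) twocat \<Rightarrow> ('o, 'a, 'c) monad_data \<Rightarrow>
    ('o \<times> 'a, ('o, 'a) alg_arr, ('o, 'a, 'c) alg_cell) twocat" where
  "Alg K T = \<lparr>
     Ob = alg_Ob K T, Ar = alg_Ar K T, Dom = Src, Cod = Tgt,
     Idn = (\<lambda>A. \<lparr>Src = A, Tgt = A, Fn = Idn K (fst A)\<rparr>),
     Comp = alg_comp K,
     Ce = alg_Ce K T, Dom2 = Src, Cod2 = Tgt,
     Idn2 = (\<lambda>H. \<lparr>Src = H, Tgt = H, Fn = Idn2 K (Fn H)\<rparr>),
     VComp = (\<lambda>\<tau> \<theta>. \<lparr>Src = Src \<theta>, Tgt = Tgt \<tau>, Fn = VComp K (Fn \<tau>) (Fn \<theta>)\<rparr>),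
     HComp = (\<lambda>\<tau> \<theta>. \<lparr>Src = alg_comp K (Src \<tau>) (Src \<theta>), Tgt = alg_comp K (Tgt \<tau>) (Tgt \<theta>),
       Fn = HComp K (Fn \<tau>) (Fn \<theta>)\<rparr>)\<rparr>"


section \<open>The category of squares\<close>

text \<open>A square from \<open>sqf\<close> to \<open>sqg\<close>, given by \<open>(sqh, sqk, sqc)\<close> with
  \<open>sqc : sqk \<circ> sqf \<Rightarrow> sqg \<circ> sqh\<close>.\<close>

record ('a, 'c) square =
  sqf :: 'a
  sqg :: 'a
  sqh :: 'a
  sqk :: 'a
  sqc :: 'c

definition Sq :: "('o, 'a, 'c) twocat \<Rightarrow> ('a, ('a, 'c) square) cat" where
  "Sq B = \<lparr>
     Ob = Ar B,
     Ar = {s. sqf s \<in> Ar B \<and> sqg s \<in> Ar B \<and> sqh s \<in> Ar B \<and> sqk s \<in> Ar B \<and> sqc s \<in> Ce B \<and>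
       Dom B (sqh s) = Dom B (sqf s) \<and> Cod B (sqh s) = Dom B (sqg s) \<and>
       Dom B (sqk s) = Cod B (sqf s) \<and> Cod B (sqk s) = Cod B (sqg s) \<and>
       Dom2 B (sqc s) = Comp B (sqk s) (sqf s) \<and> Cod2 B (sqc s) = Comp B (sqg s) (sqh s)},
     Dom = sqf, Cod = sqg,
     Idn = (\<lambda>f. \<lparr>sqf = f, sqg = f, sqh = Idn B (Dom B f), sqk = Idn B (Cod B f), sqc = Idn2 B f\<rparr>),
     Comp = (\<lambda>t s. \<lparr>sqf = sqf s, sqg = sqg t,
       sqh = Comp B (sqh t) (sqh s), sqk = Comp B (sqk t) (sqk s),
       sqc = VComp B (HComp B (sqc t) (Idn2 B (sqh s))) (HComp B (Idn2 B (sqk t)) (sqc s))\<rparr>)\<rparr>"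

definition src_functor :: "('o, 'a, 'c) twocat \<Rightarrow> ('a, ('a, 'c) square, 'o, 'a) functr" where
  "src_functor B = \<lparr>FOb = (\<lambda>f\<in>Ob (Sq B). Dom B f), FAr = (\<lambda>s\<in>Ar (Sq B). sqh s)\<rparr>"

definition tgt_functor :: "('o, 'a, 'c) twocat \<Rightarrow> ('a, ('a, 'c) square, 'o, 'a) functr" where
  "tgt_functor B = \<lparr>FOb = (\<lambda>f\<in>Ob (Sq B). Cod B f), FAr = (\<lambda>s\<in>Ar (Sq B). sqk s)\<rparr>"

text \<open>Horizontal pasting of \<open>s = (h, k, \<alpha>)\<close> and \<open>t = (k, l, \<beta>)\<close> along \<open>k\<close>, and its identities.\<close>

definition sq_hcomp ::
  "('o, 'a, 'c) twocat \<Rightarrow> ('a, 'c) square \<Rightarrow> ('a, 'c) square \<Rightarrow> ('a, 'c) square"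
where
  "sq_hcomp B t s = \<lparr>sqf = Comp B (sqf t) (sqf s), sqg = Comp B (sqg t) (sqg s),
     sqh = sqh s, sqk = sqk t,
     sqc = VComp B (HComp B (Idn2 B (sqg t)) (sqc s)) (HComp B (sqc t) (Idn2 B (sqf s)))\<rparr>"

definition sq_hid :: "('o, 'a, 'c) twocat \<Rightarrow> 'a \<Rightarrow> ('a, 'c) square" where
  "sq_hid B k = \<lparr>sqf = Idn B (Dom B k), sqg = Idn B (Cod B k), sqh = k, sqk = k, sqc = Idn2 B k\<rparr>"


section \<open>The 2-monad of squares\<close>

definition pullback :: "('o, 'a) cat \<Rightarrow> ('p, 'b) cat \<Rightarrow> ('o, 'a, 'q, 'd) functr \<Rightarrow>
    ('p, 'b, 'q, 'd) functr \<Rightarrow> ('o \<times> 'p, 'a \<times> 'b) cat" where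
  "pullback C D F G = \<lparr>
     Ob = {(X, Y). X \<in> Ob C \<and> Y \<in> Ob D \<and> FOb F X = FOb G Y},
     Ar = {(u, v). u \<in> Ar C \<and> v \<in> Ar D \<and> FAr F u = FAr G v},
     Dom = (\<lambda>(u, v). (Dom C u, Dom D v)), Cod = (\<lambda>(u, v). (Cod C u, Cod D v)),
     Idn = (\<lambda>(X, Y). (Idn C X, Idn D Y)),
     Comp = (\<lambda>(u', v') (u, v). (Comp C u' u, Comp D v' v))\<rparr>"

text \<open>Objects of \<open>T (C, F)\<close> are codes of pairs \<open>(f, X)\<close>, arrows are codes of pairs of a square
  and an arrow of \<open>C\<close>.\<close>

definition T_ob :: "('u, 'u, 'u) twocat \<Rightarrow> 'u over \<Rightarrow> 'u over" where
  "T_ob B Q = (let TC = recode (pullback (Sq B) (fst Q) (tgt_functor B) (snd Q)) in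
     (TC, \<lparr>FOb = (\<lambda>z\<in>Ob TC. case dec z of (f :: 'u, X :: 'u) \<Rightarrow> FOb (src_functor B) f),
           FAr = (\<lambda>w\<in>Ar TC. case dec w of (s :: ('u, 'u) square, u :: 'u) \<Rightarrow>
             FAr (src_functor B) s)\<rparr>))"

definition T_ar :: "('u, 'u, 'u) twocat \<Rightarrow> 'u over_arr \<Rightarrow> 'u over_arr" where
  "T_ar B H = \<lparr>Src = T_ob B (Src H), Tgt = T_ob B (Tgt H),
     Fn = \<lparr>FOb = (\<lambda>z\<in>Ob (fst (T_ob B (Src H))). case dec z of (f :: 'u, X) \<Rightarrow>
              enc (f, FOb (Fn H) X)),
           FAr = (\<lambda>w\<in>Ar (fst (T_ob B (Src H))). case dec w of (s :: ('u, 'u) square, u) \<Rightarrow>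
              enc (s, FAr (Fn H) u))\<rparr>\<rparr>"

definition T_ce :: "('u, 'u, 'u) twocat \<Rightarrow> 'u over_cell \<Rightarrow> 'u over_cell" where
  "T_ce B \<theta> = \<lparr>Src = T_ar B (Src \<theta>), Tgt = T_ar B (Tgt \<theta>),
     Fn = (\<lambda>z\<in>Ob (fst (T_ob B (Src (Src \<theta>)))). case dec z of (f, X) \<Rightarrow>
        enc (Idn (Sq B) f, Fn \<theta> X))\<rparr>"

definition T_mult :: "('u, 'u, 'u) twocat \<Rightarrow> 'u over \<Rightarrow> 'u over_arr" where
  "T_mult B Q = \<lparr>Src = T_ob B (T_ob B Q), Tgt = T_ob B Q,
     Fn = \<lparr>FOb = (\<lambda>z\<in>Ob (fst (T_ob B (T_ob B Q))).
              case dec z of (f, y :: 'u) \<Rightarrow> case dec y of (g, X :: 'u) \<Rightarrow> enc (Comp B g f, X)),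
           FAr = (\<lambda>w\<in>Ar (fst (T_ob B (T_ob B Q))).
              case dec w of (s, v :: 'u) \<Rightarrow> case dec v of (t, u :: 'u) \<Rightarrow>
                enc (sq_hcomp B t s, u))\<rparr>\<rparr>"

definition T_unit :: "('u, 'u, 'u) twocat \<Rightarrow> 'u over \<Rightarrow> 'u over_arr" where
  "T_unit B Q = \<lparr>Src = Q, Tgt = T_ob B Q,
     Fn = \<lparr>FOb = (\<lambda>X\<in>Ob (fst Q). enc (Idn B (FOb (snd Q) X), X)),
           FAr = (\<lambda>u\<in>Ar (fst Q). enc (sq_hid B (FAr (snd Q) u), u))\<rparr>\<rparr>"

definition sq_monad :: "'u set set \<Rightarrow> ('u, 'u, 'u) twocat \<Rightarrow>
    ('u over, 'u over_arr, 'u over_cell) monad_data" where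
  "sq_monad U B = \<lparr>
     Tfun = \<lparr>FOb = restrict (T_ob B) (over_Ob U (under B)),
             FAr = restrict (T_ar B) (over_Ar U (under B)),
             FCe = restrict (T_ce B) (over_Ce U (under B))\<rparr>,
     Mult = restrict (T_mult B) (over_Ob U (under B)),
     Unit = restrict (T_unit B) (over_Ob U (under B))\<rparr>"

definition TAlg :: "'u set set \<Rightarrow> ('u, 'u, 'u) twocat \<Rightarrow>
    ('u over \<times> 'u over_arr, ('u over, 'u over_arr) alg_arr,
     ('u over, 'u over_arr, 'u over_cell) alg_cell) twocat" where
  "TAlg U B = Alg (Cat_over U (under B)) (sq_monad U B)"

end

theory Submission
  imports Defs
begin

text \<open>A discrete 2-fibration lets squares act on its arrows: given a square \<open>(h, k, \<alpha>)\<close> from \<open>f\<close> to \<open>g\<close>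
  and \<open>u : X \<rightarrow> Y\<close> over \<open>k\<close>, lift \<open>\<alpha>\<close> to a 2-cell out of \<open>u \<circ> \<phi>(f, X)\<close> and factor its target through
  \<open>\<phi>(g, Y)\<close>. The result is the only arrow \<open>v\<close> over \<open>h\<close> admitting a 2-cell
  \<open>u \<circ> \<phi>(f, X) \<Rightarrow> \<phi>(g, Y) \<circ> v\<close> over \<open>\<alpha>\<close>, so every law of an algebra follows by exhibiting a pasted 2-cell.
  Conversely an action determines the splitting, as \<open>\<phi>(f, X)\<close> is the action of \<open>(f, 1, id)\<close> on the
  identity of \<open>X\<close>, and the 2-cells, as a 2-cell \<open>u \<Rightarrow> v\<close> over \<open>\<alpha>\<close> exists, and is unique, exactly if \<open>\<alpha>\<close>
  seen as a square between identities takes \<open>u\<close> to \<open>v\<close>. Uniqueness of lifts makes 2-naturality and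
  compatibility with the actions automatic for vertical transformations. Hence the comparison
  2-functor is surjective on objects (on the nose) and bijective on arrows and on 2-cells between
  given boundaries.\<close>

section \<open>Two-categories and 2-functors\<close>

text \<open>The comparison is not injective on objects: it forgets the names of the 2-cells of a
  discrete 2-fibration and keeps only how 2-cells of the base move its arrows. Renamed 2-cells have
  the same image, so a quasi-inverse must choose preimages. Surjectivity on the nose is possible
  because the total 2-category of an algebra keeps the given objects and arrows and codes only its
  2-cells. That the structures are 2-categories at all is a large part of the work. In the slice the
  laws are checked componentwise. Algebras inherit them along the forgetful 2-functor, and discrete
  2-fibrations along the comparison itself, which is therefore set up while its domain is known to
  satisfy only typing conditions. Codes are the other obstacle: all cells of small categories live
  in one type, so the cells of \<open>T_ob B Q\<close> are values of arbitrary injections. Actions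
  \<open>mo\<close> and \<open>ma\<close> strip these off, and the core argument runs in
  \<open>sq_algebra\<close> and \<open>discrete_two_fib\<close>, for cells of arbitrary
  types.\<close>

lemma under_simps [simp]:
  "Ob (under B) = Ob B" "Ar (under B) = Ar B" "Dom (under B) = Dom B" "Cod (under B) = Cod B"
  "Idn (under B) = Idn B" "Comp (under B) = Comp B"
  by (simp_all add: under_def cat.truncate_def)

lemma category_under [simp]: "category (under B) \<longleftrightarrow> category B"
  by (simp add: category_def)

context category begin

lemma
  shows Comp_Idn': "\<lbrakk>f \<in> Ar C; Dom C f = X\<rbrakk> \<Longrightarrow> Comp C f (Idn C X) = f"
    and Idn_Comp': "\<lbrakk>f \<in> Ar C; Cod C f = X\<rbrakk> \<Longrightarrow> Comp C (Idn C X) f = f"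
    and Idn_Idn: "X \<in> Ob C \<Longrightarrow> Comp C (Idn C X) (Idn C X) = Idn C X"
  using Comp_Idn Idn_Comp Comp_Idn[of "Idn C X"] by (auto simp: Idn_Ar Dom_Idn)

lemmas cat_typing = Dom_Ob Cod_Ob Idn_Ar Dom_Idn Cod_Idn Comp_Ar Dom_Comp Cod_Comp

end

lemma is_functor_under [simp]:
  "is_functor (under C) D F \<longleftrightarrow> is_functor C D F" "is_functor C' (under D') F' \<longleftrightarrow> is_functor C' D' F'"
  by (simp_all add: is_functor_def)

text \<open>The typing axioms of a 2-category only, so that its equations can be reflected along a
  faithful 2-functor.\<close>

locale pre_two_category =
  fixes B :: "('o, 'a, 'c) twocat"
  assumes Dom_Ob: "f \<in> Ar B \<Longrightarrow> Dom B f \<in> Ob B"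
    and Cod_Ob: "f \<in> Ar B \<Longrightarrow> Cod B f \<in> Ob B"
    and Idn_Ar: "X \<in> Ob B \<Longrightarrow> Idn B X \<in> Ar B"
    and Dom_Idn: "X \<in> Ob B \<Longrightarrow> Dom B (Idn B X) = X"
    and Cod_Idn: "X \<in> Ob B \<Longrightarrow> Cod B (Idn B X) = X"
    and Comp_Ar: "\<lbrakk>f \<in> Ar B; g \<in> Ar B; Dom B g = Cod B f\<rbrakk> \<Longrightarrow> Comp B g f \<in> Ar B"
    and Dom_Comp: "\<lbrakk>f \<in> Ar B; g \<in> Ar B; Dom B g = Cod B f\<rbrakk> \<Longrightarrow> Dom B (Comp B g f) = Dom B f"
    and Cod_Comp: "\<lbrakk>f \<in> Ar B; g \<in> Ar B; Dom B g = Cod B f\<rbrakk> \<Longrightarrow> Cod B (Comp B g f) = Cod B g"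
    and Dom2_Ar: "\<alpha> \<in> Ce B \<Longrightarrow> Dom2 B \<alpha> \<in> Ar B"
    and Cod2_Ar: "\<alpha> \<in> Ce B \<Longrightarrow> Cod2 B \<alpha> \<in> Ar B"
    and Dom_Cod2: "\<alpha> \<in> Ce B \<Longrightarrow> Dom B (Cod2 B \<alpha>) = Dom B (Dom2 B \<alpha>)"
    and Cod_Cod2: "\<alpha> \<in> Ce B \<Longrightarrow> Cod B (Cod2 B \<alpha>) = Cod B (Dom2 B \<alpha>)"
    and Idn2_Ce: "f \<in> Ar B \<Longrightarrow> Idn2 B f \<in> Ce B"
    and Dom2_Idn2: "f \<in> Ar B \<Longrightarrow> Dom2 B (Idn2 B f) = f"
    and Cod2_Idn2: "f \<in> Ar B \<Longrightarrow> Cod2 B (Idn2 B f) = f"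
    and VComp_Ce: "\<lbrakk>\<alpha> \<in> Ce B; \<beta> \<in> Ce B; Dom2 B \<beta> = Cod2 B \<alpha>\<rbrakk> \<Longrightarrow> VComp B \<beta> \<alpha> \<in> Ce B"
    and Dom2_VComp: "\<lbrakk>\<alpha> \<in> Ce B; \<beta> \<in> Ce B; Dom2 B \<beta> = Cod2 B \<alpha>\<rbrakk> \<Longrightarrow> Dom2 B (VComp B \<beta> \<alpha>) = Dom2 B \<alpha>"
    and Cod2_VComp: "\<lbrakk>\<alpha> \<in> Ce B; \<beta> \<in> Ce B; Dom2 B \<beta> = Cod2 B \<alpha>\<rbrakk> \<Longrightarrow> Cod2 B (VComp B \<beta> \<alpha>) = Cod2 B \<beta>"
    and HComp_Ce: "\<lbrakk>\<alpha> \<in> Ce B; \<beta> \<in> Ce B; Dom B (Dom2 B \<beta>) = Cod B (Dom2 B \<alpha>)\<rbrakk> \<Longrightarrow> HComp B \<beta> \<alpha> \<in> Ce B"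
    and Dom2_HComp: "\<lbrakk>\<alpha> \<in> Ce B; \<beta> \<in> Ce B; Dom B (Dom2 B \<beta>) = Cod B (Dom2 B \<alpha>)\<rbrakk>
      \<Longrightarrow> Dom2 B (HComp B \<beta> \<alpha>) = Comp B (Dom2 B \<beta>) (Dom2 B \<alpha>)"
    and Cod2_HComp: "\<lbrakk>\<alpha> \<in> Ce B; \<beta> \<in> Ce B; Dom B (Dom2 B \<beta>) = Cod B (Dom2 B \<alpha>)\<rbrakk>
      \<Longrightarrow> Cod2 B (HComp B \<beta> \<alpha>) = Comp B (Cod2 B \<beta>) (Cod2 B \<alpha>)"
begin

lemmas typing =
  Dom_Ob Cod_Ob Idn_Ar Dom_Idn Cod_Idn Comp_Ar Dom_Comp Cod_Comp Dom2_Ar Cod2_Ar Dom_Cod2 Cod_Cod2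
  Idn2_Ce Dom2_Idn2 Cod2_Idn2 VComp_Ce Dom2_VComp Cod2_VComp HComp_Ce Dom2_HComp Cod2_HComp

end

lemma (in two_category) pre_two_category: "pre_two_category B"
proof
  note u = under[simplified] and v = vert[unfolded vert_cat_def] and h = horiz[unfolded horiz_cat_def]
  show "\<And>f. f \<in> Ar B \<Longrightarrow> Dom B f \<in> Ob B" "\<And>f. f \<in> Ar B \<Longrightarrow> Cod B f \<in> Ob B"
    "\<And>X. X \<in> Ob B \<Longrightarrow> Idn B X \<in> Ar B" "\<And>X. X \<in> Ob B \<Longrightarrow> Dom B (Idn B X) = X"
    "\<And>X. X \<in> Ob B \<Longrightarrow> Cod B (Idn B X) = X"
    "\<And>f g. \<lbrakk>f \<in> Ar B; g \<in> Ar B; Dom B g = Cod B f\<rbrakk> \<Longrightarrow> Comp B g f \<in> Ar B"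
    "\<And>f g. \<lbrakk>f \<in> Ar B; g \<in> Ar B; Dom B g = Cod B f\<rbrakk> \<Longrightarrow> Dom B (Comp B g f) = Dom B f"
    "\<And>f g. \<lbrakk>f \<in> Ar B; g \<in> Ar B; Dom B g = Cod B f\<rbrakk> \<Longrightarrow> Cod B (Comp B g f) = Cod B g"
    using u by (auto simp: category_def)
  show "\<And>\<alpha>. \<alpha> \<in> Ce B \<Longrightarrow> Dom2 B \<alpha> \<in> Ar B" "\<And>\<alpha>. \<alpha> \<in> Ce B \<Longrightarrow> Cod2 B \<alpha> \<in> Ar B"
    "\<And>f. f \<in> Ar B \<Longrightarrow> Idn2 B f \<in> Ce B" "\<And>f. f \<in> Ar B \<Longrightarrow> Dom2 B (Idn2 B f) = f"
    "\<And>f. f \<in> Ar B \<Longrightarrow> Cod2 B (Idn2 B f) = f"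
    "\<And>\<alpha> \<beta>. \<lbrakk>\<alpha> \<in> Ce B; \<beta> \<in> Ce B; Dom2 B \<beta> = Cod2 B \<alpha>\<rbrakk> \<Longrightarrow> VComp B \<beta> \<alpha> \<in> Ce B"
    "\<And>\<alpha> \<beta>. \<lbrakk>\<alpha> \<in> Ce B; \<beta> \<in> Ce B; Dom2 B \<beta> = Cod2 B \<alpha>\<rbrakk> \<Longrightarrow> Dom2 B (VComp B \<beta> \<alpha>) = Dom2 B \<alpha>"
    "\<And>\<alpha> \<beta>. \<lbrakk>\<alpha> \<in> Ce B; \<beta> \<in> Ce B; Dom2 B \<beta> = Cod2 B \<alpha>\<rbrakk> \<Longrightarrow> Cod2 B (VComp B \<beta> \<alpha>) = Cod2 B \<beta>"
    using v by (auto simp: category_def)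
  show "\<And>\<alpha> \<beta>. \<lbrakk>\<alpha> \<in> Ce B; \<beta> \<in> Ce B; Dom B (Dom2 B \<beta>) = Cod B (Dom2 B \<alpha>)\<rbrakk> \<Longrightarrow> HComp B \<beta> \<alpha> \<in> Ce B"
    using h by (auto simp: category_def)
qed (fact Dom_globular Cod_globular Dom2_HComp Cod2_HComp)+

context two_category begin

lemmas typing = pre_two_category.typing [OF pre_two_category]

lemma
  shows Comp_Idn: "f \<in> Ar B \<Longrightarrow> Comp B f (Idn B (Dom B f)) = f"
    and Idn_Comp: "f \<in> Ar B \<Longrightarrow> Comp B (Idn B (Cod B f)) f = f"
    and Comp_assoc: "\<lbrakk>f \<in> Ar B; g \<in> Ar B; h \<in> Ar B; Dom B g = Cod B f; Dom B h = Cod B g\<rbrakk>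
      \<Longrightarrow> Comp B h (Comp B g f) = Comp B (Comp B h g) f"
  using under by (auto simp: category_def)

lemma category_self: "category B"
  using under by simp

lemmas Comp_Idn' = category.Comp_Idn'[OF category_self]
  and Idn_Comp' = category.Idn_Comp'[OF category_self]
  and Idn_Idn = category.Idn_Idn[OF category_self]

lemma
  shows VComp_Idn2: "\<alpha> \<in> Ce B \<Longrightarrow> VComp B \<alpha> (Idn2 B (Dom2 B \<alpha>)) = \<alpha>"
    and Idn2_VComp: "\<alpha> \<in> Ce B \<Longrightarrow> VComp B (Idn2 B (Cod2 B \<alpha>)) \<alpha> = \<alpha>"
    and VComp_assoc: "\<lbrakk>\<alpha> \<in> Ce B; \<beta> \<in> Ce B; \<gamma> \<in> Ce B; Dom2 B \<beta> = Cod2 B \<alpha>; Dom2 B \<gamma> = Cod2 B \<beta>\<rbrakk>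
      \<Longrightarrow> VComp B \<gamma> (VComp B \<beta> \<alpha>) = VComp B (VComp B \<gamma> \<beta>) \<alpha>"
  using vert by (auto simp: category_def vert_cat_def)

lemma
  shows HComp_unit: "\<alpha> \<in> Ce B \<Longrightarrow> HComp B \<alpha> (Idn2 B (Idn B (Dom B (Dom2 B \<alpha>)))) = \<alpha>"
    and unit_HComp: "\<alpha> \<in> Ce B \<Longrightarrow> HComp B (Idn2 B (Idn B (Cod B (Dom2 B \<alpha>)))) \<alpha> = \<alpha>"
    and HComp_assoc: "\<lbrakk>\<alpha> \<in> Ce B; \<beta> \<in> Ce B; \<gamma> \<in> Ce B; Dom B (Dom2 B \<beta>) = Cod B (Dom2 B \<alpha>);
        Dom B (Dom2 B \<gamma>) = Cod B (Dom2 B \<beta>)\<rbrakk>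
      \<Longrightarrow> HComp B \<gamma> (HComp B \<beta> \<alpha>) = HComp B (HComp B \<gamma> \<beta>) \<alpha>"
  using horiz typing by (auto simp: category_def horiz_cat_def)

end

section \<open>Unit laws and whiskering\<close>

context two_category begin

lemma
  shows VComp_Idn2': "\<lbrakk>\<alpha> \<in> Ce B; Dom2 B \<alpha> = f\<rbrakk> \<Longrightarrow> VComp B \<alpha> (Idn2 B f) = \<alpha>"
    and Idn2_VComp': "\<lbrakk>\<alpha> \<in> Ce B; Cod2 B \<alpha> = f\<rbrakk> \<Longrightarrow> VComp B (Idn2 B f) \<alpha> = \<alpha>"
    and HComp_unit': "\<lbrakk>\<alpha> \<in> Ce B; Dom B (Dom2 B \<alpha>) = X\<rbrakk> \<Longrightarrow> HComp B \<alpha> (Idn2 B (Idn B X)) = \<alpha>"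
    and unit_HComp': "\<lbrakk>\<alpha> \<in> Ce B; Cod B (Dom2 B \<alpha>) = X\<rbrakk> \<Longrightarrow> HComp B (Idn2 B (Idn B X)) \<alpha> = \<alpha>"
  using VComp_Idn2 Idn2_VComp HComp_unit unit_HComp by auto

lemmas unit_laws = Comp_Idn' Idn_Comp' Idn_Idn VComp_Idn2' Idn2_VComp' HComp_unit' unit_HComp'

text \<open>The interchange law in which \<open>Idn2 B f\<close> is split as its vertical composite
  with itself.\<close>

lemma whisker_left_VComp:
  "\<lbrakk>\<alpha> \<in> Ce B; \<beta> \<in> Ce B; f \<in> Ar B; Dom2 B \<beta> = Cod2 B \<alpha>; Dom B f = Cod B (Dom2 B \<alpha>)\<rbrakk>
    \<Longrightarrow> HComp B (Idn2 B f) (VComp B \<beta> \<alpha>) = VComp B (HComp B (Idn2 B f) \<beta>) (HComp B (Idn2 B f) \<alpha>)"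
  using interchange[of \<alpha> \<beta> "Idn2 B f" "Idn2 B f"] by (simp add: typing VComp_Idn2')

lemma whisker_right_VComp:
  "\<lbrakk>\<alpha> \<in> Ce B; \<beta> \<in> Ce B; f \<in> Ar B; Dom2 B \<beta> = Cod2 B \<alpha>; Cod B f = Dom B (Dom2 B \<alpha>)\<rbrakk>
    \<Longrightarrow> HComp B (VComp B \<beta> \<alpha>) (Idn2 B f) = VComp B (HComp B \<beta> (Idn2 B f)) (HComp B \<alpha> (Idn2 B f))"
  using interchange[of "Idn2 B f" "Idn2 B f" \<alpha> \<beta>] by (simp add: typing VComp_Idn2')

lemma whisker_left_Comp:
  "\<lbrakk>\<alpha> \<in> Ce B; f \<in> Ar B; g \<in> Ar B; Dom B g = Cod B (Dom2 B \<alpha>); Dom B f = Cod B g\<rbrakk>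
    \<Longrightarrow> HComp B (Idn2 B f) (HComp B (Idn2 B g) \<alpha>) = HComp B (Idn2 B (Comp B f g)) \<alpha>"
  by (simp add: HComp_assoc HComp_Idn2 typing)

lemma whisker_right_Comp:
  "\<lbrakk>\<alpha> \<in> Ce B; f \<in> Ar B; g \<in> Ar B; Cod B f = Dom B (Dom2 B \<alpha>); Cod B g = Dom B f\<rbrakk>
    \<Longrightarrow> HComp B (HComp B \<alpha> (Idn2 B f)) (Idn2 B g) = HComp B \<alpha> (Idn2 B (Comp B f g))"
  by (simp add: HComp_assoc[symmetric] HComp_Idn2 typing)

lemma whisker_left_right:
  "\<lbrakk>\<alpha> \<in> Ce B; f \<in> Ar B; g \<in> Ar B; Cod B f = Dom B (Dom2 B \<alpha>); Dom B g = Cod B (Dom2 B \<alpha>)\<rbrakk>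
    \<Longrightarrow> HComp B (HComp B (Idn2 B g) \<alpha>) (Idn2 B f) = HComp B (Idn2 B g) (HComp B \<alpha> (Idn2 B f))"
  by (simp add: HComp_assoc typing)

text \<open>A normal form for pastings: every whiskering is pushed onto a single 2-cell and
  neighbouring 1-cells are merged, so that pastings can be compared as vertical composites.\<close>

lemmas whisker = whisker_left_VComp whisker_right_VComp whisker_left_Comp whisker_right_Comp
  whisker_left_right HComp_Idn2

text \<open>Interchange after inserting the identities of the target of \<alpha> and of the source
  of \<beta>. The right side is the composition formula of \<open>Sq\<close> for squares between
  identities.\<close>

lemma HComp_conv_left_right:
  assumes "\<alpha> \<in> Ce B" "\<beta> \<in> Ce B" "Dom B (Dom2 B \<beta>) = Cod B (Dom2 B \<alpha>)"
  shows "HComp B \<beta> \<alpha> = VComp B (HComp B \<beta> (Idn2 B (Cod2 B \<alpha>))) (HComp B (Idn2 B (Dom2 B \<beta>)) \<alpha>)"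
  using assms interchange[of \<alpha> "Idn2 B (Cod2 B \<alpha>)" "Idn2 B (Dom2 B \<beta>)" \<beta>]
  by (simp add: typing unit_laws)

end

lemma (in pre_two_category) two_categoryI:
  assumes "\<And>f. f \<in> Ar B \<Longrightarrow> Comp B f (Idn B (Dom B f)) = f"
    and "\<And>f. f \<in> Ar B \<Longrightarrow> Comp B (Idn B (Cod B f)) f = f"
    and "\<And>f g h. \<lbrakk>f \<in> Ar B; g \<in> Ar B; h \<in> Ar B; Dom B g = Cod B f; Dom B h = Cod B g\<rbrakk>
      \<Longrightarrow> Comp B h (Comp B g f) = Comp B (Comp B h g) f"
    and "\<And>\<alpha>. \<alpha> \<in> Ce B \<Longrightarrow> VComp B \<alpha> (Idn2 B (Dom2 B \<alpha>)) = \<alpha>"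
    and "\<And>\<alpha>. \<alpha> \<in> Ce B \<Longrightarrow> VComp B (Idn2 B (Cod2 B \<alpha>)) \<alpha> = \<alpha>"
    and "\<And>\<alpha> \<beta> \<gamma>. \<lbrakk>\<alpha> \<in> Ce B; \<beta> \<in> Ce B; \<gamma> \<in> Ce B; Dom2 B \<beta> = Cod2 B \<alpha>; Dom2 B \<gamma> = Cod2 B \<beta>\<rbrakk>
      \<Longrightarrow> VComp B \<gamma> (VComp B \<beta> \<alpha>) = VComp B (VComp B \<gamma> \<beta>) \<alpha>"
    and "\<And>\<alpha>. \<alpha> \<in> Ce B \<Longrightarrow> HComp B \<alpha> (Idn2 B (Idn B (Dom B (Dom2 B \<alpha>)))) = \<alpha>"
    and "\<And>\<alpha>. \<alpha> \<in> Ce B \<Longrightarrow> HComp B (Idn2 B (Idn B (Cod B (Dom2 B \<alpha>)))) \<alpha> = \<alpha>"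
    and "\<And>\<alpha> \<beta> \<gamma>. \<lbrakk>\<alpha> \<in> Ce B; \<beta> \<in> Ce B; \<gamma> \<in> Ce B; Dom B (Dom2 B \<beta>) = Cod B (Dom2 B \<alpha>);
        Dom B (Dom2 B \<gamma>) = Cod B (Dom2 B \<beta>)\<rbrakk>
      \<Longrightarrow> HComp B \<gamma> (HComp B \<beta> \<alpha>) = HComp B (HComp B \<gamma> \<beta>) \<alpha>"
    and "\<And>f g. \<lbrakk>f \<in> Ar B; g \<in> Ar B; Dom B g = Cod B f\<rbrakk>
      \<Longrightarrow> HComp B (Idn2 B g) (Idn2 B f) = Idn2 B (Comp B g f)"
    and "\<And>\<alpha> \<alpha>' \<beta> \<beta>'. \<lbrakk>\<alpha> \<in> Ce B; \<alpha>' \<in> Ce B; \<beta> \<in> Ce B; \<beta>' \<in> Ce B;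
        Dom2 B \<alpha>' = Cod2 B \<alpha>; Dom2 B \<beta>' = Cod2 B \<beta>; Dom B (Dom2 B \<beta>) = Cod B (Dom2 B \<alpha>)\<rbrakk>
      \<Longrightarrow> HComp B (VComp B \<beta>' \<beta>) (VComp B \<alpha>' \<alpha>) = VComp B (HComp B \<beta>' \<alpha>') (HComp B \<beta> \<alpha>)"
  shows "two_category B"
proof (rule two_category.intro)
  show "category (under B)" using typing assms(1-3) unfolding category_under category_def by simp
  show "category (vert_cat B)" using typing assms(4-6) unfolding vert_cat_def category_def by simp
  show "category (horiz_cat B)" using typing assms(7-9) unfolding horiz_cat_def category_def by simp
qed (use typing assms in simp_all)

section \<open>Rules for functors and 2-functors\<close>

locale functor_on =
  fixes C :: "('o, 'a, 'm) cat_scheme" and D :: "('p, 'b, 'n) cat_scheme"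
    and F :: "('o, 'a, 'p, 'b, 'k) functr_scheme"
  assumes is_functor: "is_functor C D F"
begin

lemma
  shows FOb_ext: "FOb F \<in> Ob C \<rightarrow>\<^sub>E Ob D" and FAr_ext: "FAr F \<in> Ar C \<rightarrow>\<^sub>E Ar D"
    and F_Ob: "X \<in> Ob C \<Longrightarrow> FOb F X \<in> Ob D"
    and F_Ar: "f \<in> Ar C \<Longrightarrow> FAr F f \<in> Ar D"
    and F_Dom: "f \<in> Ar C \<Longrightarrow> Dom D (FAr F f) = FOb F (Dom C f)"
    and F_Cod: "f \<in> Ar C \<Longrightarrow> Cod D (FAr F f) = FOb F (Cod C f)"
    and F_Idn: "X \<in> Ob C \<Longrightarrow> FAr F (Idn C X) = Idn D (FOb F X)"
    and F_Comp: "\<lbrakk>f \<in> Ar C; g \<in> Ar C; Dom C g = Cod C f\<rbrakk>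
      \<Longrightarrow> FAr F (Comp C g f) = Comp D (FAr F g) (FAr F f)"
  using is_functor by (auto simp: is_functor_def)

lemmas functor_simps = F_Ob F_Ar F_Dom F_Cod F_Idn F_Comp

end

locale two_functor =
  fixes C :: "('o, 'a, 'c) twocat" and D :: "('p, 'b, 'd) twocat"
    and F :: "('o, 'a, 'c, 'p, 'b, 'd) twofunctr"
  assumes is_two_functor: "is_two_functor C D F"
begin

sublocale functor_on C D F
  using is_two_functor by unfold_locales (simp add: is_two_functor_def)

lemma
  shows FCe_ext: "FCe F \<in> Ce C \<rightarrow>\<^sub>E Ce D"
    and F_Ce: "\<alpha> \<in> Ce C \<Longrightarrow> FCe F \<alpha> \<in> Ce D"
    and F_Dom2: "\<alpha> \<in> Ce C \<Longrightarrow> Dom2 D (FCe F \<alpha>) = FAr F (Dom2 C \<alpha>)"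
    and F_Cod2: "\<alpha> \<in> Ce C \<Longrightarrow> Cod2 D (FCe F \<alpha>) = FAr F (Cod2 C \<alpha>)"
    and F_Idn2: "f \<in> Ar C \<Longrightarrow> FCe F (Idn2 C f) = Idn2 D (FAr F f)"
    and F_VComp: "\<lbrakk>\<alpha> \<in> Ce C; \<beta> \<in> Ce C; Dom2 C \<beta> = Cod2 C \<alpha>\<rbrakk>
      \<Longrightarrow> FCe F (VComp C \<beta> \<alpha>) = VComp D (FCe F \<beta>) (FCe F \<alpha>)"
    and F_HComp: "\<lbrakk>\<alpha> \<in> Ce C; \<beta> \<in> Ce C; Dom C (Dom2 C \<beta>) = Cod C (Dom2 C \<alpha>)\<rbrakk>
      \<Longrightarrow> FCe F (HComp C \<beta> \<alpha>) = HComp D (FCe F \<beta>) (FCe F \<alpha>)"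
  using is_two_functor by (auto simp: is_two_functor_def)

lemmas two_functor_simps = functor_simps F_Ce F_Dom2 F_Cod2 F_Idn2 F_VComp F_HComp

end

lemma is_functorI:
  assumes "FOb F \<in> Ob C \<rightarrow>\<^sub>E Ob D" "FAr F \<in> Ar C \<rightarrow>\<^sub>E Ar D"
    and "\<And>f. f \<in> Ar C \<Longrightarrow> Dom D (FAr F f) = FOb F (Dom C f)"
    and "\<And>f. f \<in> Ar C \<Longrightarrow> Cod D (FAr F f) = FOb F (Cod C f)"
    and "\<And>X. X \<in> Ob C \<Longrightarrow> FAr F (Idn C X) = Idn D (FOb F X)"
    and "\<And>f g. \<lbrakk>f \<in> Ar C; g \<in> Ar C; Dom C g = Cod C f\<rbrakk>
      \<Longrightarrow> FAr F (Comp C g f) = Comp D (FAr F g) (FAr F f)"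
  shows "is_functor C D F"
  using assms by (simp add: is_functor_def)

lemma is_two_functorI:
  assumes "is_functor C D F" "FCe F \<in> Ce C \<rightarrow>\<^sub>E Ce D"
    and "\<And>\<alpha>. \<alpha> \<in> Ce C \<Longrightarrow> Dom2 D (FCe F \<alpha>) = FAr F (Dom2 C \<alpha>)"
    and "\<And>\<alpha>. \<alpha> \<in> Ce C \<Longrightarrow> Cod2 D (FCe F \<alpha>) = FAr F (Cod2 C \<alpha>)"
    and "\<And>f. f \<in> Ar C \<Longrightarrow> FCe F (Idn2 C f) = Idn2 D (FAr F f)"
    and "\<And>\<alpha> \<beta>. \<lbrakk>\<alpha> \<in> Ce C; \<beta> \<in> Ce C; Dom2 C \<beta> = Cod2 C \<alpha>\<rbrakk>
      \<Longrightarrow> FCe F (VComp C \<beta> \<alpha>) = VComp D (FCe F \<beta>) (FCe F \<alpha>)"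
    and "\<And>\<alpha> \<beta>. \<lbrakk>\<alpha> \<in> Ce C; \<beta> \<in> Ce C; Dom C (Dom2 C \<beta>) = Cod C (Dom2 C \<alpha>)\<rbrakk>
      \<Longrightarrow> FCe F (HComp C \<beta> \<alpha>) = HComp D (FCe F \<beta>) (FCe F \<alpha>)"
  shows "is_two_functor C D F"
  using assms by (simp add: is_two_functor_def)

section \<open>Reflection of axioms and recognition of 2-equivalences\<close>

locale faithful_two_functor = C: pre_two_category C + D: two_category D + two_functor C D F
  for C :: "('o, 'a, 'c) twocat" and D :: "('p, 'b, 'd) twocat" and F +
  assumes faithful: "\<lbrakk>f \<in> Ar C; g \<in> Ar C; Dom C f = Dom C g; Cod C f = Cod C g; FAr F f = FAr F g\<rbrakk> \<Longrightarrow> f = g"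
    and faithful2: "\<lbrakk>\<alpha> \<in> Ce C; \<beta> \<in> Ce C; Dom2 C \<alpha> = Dom2 C \<beta>; Cod2 C \<alpha> = Cod2 C \<beta>; FCe F \<alpha> = FCe F \<beta>\<rbrakk> \<Longrightarrow> \<alpha> = \<beta>"
begin

text \<open>\<open>F\<close> sends the two sides of each law to the two sides of the same law in
  \<open>D\<close>, and faithfulness applies once they are parallel. The laws for 1-cells come
  first: the horizontal unit and associativity laws for 2-cells are parallel only by virtue of
  them.\<close>

lemma two_category: "two_category C"
proof -
  note [simp] = C.typing two_functor_simps
  have c: "Comp C f (Idn C (Dom C f)) = f" "Comp C (Idn C (Cod C f)) f = f" if "f \<in> Ar C" for f
    using that D.Comp_Idn[of "FAr F f"] D.Idn_Comp[of "FAr F f"] by (auto intro: faithful)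
  have a: "Comp C h (Comp C g f) = Comp C (Comp C h g) f"
    if "f \<in> Ar C" "g \<in> Ar C" "h \<in> Ar C" "Dom C g = Cod C f" "Dom C h = Cod C g" for f g h
    using that D.Comp_assoc by (auto intro: faithful)
  show ?thesis
  proof (rule C.two_categoryI)
    show "VComp C \<alpha> (Idn2 C (Dom2 C \<alpha>)) = \<alpha>" "VComp C (Idn2 C (Cod2 C \<alpha>)) \<alpha> = \<alpha>"
      "HComp C \<alpha> (Idn2 C (Idn C (Dom C (Dom2 C \<alpha>)))) = \<alpha>"
      "HComp C (Idn2 C (Idn C (Cod C (Dom2 C \<alpha>)))) \<alpha> = \<alpha>" if "\<alpha> \<in> Ce C" for \<alpha>
      using that D.VComp_Idn2[of "FCe F \<alpha>"] D.Idn2_VComp[of "FCe F \<alpha>"]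
        D.HComp_unit[of "FCe F \<alpha>"] D.unit_HComp[of "FCe F \<alpha>"] 
        c[of "Dom2 C \<alpha>"] c[of "Cod2 C \<alpha>"] by (auto intro: faithful2)
    show "VComp C \<gamma> (VComp C \<beta> \<alpha>) = VComp C (VComp C \<gamma> \<beta>) \<alpha>"
      if "\<alpha> \<in> Ce C" "\<beta> \<in> Ce C" "\<gamma> \<in> Ce C" "Dom2 C \<beta> = Cod2 C \<alpha>" "Dom2 C \<gamma> = Cod2 C \<beta>" for \<alpha> \<beta> \<gamma>
      using that D.VComp_assoc by (auto intro: faithful2)
    show "HComp C \<gamma> (HComp C \<beta> \<alpha>) = HComp C (HComp C \<gamma> \<beta>) \<alpha>"
      if "\<alpha> \<in> Ce C" "\<beta> \<in> Ce C" "\<gamma> \<in> Ce C" "Dom C (Dom2 C \<beta>) = Cod C (Dom2 C \<alpha>)"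
        "Dom C (Dom2 C \<gamma>) = Cod C (Dom2 C \<beta>)" for \<alpha> \<beta> \<gamma>
      using that D.HComp_assoc a by (auto intro!: faithful2)
    show "HComp C (Idn2 C g) (Idn2 C f) = Idn2 C (Comp C g f)"
      if "f \<in> Ar C" "g \<in> Ar C" "Dom C g = Cod C f" for f g
      using that D.HComp_Idn2 by (auto intro: faithful2)
    show "HComp C (VComp C \<beta>' \<beta>) (VComp C \<alpha>' \<alpha>) = VComp C (HComp C \<beta>' \<alpha>') (HComp C \<beta> \<alpha>)"
      if *: "\<alpha> \<in> Ce C" "\<alpha>' \<in> Ce C" "\<beta> \<in> Ce C" "\<beta>' \<in> Ce C" "Dom2 C \<alpha>' = Cod2 C \<alpha>"
        "Dom2 C \<beta>' = Cod2 C \<beta>" "Dom C (Dom2 C \<beta>) = Cod C (Dom2 C \<alpha>)" for \<alpha> \<alpha>' \<beta> \<beta>'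
      using that by (auto intro!: faithful2 simp: D.interchange)
  qed (fact c a)+
qed

end

text \<open>The quasi-inverse is obtained by choosing preimages; it is a strict section of \<open>F\<close>, so that
  only the unit of the equivalence is not an identity.\<close>

lemma two_equivalentI:
  fixes C :: "('o, 'a, 'c) twocat" and D :: "('p, 'b, 'd) twocat"
  assumes "faithful_two_functor C D F"
    and surj: "\<And>Y. Y \<in> Ob D \<Longrightarrow> \<exists>X\<in>Ob C. FOb F X = Y"
    and full: "\<And>X Y g. \<lbrakk>X \<in> Ob C; Y \<in> Ob C; g \<in> Ar D; Dom D g = FOb F X; Cod D g = FOb F Y\<rbrakk>
      \<Longrightarrow> \<exists>f\<in>Ar C. Dom C f = X \<and> Cod C f = Y \<and> FAr F f = g"
    and full2: "\<And>f g \<beta>. \<lbrakk>f \<in> Ar C; g \<in> Ar C; Dom C f = Dom C g; Cod C f = Cod C g; \<beta> \<in> Ce D; 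
        Dom2 D \<beta> = FAr F f; Cod2 D \<beta> = FAr F g\<rbrakk>
      \<Longrightarrow> \<exists>\<alpha>\<in>Ce C. Dom2 C \<alpha> = f \<and> Cod2 C \<alpha> = g \<and> FCe F \<alpha> = \<beta>"
  shows "two_equivalent C D"
proof -
  interpret faithful_two_functor C D F by fact
  interpret Cc: two_category C by (rule two_category)
  define g0 where "g0 = (\<lambda>Y\<in>Ob D. SOME X. X \<in> Ob C \<and> FOb F X = Y)"
  have g0: "g0 Y \<in> Ob C" "FOb F (g0 Y) = Y" if "Y \<in> Ob D" for Y
    using someI_ex[of "\<lambda>X. X \<in> Ob C \<and> FOb F X = Y"] surj[OF that] that by (auto simp: g0_def)
  define lft where "lft X Y g = (SOME f. f \<in> Ar C \<and> Dom C f = X \<and> Cod C f = Y \<and> FAr F f = g)" for X Y g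
  have lft: "lft X Y g \<in> Ar C" "Dom C (lft X Y g) = X" "Cod C (lft X Y g) = Y" "FAr F (lft X Y g) = g"
    if "X \<in> Ob C" "Y \<in> Ob C" "g \<in> Ar D" "Dom D g = FOb F X" "Cod D g = FOb F Y" for X Y g
    using someI_ex[of "\<lambda>f. f \<in> Ar C \<and> Dom C f = X \<and> Cod C f = Y \<and> FAr F f = g"] full[OF that]
    by (auto simp: lft_def)
  define g1 where "g1 = (\<lambda>g\<in>Ar D. lft (g0 (Dom D g)) (g0 (Cod D g)) g)"
  have g1: "g1 g \<in> Ar C" "Dom C (g1 g) = g0 (Dom D g)" "Cod C (g1 g) = g0 (Cod D g)" "FAr F (g1 g) = g"
    if "g \<in> Ar D" for g
    using that by (simp_all add: g1_def lft g0 D.typing)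
  define g2 where "g2 = (\<lambda>\<beta>\<in>Ce D. SOME \<alpha>. \<alpha> \<in> Ce C \<and> Dom2 C \<alpha> = g1 (Dom2 D \<beta>) \<and>
    Cod2 C \<alpha> = g1 (Cod2 D \<beta>) \<and> FCe F \<alpha> = \<beta>)"
  have g2: "g2 \<beta> \<in> Ce C" "Dom2 C (g2 \<beta>) = g1 (Dom2 D \<beta>)" "Cod2 C (g2 \<beta>) = g1 (Cod2 D \<beta>)" "FCe F (g2 \<beta>) = \<beta>"
    if "\<beta> \<in> Ce D" for \<beta>
  proof -
    have "\<exists>\<alpha>. \<alpha> \<in> Ce C \<and> Dom2 C \<alpha> = g1 (Dom2 D \<beta>) \<and> Cod2 C \<alpha> = g1 (Cod2 D \<beta>) \<and> FCe F \<alpha> = \<beta>"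
      using full2[of "g1 (Dom2 D \<beta>)" "g1 (Cod2 D \<beta>)" \<beta>] that by (auto simp: g1 D.typing)
    from someI_ex[OF this] that
    show "g2 \<beta> \<in> Ce C" "Dom2 C (g2 \<beta>) = g1 (Dom2 D \<beta>)" "Cod2 C (g2 \<beta>) = g1 (Cod2 D \<beta>)" "FCe F (g2 \<beta>) = \<beta>"
      by (simp_all add: g2_def)
  qed
  define G where "G = \<lparr>FOb = g0, FAr = g1, FCe = g2\<rparr>"
  note [simp] = Cc.typing D.typing two_functor_simps g0 g1 g2
  have ext: "g0 \<in> Ob D \<rightarrow>\<^sub>E Ob C" "g1 \<in> Ar D \<rightarrow>\<^sub>E Ar C" "g2 \<in> Ce D \<rightarrow>\<^sub>E Ce C"
    by (auto simp: PiE_def) (simp_all add: g0_def g1_def g2_def)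
  \<comment> \<open>\<open>G\<close> is a section of \<open>F\<close>, so the two sides of each law
    have the same image as well as the same boundary.\<close>
  have "is_functor D C G"
    by (rule is_functorI) (use ext in \<open>auto simp: G_def intro!: faithful\<close>)
  then have G: "is_two_functor D C G"
    by (rule is_two_functorI) (use ext in \<open>auto simp: G_def intro!: faithful2 faithful\<close>)
  \<comment> \<open>\<open>FOb F\<close> takes the same value at \<open>X\<close> and at
    \<open>g0 (FOb F X)\<close>, so the identity of that value has a lift between them.\<close>
  define \<eta> where "\<eta> = (\<lambda>X\<in>Ob C. lft X (g0 (FOb F X)) (Idn D (FOb F X)))"
  have [simp]: "\<eta> X \<in> Ar C" "Dom C (\<eta> X) = X" "Cod C (\<eta> X) = g0 (FOb F X)" "FAr F (\<eta> X) = Idn D (FOb F X)"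
    if "X \<in> Ob C" for X using that by (simp_all add: \<eta>_def lft)
  note [simp] = D.unit_laws
  have nat: "Comp C (g1 (FAr F f)) (\<eta> (Dom C f)) = Comp C (\<eta> (Cod C f)) f" if "f \<in> Ar C" for f
    using that by (auto intro!: faithful)
  \<comment> \<open>The targets of the two whiskerings that 2-naturality compares;
    \<open>nat\<close> itself takes care of the sources.\<close>
  have nat2: "Comp C (g1 (FAr F (Cod2 C \<alpha>))) (\<eta> (Dom C (Dom2 C \<alpha>))) =
      Comp C (\<eta> (Cod C (Dom2 C \<alpha>))) (Cod2 C \<alpha>)" if "\<alpha> \<in> Ce C" for \<alpha>
    using that nat[of "Cod2 C \<alpha>"] by simp
  have \<eta>_ext: "\<eta> \<in> extensional (Ob C)"
    by (simp add: \<eta>_def)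
  have "two_nat_trans C C (tfid C) (tfcomp C G F) \<eta>"
    unfolding two_nat_trans_def nat_trans_def
    using nat nat2 \<eta>_ext
    by (auto simp: tfid_def tfcomp_def G_def compose_def PiE_def extensional_def intro!: faithful2)
  \<comment> \<open>The inverse is the lift of the same identity in the opposite direction;
    faithfulness reflects both composites.\<close>
  moreover have "iso_arrow C (\<eta> X)" if "X \<in> Ob C" for X
    unfolding iso_arrow_def
    using that by (auto intro!: bexI[of _ "lft (g0 (FOb F X)) X (Idn D (FOb F X))"] faithful simp: lft)
  ultimately have \<eta>: "two_nat_iso C C (tfid C) (tfcomp C G F) \<eta>"
    by (simp add: two_nat_iso_def)
  have idn_iso: "\<exists>g\<in>Ar D. Dom D g = X \<and> Cod D g = X \<and> Comp D g (Idn D X) = Idn D X \<and>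
      Comp D (Idn D X) g = Idn D X" if "X \<in> Ob D" for X
    using that by (intro bexI[of _ "Idn D X"]) auto
  have "two_nat_iso D D (tfcomp D F G) (tfid D) (\<lambda>Y\<in>Ob D. Idn D Y)"
    unfolding two_nat_iso_def two_nat_trans_def nat_trans_def iso_arrow_def
    by (auto simp: tfid_def tfcomp_def G_def compose_def intro: idn_iso)
  with \<eta> G show ?thesis
    using Cc.two_category_axioms D.two_category_axioms is_two_functor
    unfolding two_equivalent_def by blast
qed

section \<open>The slice 2-category\<close>

lemma fcomp_simps [simp]:
  "X \<in> Ob C \<Longrightarrow> FOb (fcomp C G F) X = FOb G (FOb F X)"
  "f \<in> Ar C \<Longrightarrow> FAr (fcomp C G F) f = FAr G (FAr F f)"
  by (simp_all add: fcomp_def compose_def)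

lemma fid_simps [simp]:
  "X \<in> Ob C \<Longrightarrow> FOb (fid C) X = X" "f \<in> Ar C \<Longrightarrow> FAr (fid C) f = f"
  by (simp_all add: fid_def)

text \<open>Functors are extensional, hence determined by their values on the carriers.\<close>

lemma functr_eqI:
  fixes F G :: "('o, 'a, 'p, 'b) functr"
  assumes "is_functor C D F" "is_functor C D' G"
    and "\<And>X. X \<in> Ob C \<Longrightarrow> FOb F X = FOb G X" "\<And>f. f \<in> Ar C \<Longrightarrow> FAr F f = FAr G f"
  shows "F = G"
proof -
  interpret F: functor_on C D F by unfold_locales fact
  interpret G: functor_on C D' G by unfold_locales fact
  have "FOb F = FOb G" "FAr F = FAr G"
    using assms(3,4) F.FOb_ext F.FAr_ext G.FOb_ext G.FAr_ext by (auto intro: PiE_ext)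
  then show ?thesis by simp
qed

lemma is_functor_fid: "category C \<Longrightarrow> is_functor C C (fid C)"
  by (rule is_functorI) (auto simp: fid_def category_def)

lemma is_functor_fcomp:
  assumes "category C" "is_functor C D F" "is_functor D E G"
  shows "is_functor C E (fcomp C G F)"
proof -
  interpret C: category C by fact
  interpret F: functor_on C D F by unfold_locales fact
  interpret G: functor_on D E G by unfold_locales fact
  note [simp] = F.functor_simps G.functor_simps C.Dom_Ob C.Cod_Ob C.Idn_Ar C.Comp_Ar C.Dom_Comp C.Cod_Comp
  show ?thesis
    by (rule is_functorI) (auto simp: fcomp_def compose_def PiE_def)
qed

section \<open>Natural transformations and their composites\<close>

locale nat_transformation =
  C: category C + D: category D + F: functor_on C D F + G: functor_on C D G
  for C :: "('o, 'a, 'm) cat_scheme" and D :: "('p, 'b, 'n) cat_scheme"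
    and F :: "('o, 'a, 'p, 'b, 'k) functr_scheme" and G :: "('o, 'a, 'p, 'b, 'l) functr_scheme" +
  fixes \<theta>
  assumes nat_trans: "nat_trans C D F G \<theta>"
begin

lemma
  shows nt_ext: "\<theta> \<in> Ob C \<rightarrow>\<^sub>E Ar D"
    and nt_Ar: "X \<in> Ob C \<Longrightarrow> \<theta> X \<in> Ar D"
    and nt_Dom: "X \<in> Ob C \<Longrightarrow> Dom D (\<theta> X) = FOb F X"
    and nt_Cod: "X \<in> Ob C \<Longrightarrow> Cod D (\<theta> X) = FOb G X"
    and naturality: "f \<in> Ar C \<Longrightarrow> Comp D (FAr G f) (\<theta> (Dom C f)) = Comp D (\<theta> (Cod C f)) (FAr F f)"
  using nat_trans by (auto simp: nat_trans_def)

lemmas nt_simps = nt_Ar nt_Dom nt_Cod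

end

lemma nat_trans_idn:
  assumes "category C" "category D" "is_functor C D F"
  shows "nat_trans C D F F (\<lambda>X\<in>Ob C. Idn D (FOb F X))"
proof -
  interpret C: category C by fact
  interpret D: category D by fact
  interpret F: functor_on C D F by unfold_locales fact
  show ?thesis
    by (simp add: nat_trans_def F.functor_simps C.cat_typing D.cat_typing D.Comp_Idn' D.Idn_Comp')
qed

lemma nat_trans_vcomp:
  assumes "nat_transformation C D F G \<theta>" "nat_transformation C D G H \<tau>"
  shows "nat_trans C D F H (\<lambda>X\<in>Ob C. Comp D (\<tau> X) (\<theta> X))"
proof -
  interpret t: nat_transformation C D F G \<theta> by fact
  interpret u: nat_transformation C D G H \<tau> by fact
  note [simp] = t.C.Dom_Ob t.C.Cod_Ob t.D.Comp_Ar t.D.Dom_Comp t.D.Cod_Comp t.nt_simps u.nt_simps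
    t.F.functor_simps t.G.functor_simps u.G.functor_simps
  have "Comp D (FAr H f) (Comp D (\<tau> (Dom C f)) (\<theta> (Dom C f))) =
      Comp D (Comp D (\<tau> (Cod C f)) (\<theta> (Cod C f))) (FAr F f)" if "f \<in> Ar C" for f
  proof -
    have "Comp D (FAr H f) (Comp D (\<tau> (Dom C f)) (\<theta> (Dom C f))) =
        Comp D (Comp D (\<tau> (Cod C f)) (FAr G f)) (\<theta> (Dom C f))"
      using that u.naturality by (simp add: t.D.Comp_assoc)
    also have "\<dots> = Comp D (\<tau> (Cod C f)) (Comp D (FAr G f) (\<theta> (Dom C f)))"
      using that by (simp add: t.D.Comp_assoc)
    also have "\<dots> = Comp D (Comp D (\<tau> (Cod C f)) (\<theta> (Cod C f))) (FAr F f)"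
      using that t.naturality by (simp add: t.D.Comp_assoc)
    finally show ?thesis .
  qed
  then show ?thesis by (simp add: nat_trans_def)
qed

text \<open>Two exchanges suffice: naturality of \<tau> at \<open>FAr G f\<close>, then the image
  under \<open>H\<close> of naturality of \<theta> at \<open>f\<close>.\<close>

lemma nat_trans_hcomp:
  assumes "nat_transformation C D F G \<theta>" "nat_transformation D E H K \<tau>"
  shows "nat_trans C E (fcomp C H F) (fcomp C K G) (\<lambda>X\<in>Ob C. Comp E (\<tau> (FOb G X)) (FAr H (\<theta> X)))"
proof -
  interpret t: nat_transformation C D F G \<theta> by fact
  interpret u: nat_transformation D E H K \<tau> by fact
  note [simp] = t.C.Dom_Ob t.C.Cod_Ob u.D.Comp_Ar u.D.Dom_Comp u.D.Cod_Comp t.nt_simps u.nt_simps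
    t.F.functor_simps t.G.functor_simps u.F.functor_simps u.G.functor_simps
  have "Comp E (FAr K (FAr G f)) (Comp E (\<tau> (FOb G (Dom C f))) (FAr H (\<theta> (Dom C f)))) =
      Comp E (Comp E (\<tau> (FOb G (Cod C f))) (FAr H (\<theta> (Cod C f)))) (FAr H (FAr F f))" if "f \<in> Ar C" for f
  proof -
    have "Comp E (FAr K (FAr G f)) (Comp E (\<tau> (FOb G (Dom C f))) (FAr H (\<theta> (Dom C f)))) =
        Comp E (Comp E (\<tau> (FOb G (Cod C f))) (FAr H (FAr G f))) (FAr H (\<theta> (Dom C f)))"
      using that u.naturality[of "FAr G f"] by (simp add: u.D.Comp_assoc)
    also have "\<dots> = Comp E (\<tau> (FOb G (Cod C f))) (FAr H (Comp D (FAr G f) (\<theta> (Dom C f))))"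
      using that by (simp add: u.D.Comp_assoc)
    also have "\<dots> = Comp E (Comp E (\<tau> (FOb G (Cod C f))) (FAr H (\<theta> (Cod C f)))) (FAr H (FAr F f))"
      using that t.naturality by (simp add: u.D.Comp_assoc)
    finally show ?thesis .
  qed
  then show ?thesis by (simp add: nat_trans_def)
qed

section \<open>Objects, arrows and cells over a base\<close>

lemma Cat_over_simps:
  "Ob (Cat_over U K) = over_Ob U K" "Ar (Cat_over U K) = over_Ar U K"
  "Dom (Cat_over U K) = Src" "Cod (Cat_over U K) = Tgt"
  "Idn (Cat_over U K) = (\<lambda>X. \<lparr>Src = X, Tgt = X, Fn = fid (fst X)\<rparr>)"
  "Comp (Cat_over U K) = over_comp"
  "Ce (Cat_over U K) = over_Ce U K" "Dom2 (Cat_over U K) = Src" "Cod2 (Cat_over U K) = Tgt"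
  "Idn2 (Cat_over U K) = (\<lambda>H. \<lparr>Src = H, Tgt = H,
       Fn = (\<lambda>X\<in>Ob (fst (Src H)). Idn (fst (Tgt H)) (FOb (Fn H) X))\<rparr>)"
  "VComp (Cat_over U K) = (\<lambda>\<tau> \<theta>. \<lparr>Src = Src \<theta>, Tgt = Tgt \<tau>,
       Fn = (\<lambda>X\<in>Ob (fst (Src (Src \<theta>))). Comp (fst (Tgt (Src \<theta>))) (Fn \<tau> X) (Fn \<theta> X))\<rparr>)"
  "HComp (Cat_over U K) = (\<lambda>\<tau> \<theta>. \<lparr>Src = over_comp (Src \<tau>) (Src \<theta>), Tgt = over_comp (Tgt \<tau>) (Tgt \<theta>),
       Fn = (\<lambda>X\<in>Ob (fst (Src (Src \<theta>))). Comp (fst (Tgt (Src \<tau>)))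
              (Fn \<tau> (FOb (Fn (Tgt \<theta>)) X)) (FAr (Fn (Src \<tau>)) (Fn \<theta> X)))\<rparr>)"
  by (simp_all add: Cat_over_def)

lemma over_comp_simps [simp]:
  "Src (over_comp G F) = Src F" "Tgt (over_comp G F) = Tgt G"
  "Fn (over_comp G F) = fcomp (fst (Src F)) (Fn G) (Fn F)"
  by (simp_all add: over_comp_def)

lemma over_ObD:
  assumes "Q \<in> over_Ob U K"
  shows "category (fst Q)" "small_category U (fst Q)" "functor_on (fst Q) K (snd Q)"
  using assms by (auto simp: over_Ob_def small_category_def functor_on_def)

lemma over_ArD:
  assumes "H \<in> over_Ar U K"
  shows "Src H \<in> over_Ob U K" "Tgt H \<in> over_Ob U K" "functor_on (fst (Src H)) (fst (Tgt H)) (Fn H)"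
    "X \<in> Ob (fst (Src H)) \<Longrightarrow> FOb (snd (Tgt H)) (FOb (Fn H) X) = FOb (snd (Src H)) X"
    "f \<in> Ar (fst (Src H)) \<Longrightarrow> FAr (snd (Tgt H)) (FAr (Fn H) f) = FAr (snd (Src H)) f"
proof -
  show "Src H \<in> over_Ob U K" "Tgt H \<in> over_Ob U K" "functor_on (fst (Src H)) (fst (Tgt H)) (Fn H)"
    using assms by (auto simp: over_Ar_def functor_on_def)
  have "fcomp (fst (Src H)) (snd (Tgt H)) (Fn H) = snd (Src H)"
    using assms by (simp add: over_Ar_def)
  from this[symmetric]
  show "X \<in> Ob (fst (Src H)) \<Longrightarrow> FOb (snd (Tgt H)) (FOb (Fn H) X) = FOb (snd (Src H)) X"
    "f \<in> Ar (fst (Src H)) \<Longrightarrow> FAr (snd (Tgt H)) (FAr (Fn H) f) = FAr (snd (Src H)) f"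
    by simp_all
qed

lemma over_ArI:
  assumes "Src H \<in> over_Ob U K" "Tgt H \<in> over_Ob U K" and F: "is_functor (fst (Src H)) (fst (Tgt H)) (Fn H)"
    and "\<And>X. X \<in> Ob (fst (Src H)) \<Longrightarrow> FOb (snd (Tgt H)) (FOb (Fn H) X) = FOb (snd (Src H)) X"
    and "\<And>f. f \<in> Ar (fst (Src H)) \<Longrightarrow> FAr (snd (Tgt H)) (FAr (Fn H) f) = FAr (snd (Src H)) f"
  shows "H \<in> over_Ar U K"
proof -
  note Q = over_ObD[OF assms(1)] over_ObD[OF assms(2)]
  have "fcomp (fst (Src H)) (snd (Tgt H)) (Fn H) = snd (Src H)"
    using assms(4,5) Q by (intro functr_eqI[OF is_functor_fcomp[OF _ F]]) (auto simp: functor_on_def)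
  with assms show ?thesis by (simp add: over_Ar_def)
qed

lemma over_Ar_eqI:
  assumes "G \<in> over_Ar U K" "H \<in> over_Ar U K" "Src G = Src H" "Tgt G = Tgt H"
    and "\<And>X. X \<in> Ob (fst (Src H)) \<Longrightarrow> FOb (Fn G) X = FOb (Fn H) X"
    and "\<And>f. f \<in> Ar (fst (Src H)) \<Longrightarrow> FAr (Fn G) f = FAr (Fn H) f"
  shows "G = H"
proof -
  have "Fn G = Fn H"
    using assms over_ArD(3)[OF assms(1)] over_ArD(3)[OF assms(2)]
    by (intro functr_eqI[of "fst (Src H)" "fst (Tgt H)" _ "fst (Tgt H)"]) (auto simp: functor_on_def)
  with assms show ?thesis by simp
qed

lemma over_CeD:
  assumes "\<theta> \<in> over_Ce U K"
  shows "Src \<theta> \<in> over_Ar U K" "Tgt \<theta> \<in> over_Ar U K" "Src (Tgt \<theta>) = Src (Src \<theta>)" "Tgt (Tgt \<theta>) = Tgt (Src \<theta>)"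
    "nat_transformation (fst (Src (Src \<theta>))) (fst (Tgt (Src \<theta>))) (Fn (Src \<theta>)) (Fn (Tgt \<theta>)) (Fn \<theta>)"
    "X \<in> Ob (fst (Src (Src \<theta>))) \<Longrightarrow> FAr (snd (Tgt (Src \<theta>))) (Fn \<theta> X) = Idn K (FOb (snd (Src (Src \<theta>))) X)"
proof -
  show *: "Src \<theta> \<in> over_Ar U K" "Tgt \<theta> \<in> over_Ar U K" "Src (Tgt \<theta>) = Src (Src \<theta>)" "Tgt (Tgt \<theta>) = Tgt (Src \<theta>)"
   "X \<in> Ob (fst (Src (Src \<theta>))) \<Longrightarrow> FAr (snd (Tgt (Src \<theta>))) (Fn \<theta> X) = Idn K (FOb (snd (Src (Src \<theta>))) X)"
    using assms by (auto simp: over_Ce_def)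
  have "nat_trans (fst (Src (Src \<theta>))) (fst (Tgt (Src \<theta>))) (Fn (Src \<theta>)) (Fn (Tgt \<theta>)) (Fn \<theta>)"
    using assms by (auto simp: over_Ce_def)
  with over_ArD[OF *(1)] over_ArD[OF *(2)] *(3,4)
  show "nat_transformation (fst (Src (Src \<theta>))) (fst (Tgt (Src \<theta>))) (Fn (Src \<theta>)) (Fn (Tgt \<theta>)) (Fn \<theta>)"
    by (simp add: nat_transformation_def nat_transformation_axioms_def over_ObD)
qed

lemma over_CeI:
  assumes "Src \<theta> \<in> over_Ar U K" "Tgt \<theta> \<in> over_Ar U K" "Src (Tgt \<theta>) = Src (Src \<theta>)" "Tgt (Tgt \<theta>) = Tgt (Src \<theta>)"
    "nat_trans (fst (Src (Src \<theta>))) (fst (Tgt (Src \<theta>))) (Fn (Src \<theta>)) (Fn (Tgt \<theta>)) (Fn \<theta>)"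
    "\<And>X. X \<in> Ob (fst (Src (Src \<theta>))) \<Longrightarrow>
      FAr (snd (Tgt (Src \<theta>))) (Fn \<theta> X) = Idn K (FOb (snd (Src (Src \<theta>))) X)"
  shows "\<theta> \<in> over_Ce U K"
  using assms by (simp add: over_Ce_def)

lemma over_Ce_eqI:
  assumes "\<theta> \<in> over_Ce U K" "\<tau> \<in> over_Ce U K" "Src \<theta> = Src \<tau>" "Tgt \<theta> = Tgt \<tau>"
    and "\<And>X. X \<in> Ob (fst (Src (Src \<tau>))) \<Longrightarrow> Fn \<theta> X = Fn \<tau> X"
  shows "\<theta> = \<tau>"
proof -
  have "Fn \<theta> = Fn \<tau>"
    using assms nat_transformation.nt_ext[OF over_CeD(5)[OF assms(1)]]
      nat_transformation.nt_ext[OF over_CeD(5)[OF assms(2)]] by (auto intro: PiE_ext)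
  with assms show ?thesis by simp
qed

lemma over_comp_Ar:
  assumes "F \<in> over_Ar U K" "G \<in> over_Ar U K" "Src G = Tgt F"
  shows "over_comp G F \<in> over_Ar U K"
proof -
  note F = over_ArD[OF assms(1)] and G = over_ArD[OF assms(2)]
  show ?thesis
    using F G assms(3) functor_on.functor_simps(1,2)[OF F(3)]
    by (intro over_ArI) (auto intro!: is_functor_fcomp simp: over_ObD functor_on_def)
qed

lemma over_id_Ar: "Q \<in> over_Ob U K \<Longrightarrow> \<lparr>Src = Q, Tgt = Q, Fn = fid (fst Q)\<rparr> \<in> over_Ar U K"
  by (rule over_ArI) (auto simp: over_ObD is_functor_fid)

text \<open>Beyond closure of natural transformations under composition, composites must stay
  vertical. Their components project to composites of identities, because the functors applied in
  whiskering commute with the projections.\<close>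

lemma pre_two_category_Cat_over:
  assumes "category K"
  shows "pre_two_category (Cat_over U K)"
proof
  interpret K: category K by fact
  note [simp] = Cat_over_simps
  show "\<And>f. f \<in> Ar (Cat_over U K) \<Longrightarrow> Dom (Cat_over U K) f \<in> Ob (Cat_over U K)"
    "\<And>f. f \<in> Ar (Cat_over U K) \<Longrightarrow> Cod (Cat_over U K) f \<in> Ob (Cat_over U K)"
    by (auto dest: over_ArD)
  show "\<And>X. X \<in> Ob (Cat_over U K) \<Longrightarrow> Idn (Cat_over U K) X \<in> Ar (Cat_over U K)"
    by (simp add: over_id_Ar)
  show "Idn2 (Cat_over U K) f \<in> Ce (Cat_over U K)" if "f \<in> Ar (Cat_over U K)" for f
  proof -
    have f: "f \<in> over_Ar U K" using that by simp
    note f = f over_ArD[OF f]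
    interpret s: functor_on "fst (Tgt f)" K "snd (Tgt f)" by (rule over_ObD(3)[OF f(3)])
    interpret f: functor_on "fst (Src f)" "fst (Tgt f)" "Fn f" by fact
    show ?thesis
      using f f.F_Ob by (auto intro!: over_CeI nat_trans_idn simp: s.functor_simps f.is_functor over_ObD)
  qed
  show "VComp (Cat_over U K) \<beta> \<alpha> \<in> Ce (Cat_over U K)"
    if "\<alpha> \<in> Ce (Cat_over U K)" "\<beta> \<in> Ce (Cat_over U K)" "Dom2 (Cat_over U K) \<beta> = Cod2 (Cat_over U K) \<alpha>" for \<alpha> \<beta>
  proof -
    have a: "\<alpha> \<in> over_Ce U K" "\<beta> \<in> over_Ce U K" "Src \<beta> = Tgt \<alpha>" using that by simp_all
    note d = over_CeD[OF a(1)] over_CeD[OF a(2)]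
    note A = over_ArD[OF d(1)]
    interpret s: functor_on "fst (Tgt (Src \<alpha>))" K "snd (Tgt (Src \<alpha>))" by (rule over_ObD(3)[OF A(2)])
    interpret q: functor_on "fst (Src (Src \<alpha>))" K "snd (Src (Src \<alpha>))" by (rule over_ObD(3)[OF A(1)])
    interpret a: nat_transformation "fst (Src (Src \<alpha>))" "fst (Tgt (Src \<alpha>))" "Fn (Src \<alpha>)" "Fn (Tgt \<alpha>)" "Fn \<alpha>"
      by fact
    interpret b: nat_transformation "fst (Src (Src \<alpha>))" "fst (Tgt (Src \<alpha>))" "Fn (Tgt \<alpha>)" "Fn (Tgt \<beta>)" "Fn \<beta>"
      using d a(3) by simp
    show ?thesis
      using d a A a.nat_transformation_axioms b.nat_transformation_axioms
      by (auto intro!: over_CeI nat_trans_vcomp simp: s.functor_simps q.functor_simps a.nt_simps b.nt_simps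
          K.cat_typing K.Idn_Idn)
  qed
  show "HComp (Cat_over U K) \<beta> \<alpha> \<in> Ce (Cat_over U K)"
    if "\<alpha> \<in> Ce (Cat_over U K)" "\<beta> \<in> Ce (Cat_over U K)"
       "Dom (Cat_over U K) (Dom2 (Cat_over U K) \<beta>) = Cod (Cat_over U K) (Dom2 (Cat_over U K) \<alpha>)" for \<alpha> \<beta>
  proof -
    have a: "\<alpha> \<in> over_Ce U K" "\<beta> \<in> over_Ce U K" "Src (Src \<beta>) = Tgt (Src \<alpha>)" using that by simp_all
    note d = over_CeD[OF a(1)] over_CeD[OF a(2)]
    note A = over_ArD[OF d(1)] over_ArD[OF d(2)] and B = over_ArD[OF d(7)] over_ArD[OF d(8)]
    interpret s: functor_on "fst (Tgt (Src \<beta>))" K "snd (Tgt (Src \<beta>))" by (rule over_ObD(3)[OF B(2)])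
    interpret q: functor_on "fst (Src (Src \<alpha>))" K "snd (Src (Src \<alpha>))" by (rule over_ObD(3)[OF A(1)])
    interpret a: nat_transformation "fst (Src (Src \<alpha>))" "fst (Tgt (Src \<alpha>))" "Fn (Src \<alpha>)" "Fn (Tgt \<alpha>)" "Fn \<alpha>"
      by fact
    interpret b: nat_transformation "fst (Tgt (Src \<alpha>))" "fst (Tgt (Src \<beta>))" "Fn (Src \<beta>)" "Fn (Tgt \<beta>)" "Fn \<beta>"
      using d a(3) by simp
    show ?thesis
      using d a A B a.nat_transformation_axioms b.nat_transformation_axioms
      by (auto intro!: over_CeI over_comp_Ar nat_trans_hcomp simp: s.functor_simps q.functor_simps a.nt_simps b.nt_simps
         a.F.functor_simps a.G.functor_simps b.F.functor_simps
          K.cat_typing K.Idn_Idn)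
  qed
qed (auto simp: Cat_over_simps over_CeD over_ArD over_comp_Ar)

text \<open>Arrows agree once they agree on carriers, and cells once their components agree, so each
  law becomes one about arrows of a codomain category.\<close>

lemma two_category_Cat_over:
  assumes "category K"
  shows "two_category (Cat_over U K)"
proof -
  let ?S = "Cat_over U K"
  interpret P: pre_two_category ?S by (rule pre_two_category_Cat_over) fact
  have sel: "Ar ?S = over_Ar U K" "Ce ?S = over_Ce U K" "Dom ?S = Src" "Cod ?S = Tgt"
    "Dom2 ?S = Src" "Cod2 ?S = Tgt" by (simp_all add: Cat_over_simps)
  have ar_eq: "f = g" if "f \<in> Ar ?S" "g \<in> Ar ?S" "Dom ?S f = Dom ?S g" "Cod ?S f = Cod ?S g"
    "\<And>X. X \<in> Ob (fst (Dom ?S g)) \<Longrightarrow> FOb (Fn f) X = FOb (Fn g) X"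
    "\<And>u. u \<in> Ar (fst (Dom ?S g)) \<Longrightarrow> FAr (Fn f) u = FAr (Fn g) u" for f g
    by (rule over_Ar_eqI[of _ U K]) (use that in \<open>simp_all add: sel\<close>)
  have ce_eq: "\<alpha> = \<beta>" if "\<alpha> \<in> Ce ?S" "\<beta> \<in> Ce ?S" "Dom2 ?S \<alpha> = Dom2 ?S \<beta>" "Cod2 ?S \<alpha> = Cod2 ?S \<beta>"
    "\<And>X. X \<in> Ob (fst (Dom ?S (Dom2 ?S \<beta>))) \<Longrightarrow> Fn \<alpha> X = Fn \<beta> X" for \<alpha> \<beta>
    by (rule over_Ce_eqI[of _ U K]) (use that in \<open>simp_all add: sel\<close>)
  have fn: "functor_on (fst (Dom ?S f)) (fst (Cod ?S f)) (Fn f)" "category (fst (Cod ?S f))" if "f \<in> Ar ?S" for f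
    using over_ArD[of f U K] that by (simp_all add: sel over_ObD)
  have nt: "nat_transformation (fst (Dom ?S (Dom2 ?S \<alpha>))) (fst (Cod ?S (Dom2 ?S \<alpha>)))
      (Fn (Dom2 ?S \<alpha>)) (Fn (Cod2 ?S \<alpha>)) (Fn \<alpha>)" if "\<alpha> \<in> Ce ?S" for \<alpha>
    using over_CeD[of \<alpha> U K] that by (simp add: sel)
  have c: "Comp ?S f (Idn ?S (Dom ?S f)) = f" "Comp ?S (Idn ?S (Cod ?S f)) f = f" if f: "f \<in> Ar ?S" for f
  proof -
    interpret F: functor_on "fst (Dom ?S f)" "fst (Cod ?S f)" "Fn f" using f by (rule fn)
    show "Comp ?S f (Idn ?S (Dom ?S f)) = f"
      by (rule ar_eq; (use f in \<open>simp add: P.typing; fail\<close>)?) (use f in \<open>simp_all add: Cat_over_simps\<close>)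
    show "Comp ?S (Idn ?S (Cod ?S f)) f = f"
      by (rule ar_eq; (use f in \<open>simp add: P.typing; fail\<close>)?)
         (use f F.functor_simps in \<open>simp_all add: Cat_over_simps\<close>)
  qed
  have a: "Comp ?S h (Comp ?S g f) = Comp ?S (Comp ?S h g) f"
    if H: "f \<in> Ar ?S" "g \<in> Ar ?S" "h \<in> Ar ?S" "Dom ?S g = Cod ?S f" "Dom ?S h = Cod ?S g" for f g h
  proof -
    interpret F: functor_on "fst (Dom ?S f)" "fst (Cod ?S f)" "Fn f" using H(1) by (rule fn)
    show ?thesis
      by (rule ar_eq; (use H in \<open>simp add: P.typing; fail\<close>)?)
         (use H F.functor_simps in \<open>simp_all add: Cat_over_simps\<close>)
  qed
  show ?thesis
  proof (rule P.two_categoryI)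
    show "VComp ?S \<alpha> (Idn2 ?S (Dom2 ?S \<alpha>)) = \<alpha>" "VComp ?S (Idn2 ?S (Cod2 ?S \<alpha>)) \<alpha> = \<alpha>"
      "HComp ?S \<alpha> (Idn2 ?S (Idn ?S (Dom ?S (Dom2 ?S \<alpha>)))) = \<alpha>"
      "HComp ?S (Idn2 ?S (Idn ?S (Cod ?S (Dom2 ?S \<alpha>)))) \<alpha> = \<alpha>" if H: "\<alpha> \<in> Ce ?S" for \<alpha>
    proof -
      interpret A: nat_transformation "fst (Dom ?S (Dom2 ?S \<alpha>))" "fst (Cod ?S (Dom2 ?S \<alpha>))"
        "Fn (Dom2 ?S \<alpha>)" "Fn (Cod2 ?S \<alpha>)" "Fn \<alpha>" using H by (rule nt)
      note c2 = c[OF P.Dom2_Ar[OF H]] c[OF P.Cod2_Ar[OF H]] 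
      note s = A.F.functor_simps A.G.functor_simps A.nt_simps A.C.cat_typing A.D.cat_typing A.D.Comp_Idn'
         A.D.Idn_Comp'
      note t = P.Dom_Cod2[OF H] P.Cod_Cod2[OF H]
      show "VComp ?S \<alpha> (Idn2 ?S (Dom2 ?S \<alpha>)) = \<alpha>" "VComp ?S (Idn2 ?S (Cod2 ?S \<alpha>)) \<alpha> = \<alpha>"
        by (rule ce_eq; (use H in \<open>simp add: P.typing; fail\<close>)?;
            use s t in \<open>simp add: Cat_over_simps\<close>)+
      show "HComp ?S \<alpha> (Idn2 ?S (Idn ?S (Dom ?S (Dom2 ?S \<alpha>)))) = \<alpha>"
        by (rule ce_eq; (use H c2 in \<open>simp add: P.typing; fail\<close>)?;
            use s t in \<open>simp add: Cat_over_simps\<close>)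
      show "HComp ?S (Idn2 ?S (Idn ?S (Cod ?S (Dom2 ?S \<alpha>)))) \<alpha> = \<alpha>"
        by (rule ce_eq; (use H c2 t in \<open>simp add: P.typing; fail\<close>)?;
            use s t in \<open>simp add: Cat_over_simps\<close>)
    qed
    show "VComp ?S \<gamma> (VComp ?S \<beta> \<alpha>) = VComp ?S (VComp ?S \<gamma> \<beta>) \<alpha>"
      if H: "\<alpha> \<in> Ce ?S" "\<beta> \<in> Ce ?S" "\<gamma> \<in> Ce ?S" "Dom2 ?S \<beta> = Cod2 ?S \<alpha>" "Dom2 ?S \<gamma> = Cod2 ?S \<beta>" for \<alpha> \<beta> \<gamma>
    proof -
      interpret A: nat_transformation "fst (Dom ?S (Dom2 ?S \<alpha>))" "fst (Cod ?S (Dom2 ?S \<alpha>))"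
        "Fn (Dom2 ?S \<alpha>)" "Fn (Cod2 ?S \<alpha>)" "Fn \<alpha>" using H(1) by (rule nt)
      interpret B: nat_transformation "fst (Dom ?S (Dom2 ?S \<beta>))" "fst (Cod ?S (Dom2 ?S \<beta>))"
        "Fn (Dom2 ?S \<beta>)" "Fn (Cod2 ?S \<beta>)" "Fn \<beta>" using H(2) by (rule nt)
      interpret C: nat_transformation "fst (Dom ?S (Dom2 ?S \<gamma>))" "fst (Cod ?S (Dom2 ?S \<gamma>))"
        "Fn (Dom2 ?S \<gamma>)" "Fn (Cod2 ?S \<gamma>)" "Fn \<gamma>" using H(3) by (rule nt)
      note t = P.Dom_Cod2[OF H(1)] P.Cod_Cod2[OF H(1)] P.Dom_Cod2[OF H(2)] P.Cod_Cod2[OF H(2)] H(4,5)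
      show ?thesis
        by (rule ce_eq; (use H in \<open>simp add: P.typing; fail\<close>)?;
            use A.nt_simps B.nt_simps C.nt_simps A.D.Comp_assoc t in \<open>simp add: Cat_over_simps\<close>)
    qed
    show "HComp ?S \<gamma> (HComp ?S \<beta> \<alpha>) = HComp ?S (HComp ?S \<gamma> \<beta>) \<alpha>"
      if H: "\<alpha> \<in> Ce ?S" "\<beta> \<in> Ce ?S" "\<gamma> \<in> Ce ?S" "Dom ?S (Dom2 ?S \<beta>) = Cod ?S (Dom2 ?S \<alpha>)"
        "Dom ?S (Dom2 ?S \<gamma>) = Cod ?S (Dom2 ?S \<beta>)" for \<alpha> \<beta> \<gamma>
    proof -
      interpret A: nat_transformation "fst (Dom ?S (Dom2 ?S \<alpha>))" "fst (Cod ?S (Dom2 ?S \<alpha>))"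
        "Fn (Dom2 ?S \<alpha>)" "Fn (Cod2 ?S \<alpha>)" "Fn \<alpha>" using H(1) by (rule nt)
      interpret B: nat_transformation "fst (Cod ?S (Dom2 ?S \<alpha>))" "fst (Cod ?S (Dom2 ?S \<beta>))"
        "Fn (Dom2 ?S \<beta>)" "Fn (Cod2 ?S \<beta>)" "Fn \<beta>" using nt[OF H(2)] H by simp
      interpret C: nat_transformation "fst (Cod ?S (Dom2 ?S \<beta>))" "fst (Cod ?S (Dom2 ?S \<gamma>))"
        "Fn (Dom2 ?S \<gamma>)" "Fn (Cod2 ?S \<gamma>)" "Fn \<gamma>" using nt[OF H(3)] H by simp
      note t = P.Dom_Cod2[OF H(1)] P.Cod_Cod2[OF H(1)] P.Dom_Cod2[OF H(2)] P.Cod_Cod2[OF H(2)] H(4,5)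
      show ?thesis
        by (rule ce_eq; (use H a in \<open>simp add: P.typing; fail\<close>)?;
            use A.nt_simps B.nt_simps C.nt_simps C.D.Comp_assoc t A.F.functor_simps A.G.functor_simps
               B.F.functor_simps B.G.functor_simps C.F.functor_simps C.G.functor_simps
            in \<open>simp add: Cat_over_simps\<close>)
    qed
    show "HComp ?S (Idn2 ?S g) (Idn2 ?S f) = Idn2 ?S (Comp ?S g f)"
      if H: "f \<in> Ar ?S" "g \<in> Ar ?S" "Dom ?S g = Cod ?S f" for f g
    proof -
      interpret F: functor_on "fst (Dom ?S f)" "fst (Cod ?S f)" "Fn f" using H(1) by (rule fn)
      interpret G: functor_on "fst (Cod ?S f)" "fst (Cod ?S g)" "Fn g" using fn[OF H(2)] H(3) by simp
      interpret c: category "fst (Cod ?S g)" using H(2) by (rule fn)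
      show ?thesis
        by (rule ce_eq; (use H in \<open>simp add: P.typing; fail\<close>)?;
            use F.functor_simps G.functor_simps c.Idn_Idn H in \<open>simp add: Cat_over_simps\<close>)
    qed
    show "HComp ?S (VComp ?S \<beta>' \<beta>) (VComp ?S \<alpha>' \<alpha>) = VComp ?S (HComp ?S \<beta>' \<alpha>') (HComp ?S \<beta> \<alpha>)"
      if H: "\<alpha> \<in> Ce ?S" "\<alpha>' \<in> Ce ?S" "\<beta> \<in> Ce ?S" "\<beta>' \<in> Ce ?S" "Dom2 ?S \<alpha>' = Cod2 ?S \<alpha>"
        "Dom2 ?S \<beta>' = Cod2 ?S \<beta>" "Dom ?S (Dom2 ?S \<beta>) = Cod ?S (Dom2 ?S \<alpha>)" for \<alpha> \<alpha>' \<beta> \<beta>'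
    proof -
      note t0 = P.Dom_Cod2[OF H(1)] P.Cod_Cod2[OF H(1)] P.Dom_Cod2[OF H(3)] P.Cod_Cod2[OF H(3)]
        P.Dom_Cod2[OF H(2)] P.Cod_Cod2[OF H(2)] P.Dom_Cod2[OF H(4)] P.Cod_Cod2[OF H(4)] H(5-7)
      note t = t0[unfolded sel]
      let ?C = "fst (Src (Src \<alpha>))" and ?D = "fst (Tgt (Src \<alpha>))" and ?E = "fst (Tgt (Src \<beta>))"
      interpret A: nat_transformation ?C ?D "Fn (Src \<alpha>)" "Fn (Tgt \<alpha>)" "Fn \<alpha>" using nt[OF H(1)] by (simp add: sel)
      interpret A': nat_transformation ?C ?D "Fn (Tgt \<alpha>)" "Fn (Tgt \<alpha>')" "Fn \<alpha>'" using nt[OF H(2)] t by (simp add: sel)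
      interpret B: nat_transformation ?D ?E "Fn (Src \<beta>)" "Fn (Tgt \<beta>)" "Fn \<beta>" using nt[OF H(3)] t by (simp add: sel)
      interpret B': nat_transformation ?D ?E "Fn (Tgt \<beta>)" "Fn (Tgt \<beta>')" "Fn \<beta>'" using nt[OF H(4)] t by (simp add: sel)
      note [simp] = A.nt_simps B.nt_simps A'.nt_simps B'.nt_simps A.F.functor_simps A.G.functor_simps
          A'.G.functor_simps B.F.functor_simps B.G.functor_simps B'.G.functor_simps B.D.cat_typing t
      \<comment> \<open>The componentwise form of interchange comes down to naturality of \<beta> at
        the component of \<alpha>'.\<close>
      have pw: "Comp ?E (Comp ?E (Fn \<beta>' (FOb (Fn (Tgt \<alpha>')) X)) (Fn \<beta> (FOb (Fn (Tgt \<alpha>')) X)))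
          (Comp ?E (FAr (Fn (Src \<beta>)) (Fn \<alpha>' X)) (FAr (Fn (Src \<beta>)) (Fn \<alpha> X))) =
         Comp ?E (Comp ?E (Fn \<beta>' (FOb (Fn (Tgt \<alpha>')) X)) (FAr (Fn (Tgt \<beta>)) (Fn \<alpha>' X)))
            (Comp ?E (Fn \<beta> (FOb (Fn (Tgt \<alpha>)) X)) (FAr (Fn (Src \<beta>)) (Fn \<alpha> X)))" (is "?l = ?r")
        if X: "X \<in> Ob ?C" for X
      proof -
        let ?a = "FAr (Fn (Src \<beta>)) (Fn \<alpha> X)" and ?b' = "Fn \<beta>' (FOb (Fn (Tgt \<alpha>')) X)"
        have "?l = Comp ?E ?b' (Comp ?E (Comp ?E (Fn \<beta> (FOb (Fn (Tgt \<alpha>')) X)) (FAr (Fn (Src \<beta>)) (Fn \<alpha>' X))) ?a)"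
          using X by (simp add: B.D.Comp_assoc)
        also have "\<dots> = Comp ?E ?b' (Comp ?E (Comp ?E (FAr (Fn (Tgt \<beta>)) (Fn \<alpha>' X)) (Fn \<beta> (FOb (Fn (Tgt \<alpha>)) X))) ?a)"
          using X B.naturality[of "Fn \<alpha>' X"] by simp
        also have "\<dots> = ?r" using X by (simp add: B.D.Comp_assoc)
        finally show ?thesis .
      qed
      show ?thesis
        by (rule ce_eq; (use H t0 in \<open>simp add: P.typing; fail\<close>)?;
            use pw in \<open>simp add: Cat_over_simps\<close>)
    qed
  qed (fact c a)+
qed

section \<open>Algebras for a 2-functor\<close>

lemma Alg_simps:
  "Ob (Alg K T) = alg_Ob K T" "Ar (Alg K T) = alg_Ar K T" "Dom (Alg K T) = Src" "Cod (Alg K T) = Tgt"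
  "Idn (Alg K T) = (\<lambda>A. \<lparr>Src = A, Tgt = A, Fn = Idn K (fst A)\<rparr>)"
  "Comp (Alg K T) = alg_comp K"
  "Ce (Alg K T) = alg_Ce K T" "Dom2 (Alg K T) = Src" "Cod2 (Alg K T) = Tgt"
  "Idn2 (Alg K T) = (\<lambda>H. \<lparr>Src = H, Tgt = H, Fn = Idn2 K (Fn H)\<rparr>)"
  "VComp (Alg K T) = (\<lambda>\<tau> \<theta>. \<lparr>Src = Src \<theta>, Tgt = Tgt \<tau>, Fn = VComp K (Fn \<tau>) (Fn \<theta>)\<rparr>)"
  "HComp (Alg K T) = (\<lambda>\<tau> \<theta>. \<lparr>Src = alg_comp K (Src \<tau>) (Src \<theta>), Tgt = alg_comp K (Tgt \<tau>) (Tgt \<theta>),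
       Fn = HComp K (Fn \<tau>) (Fn \<theta>)\<rparr>)"
  by (simp_all add: Alg_def)

lemma alg_comp_simps [simp]:
  "Src (alg_comp K G F) = Src F" "Tgt (alg_comp K G F) = Tgt G" "Fn (alg_comp K G F) = Comp K (Fn G) (Fn F)"
  by (simp_all add: alg_comp_def)

text \<open>Passing to underlying arrows and 2-cells is faithful between fixed boundaries, so the
  equations are inherited from \<open>K\<close>. What is left is closure: composites of cells
  compatible with the structure maps are compatible again.\<close>

lemma two_category_Alg:
  assumes "two_category K" "is_two_functor K K (Tfun T)"
  shows "two_category (Alg K T)"
proof -
  interpret K: two_category K by fact
  interpret T: two_functor K K "Tfun T" by unfold_locales fact
  note [simp] = K.typing T.two_functor_simps
  have ob: "fst A \<in> Ob K" "snd A \<in> Ar K" "Dom K (snd A) = FOb (Tfun T) (fst A)" "Cod K (snd A) = fst A"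
    if "A \<in> alg_Ob K T" for A using that by (auto simp: alg_Ob_def)
  have ar: "Src H \<in> alg_Ob K T" "Tgt H \<in> alg_Ob K T" "Fn H \<in> Ar K" "Dom K (Fn H) = fst (Src H)"
    "Cod K (Fn H) = fst (Tgt H)"
    "Comp K (Fn H) (snd (Src H)) = Comp K (snd (Tgt H)) (FAr (Tfun T) (Fn H))" if "H \<in> alg_Ar K T" for H
    using that by (auto simp: alg_Ar_def)
  have ce: "Src \<theta> \<in> alg_Ar K T" "Tgt \<theta> \<in> alg_Ar K T" "Src (Tgt \<theta>) = Src (Src \<theta>)" "Tgt (Tgt \<theta>) = Tgt (Src \<theta>)"
    "Fn \<theta> \<in> Ce K" "Dom2 K (Fn \<theta>) = Fn (Src \<theta>)" "Cod2 K (Fn \<theta>) = Fn (Tgt \<theta>)"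
    "HComp K (Fn \<theta>) (Idn2 K (snd (Src (Src \<theta>)))) = HComp K (Idn2 K (snd (Tgt (Src \<theta>)))) (FCe (Tfun T) (Fn \<theta>))"
    if "\<theta> \<in> alg_Ce K T" for \<theta> using that by (auto simp: alg_Ce_def)
  \<comment> \<open>The structure map travels past \<open>Fn F\<close> and then past
    \<open>Fn G\<close>; functoriality of \<open>T\<close> reassembles the composite.\<close>
  have comp: "alg_comp K G F \<in> alg_Ar K T" if H: "F \<in> alg_Ar K T" "G \<in> alg_Ar K T" "Src G = Tgt F" for F G
  proof -
    note F = ar[OF H(1)] and G = ar[OF H(2)]
    note [simp] = ob[OF F(1)] ob[OF F(2)] ob[OF G(2)]
    have "Comp K (Comp K (Fn G) (Fn F)) (snd (Src F)) = Comp K (Fn G) (Comp K (Fn F) (snd (Src F)))"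
      using F(1-5) G(1-5) H(3) by (simp add: K.Comp_assoc)
    also have "\<dots> = Comp K (Fn G) (Comp K (snd (Src G)) (FAr (Tfun T) (Fn F)))" using F H(3) by simp
    also have "\<dots> = Comp K (Comp K (Fn G) (snd (Src G))) (FAr (Tfun T) (Fn F))"
      using F G(1-5) H(3) by (simp add: K.Comp_assoc)
    also have "\<dots> = Comp K (Comp K (snd (Tgt G)) (FAr (Tfun T) (Fn G))) (FAr (Tfun T) (Fn F))" using G by simp
    also have "\<dots> = Comp K (snd (Tgt G)) (FAr (Tfun T) (Comp K (Fn G) (Fn F)))"
      using F(1-5) G(1-5) H(3) by (simp add: K.Comp_assoc)
    finally show ?thesis using F G H(3) by (simp add: alg_Ar_def)
  qed
  let ?A = "Alg K T"
  let ?F = "\<lparr>FOb = restrict fst (Ob ?A), FAr = restrict Fn (Ar ?A), FCe = restrict Fn (Ce ?A)\<rparr>"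
  have pre: "pre_two_category ?A"
  proof
    show "Idn ?A A \<in> Ar ?A" if "A \<in> Ob ?A" for A
      using that ob[of A] by (simp add: Alg_simps alg_Ar_def K.Idn_Comp' K.Comp_Idn')
    show "Idn2 ?A H \<in> Ce ?A" if "H \<in> Ar ?A" for H
      using that ar[of H] ob[of "Src H"] ob[of "Tgt H"] by (simp add: Alg_simps alg_Ce_def K.HComp_Idn2)
    show "VComp ?A \<beta> \<alpha> \<in> Ce ?A" if H: "\<alpha> \<in> Ce ?A" "\<beta> \<in> Ce ?A" "Dom2 ?A \<beta> = Cod2 ?A \<alpha>" for \<alpha> \<beta>
    proof -
      note a = ce[OF H(1)[unfolded Alg_simps]] and b = ce[OF H(2)[unfolded Alg_simps]]
      have [simp]: "Src \<beta> = Tgt \<alpha>" using H by (simp add: Alg_simps)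
      note [simp] = ar[OF a(1)] ar[OF a(2)] ar[OF b(2)]
      note [simp] = ob[OF ar(1)[OF a(1)]] ob[OF ar(2)[OF a(1)]]
      show ?thesis using a b by (simp add: Alg_simps alg_Ce_def K.whisker_left_VComp K.whisker_right_VComp)
    qed
    show "HComp ?A \<beta> \<alpha> \<in> Ce ?A" if H: "\<alpha> \<in> Ce ?A" "\<beta> \<in> Ce ?A" "Dom ?A (Dom2 ?A \<beta>) = Cod ?A (Dom2 ?A \<alpha>)" for \<alpha> \<beta>
    proof -
      note a = ce[OF H(1)[unfolded Alg_simps]] and b = ce[OF H(2)[unfolded Alg_simps]]
      have e [simp]: "Src (Src \<beta>) = Tgt (Src \<alpha>)" using H by (simp add: Alg_simps)
      note [simp] = ar(1-5)[OF a(1)] ar(1-5)[OF a(2)] ar(1-5)[OF b(1)] ar(1-5)[OF b(2)]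
      note [simp] = ob[OF ar(1)[OF a(1)]] ob[OF ar(2)[OF a(1)]] ob[OF ar(2)[OF b(1)]]
      note [simp] = a(1-7) b(1-7)
      let ?TF = "FCe (Tfun T)" and ?m = "\<lambda>A. Idn2 K (snd A)"
      \<comment> \<open>The same passage one dimension higher, with the structure maps present as
        identity 2-cells.\<close>
      have "HComp K (HComp K (Fn \<beta>) (Fn \<alpha>)) (?m (Src (Src \<alpha>))) =
          HComp K (Fn \<beta>) (HComp K (Fn \<alpha>) (?m (Src (Src \<alpha>))))"
        by (simp add: K.HComp_assoc)
      also have "\<dots> = HComp K (Fn \<beta>) (HComp K (?m (Tgt (Src \<alpha>))) (?TF (Fn \<alpha>)))" using a(8) by simp
      also have "\<dots> = HComp K (HComp K (Fn \<beta>) (?m (Src (Src \<beta>)))) (?TF (Fn \<alpha>))"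
        by (simp add: K.HComp_assoc)
      also have "\<dots> = HComp K (HComp K (?m (Tgt (Src \<beta>))) (?TF (Fn \<beta>))) (?TF (Fn \<alpha>))" unfolding b(8) ..
      also have "\<dots> = HComp K (?m (Tgt (Src \<beta>))) (?TF (HComp K (Fn \<beta>) (Fn \<alpha>)))"
        by (simp add: K.HComp_assoc)
      finally show ?thesis by (simp add: Alg_simps alg_Ce_def comp)
    qed
  qed (auto simp: Alg_simps ce ar comp)
  have "is_functor ?A K ?F"
    by (rule is_functorI)
       (use pre_two_category.typing[OF pre] in \<open>auto simp: Alg_simps ce ar comp ob\<close>)
  then have "is_two_functor ?A K ?F"
    by (rule is_two_functorI)
       (use pre_two_category.typing[OF pre] in \<open>auto simp: Alg_simps ce ar comp ob\<close>)
  then have "faithful_two_functor ?A K ?F"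
    using assms(1) pre
    by (simp add: faithful_two_functor_def two_functor_def faithful_two_functor_axioms_def Alg_simps)
  then show ?thesis by (rule faithful_two_functor.two_category)
qed

section \<open>Encodings and the universe\<close>

text \<open>\<open>enc\<close> is a bare choice, so its injectivity has to be derived at each type
  from the existence of some injection.\<close>

lemma
  assumes "\<exists>e :: 'x \<Rightarrow> 'u. inj e"
  shows inj_enc: "inj (enc :: 'x \<Rightarrow> 'u)" and dec_enc: "dec (enc x :: 'u) = (x :: 'x)"
proof -
  show "inj (enc :: 'x \<Rightarrow> 'u)" unfolding enc_def using assms by (rule someI_ex)
  then show "dec (enc x :: 'u) = (x :: 'x)" by (simp add: dec_def)
qed

text \<open>An infinite cardinal equals its own square.\<close>

lemma ex_inj_pair:
  assumes "infinite (UNIV :: 'u set)"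
  shows "\<exists>e :: 'u \<times> 'u \<Rightarrow> 'u. inj e"
proof -
  have "(card_of (UNIV \<times> UNIV :: ('u \<times> 'u) set), card_of (UNIV :: 'u set)) \<in> ordLeq"
    using card_of_Times_same_infinite[OF assms] ordIso_iff_ordLeq by blast
  then show ?thesis unfolding card_of_ordLeq[symmetric] by simp
qed

text \<open>An explicit code by nested pairs. It shows that squares with a cell inject into the type
  of cells; moreover, unlike the arbitrary injection \<open>enc\<close> at this type, its values can
  be located in an iterated product of members of the universe.\<close>

definition sq_code :: "('u, 'u) square \<times> 'u \<Rightarrow> 'u" where
  "sq_code = (\<lambda>(s, u). enc (sqf s, enc (sqg s, enc (sqh s, enc (sqk s, enc (sqc s, u) :: 'u) :: 'u) :: 'u) :: 'u))"

lemma inj_sq_code: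
  assumes "infinite (UNIV :: 'u set)"
  shows "inj (sq_code :: ('u, 'u) square \<times> 'u \<Rightarrow> 'u)"
  unfolding sq_code_def
  by (auto intro!: injI square.equality simp: inj_eq[OF inj_enc[OF ex_inj_pair[OF assms]]])

lemma universe_lepoll_Times:
  "\<lbrakk>universe U; X \<in> U; Y \<in> U; Z \<lesssim> X \<times> Y\<rbrakk> \<Longrightarrow> Z \<in> U"
  unfolding universe_def by blast

text \<open>The diagonal embeds \<open>X\<close> into \<open>X \<times> X\<close>, which brings the
  claim under the closure condition for products.\<close>

lemma universe_lepoll:
  assumes "universe U" "X \<in> U" "Z \<lesssim> X"
  shows "Z \<in> U"
proof (rule universe_lepoll_Times[OF assms(1,2,2)])
  have "X \<lesssim> X \<times> X"
    unfolding lepoll_def by (rule exI[of _ "\<lambda>x. (x, x)"]) (auto simp: inj_on_def)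
  with assms(3) show "Z \<lesssim> X \<times> X" by (rule lepoll_trans)
qed

lemma universe_enc_Times:
  fixes U :: "'u set set"
  assumes "universe U" "X \<in> U" "Y \<in> U"
  shows "enc ` (X \<times> Y) \<in> U"
  by (rule universe_lepoll_Times[OF assms]) (rule image_lepoll)

section \<open>The category of squares\<close>

lemma Sq_simps:
  "Ob (Sq B) = Ar B" "Dom (Sq B) = sqf" "Cod (Sq B) = sqg"
  "Idn (Sq B) f = \<lparr>sqf = f, sqg = f, sqh = Idn B (Dom B f), sqk = Idn B (Cod B f), sqc = Idn2 B f\<rparr>"
  "Comp (Sq B) t s = \<lparr>sqf = sqf s, sqg = sqg t,
       sqh = Comp B (sqh t) (sqh s), sqk = Comp B (sqk t) (sqk s),
       sqc = VComp B (HComp B (sqc t) (Idn2 B (sqh s))) (HComp B (Idn2 B (sqk t)) (sqc s))\<rparr>"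
  by (simp_all add: Sq_def)

lemma Sq_Ar_iff:
  "s \<in> Ar (Sq B) \<longleftrightarrow> sqf s \<in> Ar B \<and> sqg s \<in> Ar B \<and> sqh s \<in> Ar B \<and> sqk s \<in> Ar B \<and> sqc s \<in> Ce B \<and>
       Dom B (sqh s) = Dom B (sqf s) \<and> Cod B (sqh s) = Dom B (sqg s) \<and>
       Dom B (sqk s) = Cod B (sqf s) \<and> Cod B (sqk s) = Cod B (sqg s) \<and>
       Dom2 B (sqc s) = Comp B (sqk s) (sqf s) \<and> Cod2 B (sqc s) = Comp B (sqg s) (sqh s)"
  by (simp add: Sq_def)

context two_category begin

text \<open>For associativity, the whiskering rules bring both bracketings of a threefold pasting to
  the same vertical composite.\<close>

lemma category_Sq: "category (Sq B)"
proof
  show "Idn (Sq B) f \<in> Ar (Sq B)" if "f \<in> Ob (Sq B)" for f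
    using that by (simp add: Sq_simps Sq_Ar_iff typing unit_laws)
  show "Comp (Sq B) t s \<in> Ar (Sq B)" if "s \<in> Ar (Sq B)" "t \<in> Ar (Sq B)" "Dom (Sq B) t = Cod (Sq B) s" for s t
    using that by (simp add: Sq_simps Sq_Ar_iff typing Comp_assoc)
  show "Comp (Sq B) s (Idn (Sq B) (Dom (Sq B) s)) = s" "Comp (Sq B) (Idn (Sq B) (Cod (Sq B) s)) s = s"
    if "s \<in> Ar (Sq B)" for s
    using that by (auto simp: Sq_simps Sq_Ar_iff typing unit_laws HComp_Idn2 intro!: square.equality)
  show "Comp (Sq B) r (Comp (Sq B) t s) = Comp (Sq B) (Comp (Sq B) r t) s"
    if "s \<in> Ar (Sq B)" "t \<in> Ar (Sq B)" "r \<in> Ar (Sq B)" "Dom (Sq B) t = Cod (Sq B) s" "Dom (Sq B) r = Cod (Sq B) t"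
    for r s t
    using that by (simp add: Sq_simps Sq_Ar_iff typing whisker Comp_assoc VComp_assoc)
qed (simp_all add: Sq_simps Sq_Ar_iff)

lemma sq_hcomp_Ar:
  "\<lbrakk>s \<in> Ar (Sq B); t \<in> Ar (Sq B); sqh t = sqk s\<rbrakk> \<Longrightarrow> sq_hcomp B t s \<in> Ar (Sq B)"
  by (simp add: sq_hcomp_def Sq_Ar_iff typing Comp_assoc)

lemma sq_hid_Ar: "k \<in> Ar B \<Longrightarrow> sq_hid B k \<in> Ar (Sq B)"
  by (simp add: sq_hid_def Sq_Ar_iff typing unit_laws)

lemma
  shows src_simps: "f \<in> Ar B \<Longrightarrow> FOb (src_functor B) f = Dom B f"
    "s \<in> Ar (Sq B) \<Longrightarrow> FAr (src_functor B) s = sqh s"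
    and tgt_simps: "f \<in> Ar B \<Longrightarrow> FOb (tgt_functor B) f = Cod B f"
    "s \<in> Ar (Sq B) \<Longrightarrow> FAr (tgt_functor B) s = sqk s"
  by (simp_all add: src_functor_def tgt_functor_def Sq_simps)

lemma is_functor_tgt: "is_functor (Sq B) B (tgt_functor B)"
proof -
  interpret S: category "Sq B" by (rule category_Sq)
  show ?thesis
    by (rule is_functorI) (use S.cat_typing in \<open>auto simp: tgt_functor_def Sq_simps Sq_Ar_iff typing\<close>)
qed

end

lemma category_pullback:
  assumes "category C" "category D" "is_functor C K F" "is_functor D K G"
  shows "category (pullback C D F G)"
proof -
  interpret C: category C by fact
  interpret D: category D by fact
  interpret F: functor_on C K F by unfold_locales fact
  interpret G: functor_on D K G by unfold_locales fact
  show ?thesis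
    by unfold_locales
      (auto simp: pullback_def C.cat_typing D.cat_typing C.Comp_Idn C.Idn_Comp C.Comp_assoc
        D.Comp_Idn D.Idn_Comp D.Comp_assoc F.F_Idn F.F_Comp G.F_Idn G.F_Comp
        F.F_Dom[symmetric] F.F_Cod[symmetric] G.F_Dom[symmetric] G.F_Cod[symmetric])
qed

lemma category_recode:
  fixes C :: "('o, 'a) cat"
  assumes "category C" and inj: "\<exists>e :: 'o \<Rightarrow> 'u. inj e" "\<exists>e :: 'a \<Rightarrow> 'u. inj e"
  shows "category (recode C :: ('u, 'u) cat)"
proof -
  interpret C: category C by fact
  note [simp] = dec_enc[OF inj(1)] dec_enc[OF inj(2)] inj_eq[OF inj_enc[OF inj(1)]] inj_eq[OF inj_enc[OF inj(2)]]
  show ?thesis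
    by unfold_locales (auto simp: recode_def C.cat_typing C.Comp_Idn C.Idn_Comp C.Comp_assoc)
qed

section \<open>The 2-functor \<open>T\<close>\<close>

locale small_base = two_category B
  for B :: "('u, 'u, 'u) twocat" +
  fixes U :: "'u set set"
  assumes universe: "universe U" and small: "Ob B \<in> U" "Ar B \<in> U" "Ce B \<in> U"
begin

lemma infinite_UNIV: "infinite (UNIV :: 'u set)"
  using universe by (simp add: universe_def)

lemma ex_inj_square: "\<exists>e :: ('u, 'u) square \<times> 'u \<Rightarrow> 'u. inj e"
  using inj_sq_code[OF infinite_UNIV] by blast

text \<open>Two kinds of codes occur, for pairs of cells and for a square with a cell;
  \<open>enc\<close> is a separate injection at each of the two types.\<close>

lemma enc_simps [simp]:
  "(enc (a, b) :: 'u) = enc (a', b') \<longleftrightarrow> a = (a' :: 'u) \<and> b = (b' :: 'u)"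
  "(enc (s, b) :: 'u) = enc (s', b') \<longleftrightarrow> s = (s' :: ('u, 'u) square) \<and> b = (b' :: 'u)"
  "dec (enc p :: 'u) = (p :: 'u \<times> 'u)" "dec (enc q :: 'u) = (q :: ('u, 'u) square \<times> 'u)"
  using inj_enc[OF ex_inj_pair[OF infinite_UNIV]] inj_enc[OF ex_inj_square]
    dec_enc[OF ex_inj_pair[OF infinite_UNIV]] dec_enc[OF ex_inj_square]
  by (simp_all add: inj_eq)

abbreviation "over_objects \<equiv> over_Ob U (under B)"
abbreviation "over_arrows \<equiv> over_Ar U (under B)"
abbreviation "over_cells \<equiv> over_Ce U (under B)"

lemma T_ob_Ob_iff:
  "z \<in> Ob (fst (T_ob B Q)) \<longleftrightarrow>
    (\<exists>f X. z = enc (f, X) \<and> f \<in> Ar B \<and> X \<in> Ob (fst Q) \<and> Cod B f = FOb (snd Q) X)"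
  by (auto simp: T_ob_def Let_def recode_def pullback_def Sq_simps tgt_simps)

lemma T_ob_Ar_iff:
  "w \<in> Ar (fst (T_ob B Q)) \<longleftrightarrow>
    (\<exists>s u. w = enc (s, u) \<and> s \<in> Ar (Sq B) \<and> u \<in> Ar (fst Q) \<and> sqk s = FAr (snd Q) u)"
  by (auto simp: T_ob_def Let_def recode_def pullback_def tgt_simps)

lemma T_ob_simps [simp]:
  "Dom (fst (T_ob B Q)) (enc (s, u)) = enc (sqf s, Dom (fst Q) u)"
  "Cod (fst (T_ob B Q)) (enc (s, u)) = enc (sqg s, Cod (fst Q) u)"
  "Idn (fst (T_ob B Q)) (enc (f, X)) = enc (Idn (Sq B) f, Idn (fst Q) X)"
  "Comp (fst (T_ob B Q)) (enc (t, v)) (enc (s, u)) = enc (Comp (Sq B) t s, Comp (fst Q) v u)"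
  by (simp_all add: T_ob_def Let_def recode_def pullback_def Sq_simps(2,3))

lemma T_ob_proj [simp]:
  fixes f X u :: 'u and s :: "('u, 'u) square"
  shows
  "enc (f, X) \<in> Ob (fst (T_ob B Q)) \<Longrightarrow> FOb (snd (T_ob B Q)) (enc (f, X)) = Dom B f"
  "enc (s, u) \<in> Ar (fst (T_ob B Q)) \<Longrightarrow> FAr (snd (T_ob B Q)) (enc (s, u)) = sqh s"
proof -
  show "FOb (snd (T_ob B Q)) (enc (f, X)) = Dom B f" if "enc (f, X) \<in> Ob (fst (T_ob B Q))"
  proof -
    have "f \<in> Ar B" using that by (auto simp: T_ob_Ob_iff)
    then show ?thesis using that by (simp add: T_ob_def Let_def src_simps)
  qed
  show "FAr (snd (T_ob B Q)) (enc (s, u)) = sqh s" if "enc (s, u) \<in> Ar (fst (T_ob B Q))"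
  proof -
    have "s \<in> Ar (Sq B)" using that by (auto simp: T_ob_Ar_iff)
    then show ?thesis using that by (simp add: T_ob_def Let_def src_simps)
  qed
qed

lemma T_ob_over:
  assumes "Q \<in> over_objects"
  shows "T_ob B Q \<in> over_objects"
proof -
  note Q = over_ObD[OF assms]
  interpret q: functor_on "fst Q" "under B" "snd Q" by fact
  have QU: "Ob (fst Q) \<in> U" "Ar (fst Q) \<in> U" using Q(2) by (simp_all add: small_category_def)
  have "fst (T_ob B Q) = recode (pullback (Sq B) (fst Q) (tgt_functor B) (snd Q))"
    by (simp add: T_ob_def Let_def)
  moreover have "category (pullback (Sq B) (fst Q) (tgt_functor B) (snd Q))"
    using category_Sq Q(1) is_functor_tgt q.is_functor by (intro category_pullback[where K=B]) simp_all
  ultimately have cat: "category (fst (T_ob B Q))"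
    using category_recode[OF _ ex_inj_pair[OF infinite_UNIV] ex_inj_square] by simp
  have "Ob (fst (T_ob B Q)) \<subseteq> enc ` (Ar B \<times> Ob (fst Q))"
    by (auto simp: T_ob_Ob_iff)
  then have ob: "Ob (fst (T_ob B Q)) \<in> U"
    using universe_lepoll[OF universe universe_enc_Times[OF universe small(2) QU(1)] subset_imp_lepoll] by blast
  let ?P = "\<lambda>X Y. enc ` (X \<times> Y) :: 'u set"
  \<comment> \<open>One factor for each of the five components of a square, and one for the arrow of
    \<open>fst Q\<close>, nested as in \<open>sq_code\<close>.\<close>
  let ?R = "?P (Ar B) (?P (Ar B) (?P (Ar B) (?P (Ar B) (?P (Ce B) (Ar (fst Q))))))"
  have R: "?R \<in> U"
    by (intro universe_enc_Times universe small QU)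
  \<comment> \<open>The codes in \<open>T_ob B Q\<close> come from an uncontrolled injection;
    decoding and coding again by \<open>sq_code\<close> bounds their number.\<close>
  have "Ar (fst (T_ob B Q)) \<lesssim> ?R"
    unfolding lepoll_def
  proof (rule exI[of _ "\<lambda>w. sq_code (dec w)"], intro conjI)
    show "inj_on (\<lambda>w. sq_code (dec w) :: 'u) (Ar (fst (T_ob B Q)))"
      by (auto simp: inj_on_def T_ob_Ar_iff inj_eq[OF inj_sq_code[OF infinite_UNIV]])
    show "(\<lambda>w. sq_code (dec w)) ` Ar (fst (T_ob B Q)) \<subseteq> ?R"
      by (auto simp: T_ob_Ar_iff sq_code_def Sq_Ar_iff intro!: imageI)
  qed
  then have ar: "Ar (fst (T_ob B Q)) \<in> U"
    by (rule universe_lepoll[OF universe R])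
  interpret t: category "fst (T_ob B Q)" by (rule cat)
  interpret S: category "Sq B" by (rule category_Sq)
  have "is_functor (fst (T_ob B Q)) B (snd (T_ob B Q))"
  proof (rule is_functorI)
    show "FOb (snd (T_ob B Q)) \<in> Ob (fst (T_ob B Q)) \<rightarrow>\<^sub>E Ob B"
    proof (rule PiE_I)
      show "FOb (snd (T_ob B Q)) z \<in> Ob B" if "z \<in> Ob (fst (T_ob B Q))" for z
        using that T_ob_Ob_iff[THEN iffD1, OF that] by (auto simp: typing)
    qed (simp add: T_ob_def Let_def)
    show "FAr (snd (T_ob B Q)) \<in> Ar (fst (T_ob B Q)) \<rightarrow>\<^sub>E Ar B"
    proof (rule PiE_I)
      show "FAr (snd (T_ob B Q)) z \<in> Ar B" if "z \<in> Ar (fst (T_ob B Q))" for z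
        using that T_ob_Ar_iff[THEN iffD1, OF that] by (auto simp: Sq_Ar_iff)
    qed (simp add: T_ob_def Let_def)
    show "Dom B (FAr (snd (T_ob B Q)) w) = FOb (snd (T_ob B Q)) (Dom (fst (T_ob B Q)) w)"
      "Cod B (FAr (snd (T_ob B Q)) w) = FOb (snd (T_ob B Q)) (Cod (fst (T_ob B Q)) w)"
      if w: "w \<in> Ar (fst (T_ob B Q))" for w
      using T_ob_Ar_iff[THEN iffD1, OF w] w t.Dom_Ob[OF w] t.Cod_Ob[OF w] by (auto simp: Sq_Ar_iff)
    show "FAr (snd (T_ob B Q)) (Idn (fst (T_ob B Q)) z) = Idn B (FOb (snd (T_ob B Q)) z)"
      if z: "z \<in> Ob (fst (T_ob B Q))" for z
      using T_ob_Ob_iff[THEN iffD1, OF z] z t.Idn_Ar[OF z] by (auto simp: Sq_simps)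
    show "FAr (snd (T_ob B Q)) (Comp (fst (T_ob B Q)) y x) =
        Comp B (FAr (snd (T_ob B Q)) y) (FAr (snd (T_ob B Q)) x)"
      if x: "x \<in> Ar (fst (T_ob B Q))" and y: "y \<in> Ar (fst (T_ob B Q))"
        and yx: "Dom (fst (T_ob B Q)) y = Cod (fst (T_ob B Q)) x" for x y
      using T_ob_Ar_iff[THEN iffD1, OF x] T_ob_Ar_iff[THEN iffD1, OF y] x y t.Comp_Ar[OF x y yx]
      by (auto simp: Sq_simps)
  qed
  with cat ob ar show ?thesis
    by (simp add: over_Ob_def small_category_def case_prod_beta)
qed

lemma T_ar_simps [simp]:
  fixes f X u :: 'u and s :: "('u, 'u) square"
  shows
  "Src (T_ar B H) = T_ob B (Src H)" "Tgt (T_ar B H) = T_ob B (Tgt H)"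
  "enc (f, X) \<in> Ob (fst (T_ob B (Src H))) \<Longrightarrow> FOb (Fn (T_ar B H)) (enc (f, X)) = enc (f, FOb (Fn H) X)"
  "enc (s, u) \<in> Ar (fst (T_ob B (Src H))) \<Longrightarrow> FAr (Fn (T_ar B H)) (enc (s, u)) = enc (s, FAr (Fn H) u)"
  by (simp_all add: T_ar_def)

lemma T_ce_simps [simp]:
  fixes f X :: 'u
  shows
  "Src (T_ce B \<theta>) = T_ar B (Src \<theta>)" "Tgt (T_ce B \<theta>) = T_ar B (Tgt \<theta>)"
  "enc (f, X) \<in> Ob (fst (T_ob B (Src (Src \<theta>)))) \<Longrightarrow> Fn (T_ce B \<theta>) (enc (f, X)) = enc (Idn (Sq B) f, Fn \<theta> X)"
  by (simp_all add: T_ce_def)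

lemma enc_Ob [simp]:
  fixes f X :: 'u
  shows
  "enc (f, X) \<in> Ob (fst (T_ob B Q)) \<longleftrightarrow> f \<in> Ar B \<and> X \<in> Ob (fst Q) \<and> Cod B f = FOb (snd Q) X"
  by (auto simp: T_ob_Ob_iff)

lemma enc_Ar [simp]:
  fixes u :: 'u and s :: "('u, 'u) square"
  shows
  "enc (s, u) \<in> Ar (fst (T_ob B Q)) \<longleftrightarrow> s \<in> Ar (Sq B) \<and> u \<in> Ar (fst Q) \<and> sqk s = FAr (snd Q) u"
  by (auto simp: T_ob_Ar_iff)

lemma T_ar_over:
  assumes "H \<in> over_arrows"
  shows "T_ar B H \<in> over_arrows"
proof -
  note H = over_ArD[OF assms]
  interpret H: functor_on "fst (Src H)" "fst (Tgt H)" "Fn H" by fact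
  interpret q: functor_on "fst (Src H)" "under B" "snd (Src H)" using over_ObD[OF H(1)] by simp
  interpret c: category "fst (Src H)" using over_ObD[OF H(1)] by simp
  interpret S: category "Sq B" by (rule category_Sq)
  interpret t: category "fst (T_ob B (Src H))" using over_ObD[OF T_ob_over[OF H(1)]] by simp
  show ?thesis
  proof (rule over_ArI)
    show "is_functor (fst (Src (T_ar B H))) (fst (Tgt (T_ar B H))) (Fn (T_ar B H))"
    proof (rule is_functorI, unfold T_ar_simps(1,2))
      show "FOb (Fn (T_ar B H)) \<in> Ob (fst (T_ob B (Src H))) \<rightarrow>\<^sub>E Ob (fst (T_ob B (Tgt H)))"
        by (rule PiE_I; (simp add: T_ar_def; fail)?) (auto simp: T_ob_Ob_iff H H.functor_simps)
      show "FAr (Fn (T_ar B H)) \<in> Ar (fst (T_ob B (Src H))) \<rightarrow>\<^sub>E Ar (fst (T_ob B (Tgt H)))"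
        by (rule PiE_I; (simp add: T_ar_def; fail)?) (auto simp: T_ob_Ar_iff H H.functor_simps)
      fix w assume w: "w \<in> Ar (fst (T_ob B (Src H)))"
      then show "Dom (fst (T_ob B (Tgt H))) (FAr (Fn (T_ar B H)) w) =
          FOb (Fn (T_ar B H)) (Dom (fst (T_ob B (Src H))) w)"
        "Cod (fst (T_ob B (Tgt H))) (FAr (Fn (T_ar B H)) w) =
          FOb (Fn (T_ar B H)) (Cod (fst (T_ob B (Src H))) w)"
        using t.Dom_Ob[OF w] t.Cod_Ob[OF w] unfolding T_ob_Ar_iff by (auto simp: H.functor_simps)
    next
      fix z assume z: "z \<in> Ob (fst (T_ob B (Src H)))"
      then show "FAr (Fn (T_ar B H)) (Idn (fst (T_ob B (Src H))) z) =
          Idn (fst (T_ob B (Tgt H))) (FOb (Fn (T_ar B H)) z)"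
        using t.Idn_Ar[OF z] unfolding T_ob_Ob_iff by (auto simp: H.functor_simps)
    next
      fix x y assume x: "x \<in> Ar (fst (T_ob B (Src H)))" and y: "y \<in> Ar (fst (T_ob B (Src H)))"
        and yx: "Dom (fst (T_ob B (Src H))) y = Cod (fst (T_ob B (Src H))) x"
      then show "FAr (Fn (T_ar B H)) (Comp (fst (T_ob B (Src H))) y x) =
          Comp (fst (T_ob B (Tgt H))) (FAr (Fn (T_ar B H)) y) (FAr (Fn (T_ar B H)) x)"
        using t.Comp_Ar[OF x y yx] unfolding T_ob_Ar_iff by (auto simp: H.functor_simps)
    qed
  qed (auto simp: T_ob_over H T_ob_Ob_iff T_ob_Ar_iff H.functor_simps)
qed

text \<open>The component at \<open>X\<close> lies over an identity, as does the right side of the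
  identity square of \<open>f\<close>, so the two form an arrow of the pullback. The left side of
  that square is an identity too, which makes the transformation vertical.\<close>

lemma T_ce_over:
  assumes "\<theta> \<in> over_cells"
  shows "T_ce B \<theta> \<in> over_cells"
proof -
  note d = over_CeD[OF assms]
  note A = over_ArD[OF d(1)] over_ArD[OF d(2)]
  note [simp] = d(3,4)
  interpret n: nat_transformation "fst (Src (Src \<theta>))" "fst (Tgt (Src \<theta>))" "Fn (Src \<theta>)" "Fn (Tgt \<theta>)" "Fn \<theta>"
    by fact
  interpret S: category "Sq B" by (rule category_Sq)
  interpret t: category "fst (T_ob B (Src (Src \<theta>)))" using over_ObD[OF T_ob_over[OF A(1)]] by simp
  have sqI: "Idn (Sq B) f \<in> Ar (Sq B)" if "f \<in> Ar B" for f
    using S.Idn_Ar that by (simp add: Sq_simps)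
  have sqk: "sqk (Idn (Sq B) f) = Idn B (Cod B f)" for f by (simp add: Sq_simps)
  \<comment> \<open>Naturality in the first component: an identity square can be moved across
    \<open>s\<close>.\<close>
  have cI: "Comp (Sq B) s (Idn (Sq B) (sqf s)) = Comp (Sq B) (Idn (Sq B) (sqg s)) s" if "s \<in> Ar (Sq B)" for s
    using S.Comp_Idn[OF that] S.Idn_Comp[OF that] by (simp add: Sq_simps(2,3))
  have sqfg: "sqf (Idn (Sq B) f) = f" "sqg (Idn (Sq B) f) = f" "sqh (Idn (Sq B) f) = Idn B (Dom B f)" for f
    by (simp_all add: Sq_simps)
  show ?thesis
  proof (rule over_CeI)
    show "nat_trans (fst (Src (Src (T_ce B \<theta>)))) (fst (Tgt (Src (T_ce B \<theta>)))) (Fn (Src (T_ce B \<theta>)))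
       (Fn (Tgt (T_ce B \<theta>))) (Fn (T_ce B \<theta>))"
      unfolding nat_trans_def T_ce_simps T_ar_simps
    proof (intro conjI ballI)
      show "Fn (T_ce B \<theta>) \<in> Ob (fst (T_ob B (Src (Src \<theta>)))) \<rightarrow>\<^sub>E Ar (fst (T_ob B (Tgt (Src \<theta>))))"
        by (rule PiE_I; (simp add: T_ce_def; fail)?) (auto simp: T_ob_Ob_iff n.nt_simps sqI sqk d(6))
      fix w assume w: "w \<in> Ar (fst (T_ob B (Src (Src \<theta>))))"
      from w obtain s u where su: "w = enc (s, u)" "s \<in> Ar (Sq B)" "u \<in> Ar (fst (Src (Src \<theta>)))"
        "sqk s = FAr (snd (Src (Src \<theta>))) u" by (auto simp: T_ob_Ar_iff)
      then show "Comp (fst (T_ob B (Tgt (Src \<theta>)))) (FAr (Fn (T_ar B (Tgt \<theta>))) w)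
          (Fn (T_ce B \<theta>) (Dom (fst (T_ob B (Src (Src \<theta>)))) w)) =
         Comp (fst (T_ob B (Tgt (Src \<theta>)))) (Fn (T_ce B \<theta>) (Cod (fst (T_ob B (Src (Src \<theta>)))) w))
          (FAr (Fn (T_ar B (Src \<theta>))) w)"
        using w t.Dom_Ob[OF w] t.Cod_Ob[OF w] by (simp add: n.naturality cI)
    next
      fix z assume z: "z \<in> Ob (fst (T_ob B (Src (Src \<theta>))))"
      then show "Dom (fst (T_ob B (Tgt (Src \<theta>)))) (Fn (T_ce B \<theta>) z) = FOb (Fn (T_ar B (Src \<theta>))) z"
        "Cod (fst (T_ob B (Tgt (Src \<theta>)))) (Fn (T_ce B \<theta>) z) = FOb (Fn (T_ar B (Tgt \<theta>))) z"
        by (auto simp: T_ob_Ob_iff n.nt_simps sqfg)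
    qed
  qed (auto simp: T_ar_over d A T_ob_Ob_iff n.nt_simps sqI sqk sqfg)
qed

text \<open>On arrows the square component is left alone and on cells it is an identity square, so
  the laws come from those of the second components and from idempotence of identity
  squares.\<close>

lemma is_two_functor_T:
  "is_two_functor (Cat_over U (under B)) (Cat_over U (under B)) (Tfun (sq_monad U B))"
proof -
  let ?S = "Cat_over U (under B)"
  interpret P: two_category ?S by (rule two_category_Cat_over) (simp add: category_self)
  have sel: "Ob ?S = over_objects" "Ar ?S = over_arrows" "Ce ?S = over_cells" "Dom ?S = Src" "Cod ?S = Tgt"
    "Dom2 ?S = Src" "Cod2 ?S = Tgt" by (simp_all add: Cat_over_simps)
  have T: "Tfun (sq_monad U B) = \<lparr>FOb = restrict (T_ob B) (Ob ?S), FAr = restrict (T_ar B) (Ar ?S),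
      FCe = restrict (T_ce B) (Ce ?S)\<rparr>"
    by (simp add: sq_monad_def sel)
  have ar_eq: "f = g" if "f \<in> Ar ?S" "g \<in> Ar ?S" "Dom ?S f = Dom ?S g" "Cod ?S f = Cod ?S g"
    "\<And>X. X \<in> Ob (fst (Dom ?S g)) \<Longrightarrow> FOb (Fn f) X = FOb (Fn g) X"
    "\<And>u. u \<in> Ar (fst (Dom ?S g)) \<Longrightarrow> FAr (Fn f) u = FAr (Fn g) u" for f g
    by (rule over_Ar_eqI[of _ U "under B"]) (use that in \<open>simp_all add: sel\<close>)
  have ce_eq: "\<alpha> = \<beta>" if "\<alpha> \<in> Ce ?S" "\<beta> \<in> Ce ?S" "Dom2 ?S \<alpha> = Dom2 ?S \<beta>" "Cod2 ?S \<alpha> = Cod2 ?S \<beta>"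
    "\<And>X. X \<in> Ob (fst (Dom ?S (Dom2 ?S \<beta>))) \<Longrightarrow> Fn \<alpha> X = Fn \<beta> X" for \<alpha> \<beta>
    by (rule over_Ce_eqI[of _ U "under B"]) (use that in \<open>simp_all add: sel\<close>)
  have tp: "\<And>Q. Q \<in> Ob ?S \<Longrightarrow> T_ob B Q \<in> Ob ?S" "\<And>H. H \<in> Ar ?S \<Longrightarrow> T_ar B H \<in> Ar ?S"
    "\<And>\<theta>. \<theta> \<in> Ce ?S \<Longrightarrow> T_ce B \<theta> \<in> Ce ?S"
    "\<And>H. Dom ?S (T_ar B H) = T_ob B (Dom ?S H)" "\<And>H. Cod ?S (T_ar B H) = T_ob B (Cod ?S H)"
    "\<And>\<theta>. Dom2 ?S (T_ce B \<theta>) = T_ar B (Dom2 ?S \<theta>)" "\<And>\<theta>. Cod2 ?S (T_ce B \<theta>) = T_ar B (Cod2 ?S \<theta>)"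
    by (simp_all add: sel T_ob_over T_ar_over T_ce_over)
  have idn: "T_ar B (Idn ?S Q) = Idn ?S (T_ob B Q)" if Q: "Q \<in> Ob ?S" for Q
  proof -
    interpret t: category "fst (T_ob B Q)" using over_ObD[of "T_ob B Q"] tp(1)[OF Q] by (simp add: sel)
    show ?thesis
      by (rule ar_eq; (use Q in \<open>simp add: tp P.typing; fail\<close>)?)
         (use Q in \<open>auto simp: tp P.typing Cat_over_simps T_ob_Ob_iff T_ob_Ar_iff\<close>)
  qed
  have cmp: "T_ar B (Comp ?S G F) = Comp ?S (T_ar B G) (T_ar B F)"
    if H: "F \<in> Ar ?S" "G \<in> Ar ?S" "Dom ?S G = Cod ?S F" for F G
  proof -
    note F = over_ArD[OF H(1)[unfolded sel]] and G = over_ArD[OF H(2)[unfolded sel]]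
    interpret f: functor_on "fst (Src F)" "fst (Tgt F)" "Fn F" by (rule F)
    interpret g: functor_on "fst (Src G)" "fst (Tgt G)" "Fn G" by (rule G)
    have [simp]: "Src G = Tgt F" using H(3) by (simp add: sel)
    show ?thesis
      by (rule ar_eq; (use H in \<open>simp add: tp P.typing; fail\<close>)?)
         (use F G f.functor_simps g.functor_simps in \<open>auto simp: Cat_over_simps T_ob_Ob_iff T_ob_Ar_iff\<close>)
  qed
  have "is_functor ?S ?S (Tfun (sq_monad U B))"
    by (rule is_functorI) (simp_all add: T tp P.typing idn cmp)
  then show ?thesis
  proof (rule is_two_functorI)
    show "FCe (Tfun (sq_monad U B)) (Idn2 ?S f) = Idn2 ?S (FAr (Tfun (sq_monad U B)) f)" if f: "f \<in> Ar ?S" for f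
    proof -
      note F = over_ArD[OF f[unfolded sel]]
      interpret f: functor_on "fst (Src f)" "fst (Tgt f)" "Fn f" by (rule F)
      have "T_ce B (Idn2 ?S f) = Idn2 ?S (T_ar B f)"
        by (rule ce_eq; (use f in \<open>simp add: tp P.typing; fail\<close>)?)
           (use F f.functor_simps in \<open>auto simp: Cat_over_simps T_ob_Ob_iff\<close>)
      with f show ?thesis by (simp add: T P.typing)
    qed
  next
    fix \<alpha> \<beta> assume H: "\<alpha> \<in> Ce ?S" "\<beta> \<in> Ce ?S" "Dom2 ?S \<beta> = Cod2 ?S \<alpha>"
    interpret S: category "Sq B" by (rule category_Sq)
    have t: "Tgt (Src \<beta>) = Tgt (Src \<alpha>)" "Src (Src \<beta>) = Src (Src \<alpha>)"
      using P.Dom_globular[OF H(1)] P.Cod_globular[OF H(1)] H(3) by (simp_all add: sel)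
    have "T_ce B (VComp ?S \<beta> \<alpha>) = VComp ?S (T_ce B \<beta>) (T_ce B \<alpha>)"
      by (rule ce_eq; (use H in \<open>simp add: tp P.typing; fail\<close>)?)
         (use t S.Idn_Idn in \<open>auto simp: Cat_over_simps T_ob_Ob_iff Sq_simps(1)\<close>)
    with H show "FCe (Tfun (sq_monad U B)) (VComp ?S \<beta> \<alpha>) =
        VComp ?S (FCe (Tfun (sq_monad U B)) \<beta>) (FCe (Tfun (sq_monad U B)) \<alpha>)"
      by (simp add: T P.typing)
  next
    fix \<alpha> \<beta> assume H: "\<alpha> \<in> Ce ?S" "\<beta> \<in> Ce ?S" "Dom ?S (Dom2 ?S \<beta>) = Cod ?S (Dom2 ?S \<alpha>)"
    interpret S: category "Sq B" by (rule category_Sq)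
    note a = over_CeD[OF H(1)[unfolded sel]] and b = over_CeD[OF H(2)[unfolded sel]]
    interpret a: nat_transformation "fst (Src (Src \<alpha>))" "fst (Tgt (Src \<alpha>))" "Fn (Src \<alpha>)" "Fn (Tgt \<alpha>)" "Fn \<alpha>"
      by (rule a)
    interpret b: nat_transformation "fst (Src (Src \<beta>))" "fst (Tgt (Src \<beta>))" "Fn (Src \<beta>)" "Fn (Tgt \<beta>)" "Fn \<beta>"
      by (rule b)
    note A = over_ArD[OF a(1)] over_ArD[OF a(2)] and B = over_ArD[OF b(1)] over_ArD[OF b(2)]
    have t: "Src (Src \<beta>) = Tgt (Src \<alpha>)" using H(3) by (simp add: sel)
    have SI: "Idn (Sq B) f \<in> Ar (Sq B)" "sqk (Idn (Sq B) f) = Idn B (Cod B f)"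
      "Comp (Sq B) (Idn (Sq B) f) (Idn (Sq B) f) = Idn (Sq B) f" if "f \<in> Ar B" for f
      using S.Idn_Ar[of f] S.Idn_Idn[of f] that by (simp_all add: Sq_simps(1)) (simp add: Sq_simps)
    have "T_ce B (HComp ?S \<beta> \<alpha>) = HComp ?S (T_ce B \<beta>) (T_ce B \<alpha>)"
      by (rule ce_eq; (use H in \<open>simp add: tp P.typing cmp; fail\<close>)?)
         (use t SI A B a.nt_simps a.F.functor_simps a.G.functor_simps a(3,4,6) b(3,4,6) in
           \<open>auto simp: Cat_over_simps T_ob_Ob_iff\<close>)
    with H show "FCe (Tfun (sq_monad U B)) (HComp ?S \<beta> \<alpha>) =
        HComp ?S (FCe (Tfun (sq_monad U B)) \<beta>) (FCe (Tfun (sq_monad U B)) \<alpha>)"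
      by (simp add: T P.typing)
  qed (simp_all add: T tp P.typing)
qed

end

section \<open>Algebras as actions of squares\<close>

lemma sq_hcomp_simps:
  "sqf (sq_hcomp B t s) = Comp B (sqf t) (sqf s)" "sqg (sq_hcomp B t s) = Comp B (sqg t) (sqg s)"
  "sqh (sq_hcomp B t s) = sqh s" "sqk (sq_hcomp B t s) = sqk t"
  "sqc (sq_hcomp B t s) = VComp B (HComp B (Idn2 B (sqg t)) (sqc s)) (HComp B (sqc t) (Idn2 B (sqf s)))"
  by (simp_all add: sq_hcomp_def)

lemma sq_hid_simps:
  "sqf (sq_hid B k) = Idn B (Dom B k)" "sqg (sq_hid B k) = Idn B (Cod B k)"
  "sqh (sq_hid B k) = k" "sqk (sq_hid B k) = k" "sqc (sq_hid B k) = Idn2 B k"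
  by (simp_all add: sq_hid_def)

text \<open>An algebra \<open>M\<close> on \<open>q\<close> freed of the codes: \<open>mo f X\<close> and \<open>ma s u\<close> are the values of \<open>M\<close> at
  \<open>(f, X)\<close> and \<open>(s, u)\<close>.\<close>

locale sq_algebra = two_category B + A: category A + q: functor_on A B q
  for B :: "('o, 'a, 'c) twocat" and A :: "('p, 'b) cat" and q :: "('p, 'b, 'o, 'a) functr" +
  fixes mo :: "'a \<Rightarrow> 'p \<Rightarrow> 'p" and ma :: "('a, 'c) square \<Rightarrow> 'b \<Rightarrow> 'b"
  assumes mo_Ob: "\<lbrakk>f \<in> Ar B; X \<in> Ob A; Cod B f = FOb q X\<rbrakk> \<Longrightarrow> mo f X \<in> Ob A"
    and q_mo: "\<lbrakk>f \<in> Ar B; X \<in> Ob A; Cod B f = FOb q X\<rbrakk> \<Longrightarrow> FOb q (mo f X) = Dom B f"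
    and ma_Ar: "\<lbrakk>s \<in> Ar (Sq B); u \<in> Ar A; sqk s = FAr q u\<rbrakk> \<Longrightarrow> ma s u \<in> Ar A"
    and ma_Dom: "\<lbrakk>s \<in> Ar (Sq B); u \<in> Ar A; sqk s = FAr q u\<rbrakk> \<Longrightarrow> Dom A (ma s u) = mo (sqf s) (Dom A u)"
    and ma_Cod: "\<lbrakk>s \<in> Ar (Sq B); u \<in> Ar A; sqk s = FAr q u\<rbrakk> \<Longrightarrow> Cod A (ma s u) = mo (sqg s) (Cod A u)"
    and q_ma: "\<lbrakk>s \<in> Ar (Sq B); u \<in> Ar A; sqk s = FAr q u\<rbrakk> \<Longrightarrow> FAr q (ma s u) = sqh s"
    and ma_Idn: "\<lbrakk>f \<in> Ar B; X \<in> Ob A; Cod B f = FOb q X\<rbrakk>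
      \<Longrightarrow> ma (Idn (Sq B) f) (Idn A X) = Idn A (mo f X)"
    and ma_Comp: "\<lbrakk>s \<in> Ar (Sq B); u \<in> Ar A; sqk s = FAr q u; t \<in> Ar (Sq B); v \<in> Ar A; sqk t = FAr q v;
        sqf t = sqg s; Dom A v = Cod A u\<rbrakk>
      \<Longrightarrow> ma (Comp (Sq B) t s) (Comp A v u) = Comp A (ma t v) (ma s u)"
    and mo_unit: "X \<in> Ob A \<Longrightarrow> mo (Idn B (FOb q X)) X = X"
    and ma_unit: "u \<in> Ar A \<Longrightarrow> ma (sq_hid B (FAr q u)) u = u"
    and mo_mult: "\<lbrakk>f \<in> Ar B; g \<in> Ar B; Cod B f = Dom B g; X \<in> Ob A; Cod B g = FOb q X\<rbrakk>
      \<Longrightarrow> mo (Comp B g f) X = mo f (mo g X)"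
    and ma_mult: "\<lbrakk>s \<in> Ar (Sq B); t \<in> Ar (Sq B); sqk s = sqh t; u \<in> Ar A; sqk t = FAr q u\<rbrakk>
      \<Longrightarrow> ma (sq_hcomp B t s) u = ma s (ma t u)"

text \<open>Composites are restricted to carriers, which turns the equations for an algebra and for
  its morphisms into pointwise conditions.\<close>

lemma fcomp_eq_iff:
  "fcomp C G F = fcomp C G' F' \<longleftrightarrow> (\<forall>X\<in>Ob C. FOb G (FOb F X) = FOb G' (FOb F' X)) \<and>
    (\<forall>f\<in>Ar C. FAr G (FAr F f) = FAr G' (FAr F' f))"
  by (auto simp: fcomp_def compose_def restrict_def fun_eq_iff)

lemma fcomp_eq_fid_iff:
  "fcomp C G F = fid C \<longleftrightarrow> (\<forall>X\<in>Ob C. FOb G (FOb F X) = X) \<and> (\<forall>f\<in>Ar C. FAr G (FAr F f) = f)"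
  by (auto simp: fcomp_def fid_def compose_def restrict_def fun_eq_iff)

context small_base begin

lemma T_mult_simps [simp]:
  fixes f g X u :: 'u and s t :: "('u, 'u) square"
  shows "Src (T_mult B Q) = T_ob B (T_ob B Q)" "Tgt (T_mult B Q) = T_ob B Q"
    "enc (f, enc (g, X) :: 'u) \<in> Ob (fst (T_ob B (T_ob B Q))) \<Longrightarrow>
      FOb (Fn (T_mult B Q)) (enc (f, enc (g, X) :: 'u)) = enc (Comp B g f, X)"
    "enc (s, enc (t, u) :: 'u) \<in> Ar (fst (T_ob B (T_ob B Q))) \<Longrightarrow>
      FAr (Fn (T_mult B Q)) (enc (s, enc (t, u) :: 'u)) = enc (sq_hcomp B t s, u)"
  unfolding T_mult_def by (simp_all del: enc_Ob enc_Ar)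

lemma T_unit_simps [simp]:
  "Src (T_unit B Q) = Q" "Tgt (T_unit B Q) = T_ob B Q"
  "X \<in> Ob (fst Q) \<Longrightarrow> FOb (Fn (T_unit B Q)) X = enc (Idn B (FOb (snd Q) X), X)"
  "u \<in> Ar (fst Q) \<Longrightarrow> FAr (Fn (T_unit B Q)) u = enc (sq_hid B (FAr (snd Q) u), u)"
  by (simp_all add: T_unit_def)

abbreviation (input) "mo_of M \<equiv> \<lambda>f X :: 'u. FOb (Fn M) (enc (f :: 'u, X) :: 'u)"
abbreviation (input) "ma_of M \<equiv> \<lambda>s u :: 'u. FAr (Fn M) (enc (s :: ('u, 'u) square, u) :: 'u)"

text \<open>The restriction to codes makes the functor extensional, as arrows of the slice have to
  be.\<close>

definition alg_of :: "'u over \<Rightarrow> ('u \<Rightarrow> 'u \<Rightarrow> 'u) \<Rightarrow> (('u, 'u) square \<Rightarrow> 'u \<Rightarrow> 'u) \<Rightarrow> 'u over_arr" where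
  "alg_of Q mo ma = \<lparr>Src = T_ob B Q, Tgt = Q,
     Fn = \<lparr>FOb = (\<lambda>z\<in>Ob (fst (T_ob B Q)). case dec z of (f, X) \<Rightarrow> mo f X),
           FAr = (\<lambda>w\<in>Ar (fst (T_ob B Q)). case dec w of (s, u) \<Rightarrow> ma s u)\<rparr>\<rparr>"

lemma alg_of_simps [simp]:
  fixes f X u :: 'u and s :: "('u, 'u) square"
  shows "Src (alg_of Q mo ma) = T_ob B Q" "Tgt (alg_of Q mo ma) = Q"
    "enc (f, X) \<in> Ob (fst (T_ob B Q)) \<Longrightarrow> FOb (Fn (alg_of Q mo ma)) (enc (f, X)) = mo f X"
    "enc (s, u) \<in> Ar (fst (T_ob B Q)) \<Longrightarrow> FAr (Fn (alg_of Q mo ma)) (enc (s, u)) = ma s u"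
  by (simp_all add: alg_of_def)

abbreviation "algebras \<equiv> alg_Ob (Cat_over U (under B)) (sq_monad U B)"
abbreviation "algebra_arrows \<equiv> alg_Ar (Cat_over U (under B)) (sq_monad U B)"
abbreviation "algebra_cells \<equiv> alg_Ce (Cat_over U (under B)) (sq_monad U B)"

lemma algebras_iff:
  "(Q, M) \<in> algebras \<longleftrightarrow> Q \<in> over_objects \<and> M \<in> over_arrows \<and> Src M = T_ob B Q \<and> Tgt M = Q \<and>
    over_comp M (T_mult B Q) = over_comp M (T_ar B M) \<and> over_comp M (T_unit B Q) = \<lparr>Src = Q, Tgt = Q, Fn = fid (fst Q)\<rparr>"
  by (auto simp: alg_Ob_def Cat_over_simps sq_monad_def)

text \<open>All laws are the algebra equations evaluated at codes. An object of
  \<open>T (T Q)\<close> is a pair \<open>(f, (g, X))\<close> with \<open>Cod B f = Dom B g\<close>,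
  because \<open>T Q\<close> lies over \<open>B\<close> by sources; associativity therefore yields a
  contravariant action.\<close>

lemma algebrasD:
  assumes "(Q, M) \<in> algebras"
  shows "Q \<in> over_objects" "M \<in> over_arrows" "Src M = T_ob B Q" "Tgt M = Q"
    "sq_algebra B (fst Q) (snd Q) (mo_of M) (ma_of M)"
proof -
  show M: "Q \<in> over_objects" "M \<in> over_arrows" "Src M = T_ob B Q" "Tgt M = Q"
    using assms by (simp_all add: algebras_iff)
  have mult: "over_comp M (T_mult B Q) = over_comp M (T_ar B M)"
    and unit: "over_comp M (T_unit B Q) = \<lparr>Src = Q, Tgt = Q, Fn = fid (fst Q)\<rparr>"
    using assms by (simp_all add: algebras_iff)
  note [simp] = M(3,4)
  have mo_mult: "\<And>z. z \<in> Ob (fst (T_ob B (T_ob B Q))) \<Longrightarrow> FOb (Fn M) (FOb (Fn (T_mult B Q)) z) = FOb (Fn M) (FOb (Fn (T_ar B M)) z)"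
    and ma_mult: "\<And>z. z \<in> Ar (fst (T_ob B (T_ob B Q))) \<Longrightarrow> FAr (Fn M) (FAr (Fn (T_mult B Q)) z) = FAr (Fn M) (FAr (Fn (T_ar B M)) z)"
    using mult by (simp_all add: over_comp_def fcomp_eq_iff)
  have unit': "\<And>X. X \<in> Ob (fst Q) \<Longrightarrow> FOb (Fn M) (FOb (Fn (T_unit B Q)) X) = X"
    "\<And>u. u \<in> Ar (fst Q) \<Longrightarrow> FAr (Fn M) (FAr (Fn (T_unit B Q)) u) = u"
    using unit by (simp_all add: over_comp_def fcomp_eq_fid_iff)
  note MM = over_ArD[OF M(2), unfolded M(3,4)]
  interpret Q: category "fst Q" by (rule over_ObD[OF M(1)])
  interpret m: functor_on "fst (T_ob B Q)" "fst Q" "Fn M" by (rule MM)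
  have "functor_on (fst Q) B (snd Q)" using over_ObD[OF M(1)] by (simp add: functor_on_def)
  then interpret q: functor_on "fst Q" B "snd Q" .
  interpret S: category "Sq B" by (rule category_Sq)
  show "sq_algebra B (fst Q) (snd Q) (mo_of M) (ma_of M)"
  proof (intro sq_algebra.intro sq_algebra_axioms.intro)
    fix f X assume fX: "f \<in> Ar B" "X \<in> Ob (fst Q)" "Cod B f = FOb (snd Q) X"
    show "mo_of M f X \<in> Ob (fst Q)" using fX by (intro m.F_Ob) simp
    show "FOb (snd Q) (mo_of M f X) = Dom B f" using fX MM(4)[of "enc (f, X)"] by simp
    show "ma_of M (Idn (Sq B) f) (Idn (fst Q) X) = Idn (fst Q) (mo_of M f X)"
      using fX m.F_Idn[of "enc (f, X)"] by simp
  next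
    fix s u assume su: "s \<in> Ar (Sq B)" "u \<in> Ar (fst Q)" "sqk s = FAr (snd Q) u"
    then have w: "enc (s, u) \<in> Ar (fst (T_ob B Q))" by simp
    show "ma_of M s u \<in> Ar (fst Q)" "Dom (fst Q) (ma_of M s u) = mo_of M (sqf s) (Dom (fst Q) u)"
      "Cod (fst Q) (ma_of M s u) = mo_of M (sqg s) (Cod (fst Q) u)" "FAr (snd Q) (ma_of M s u) = sqh s"
      using m.F_Ar[OF w] m.F_Dom[OF w] m.F_Cod[OF w] MM(5)[OF w] su by simp_all
    fix t v assume tv: "t \<in> Ar (Sq B)" "v \<in> Ar (fst Q)" "sqk t = FAr (snd Q) v"
      "sqf t = sqg s" "Dom (fst Q) v = Cod (fst Q) u"
    then show "ma_of M (Comp (Sq B) t s) (Comp (fst Q) v u) = Comp (fst Q) (ma_of M t v) (ma_of M s u)"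
      using m.F_Comp[of "enc (s, u)" "enc (t, v)"] su by simp
  next
    show "mo_of M (Idn B (FOb (snd Q) X)) X = X" if "X \<in> Ob (fst Q)" for X
      using unit'(1)[OF that] that by simp
    show "ma_of M (sq_hid B (FAr (snd Q) u)) u = u" if "u \<in> Ar (fst Q)" for u
      using unit'(2)[OF that] that by simp
    show "mo_of M (Comp B g f) X = mo_of M f (mo_of M g X)"
      if "f \<in> Ar B" "g \<in> Ar B" "Cod B f = Dom B g" "X \<in> Ob (fst Q)" "Cod B g = FOb (snd Q) X" for f g X
      using mo_mult[of "enc (f, enc (g, X) :: 'u)"] that by simp
    show "ma_of M (sq_hcomp B t s) u = ma_of M s (ma_of M t u)"
      if "s \<in> Ar (Sq B)" "t \<in> Ar (Sq B)" "sqk s = sqh t" "u \<in> Ar (fst Q)" "sqk t = FAr (snd Q) u" for s t u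
      using ma_mult[of "enc (s, enc (t, u) :: 'u)"] that by simp
  qed (unfold_locales)
qed

lemma algebrasI:
  assumes "Q \<in> over_objects" "sq_algebra B (fst Q) (snd Q) mo ma"
  shows "(Q, alg_of Q mo ma) \<in> algebras"
proof -
  interpret a: sq_algebra B "fst Q" "snd Q" mo ma by fact
  interpret S: category "Sq B" by (rule category_Sq)
  interpret t: category "fst (T_ob B Q)" by (rule over_ObD[OF T_ob_over[OF assms(1)]])
  let ?M = "alg_of Q mo ma"
  have "?M \<in> over_arrows"
  proof (rule over_ArI)
    show "is_functor (fst (Src ?M)) (fst (Tgt ?M)) (Fn ?M)"
    proof (rule is_functorI, unfold alg_of_simps(1,2))
      show "FOb (Fn ?M) \<in> Ob (fst (T_ob B Q)) \<rightarrow>\<^sub>E Ob (fst Q)"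
        by (rule PiE_I; (simp add: alg_of_def; fail)?) (auto simp: T_ob_Ob_iff a.mo_Ob)
      show "FAr (Fn ?M) \<in> Ar (fst (T_ob B Q)) \<rightarrow>\<^sub>E Ar (fst Q)"
        by (rule PiE_I; (simp add: alg_of_def; fail)?) (auto simp: T_ob_Ar_iff a.ma_Ar)
      fix w assume w: "w \<in> Ar (fst (T_ob B Q))"
      then show "Dom (fst Q) (FAr (Fn ?M) w) = FOb (Fn ?M) (Dom (fst (T_ob B Q)) w)"
        "Cod (fst Q) (FAr (Fn ?M) w) = FOb (Fn ?M) (Cod (fst (T_ob B Q)) w)"
        using t.Dom_Ob[OF w] t.Cod_Ob[OF w] unfolding T_ob_Ar_iff by (auto simp: a.ma_Dom a.ma_Cod)
    next
      fix z assume z: "z \<in> Ob (fst (T_ob B Q))"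
      then show "FAr (Fn ?M) (Idn (fst (T_ob B Q)) z) = Idn (fst Q) (FOb (Fn ?M) z)"
        using t.Idn_Ar[OF z] unfolding T_ob_Ob_iff by (auto simp: a.ma_Idn)
    next
      fix x y assume x: "x \<in> Ar (fst (T_ob B Q))" and y: "y \<in> Ar (fst (T_ob B Q))"
        and yx: "Dom (fst (T_ob B Q)) y = Cod (fst (T_ob B Q)) x"
      then show "FAr (Fn ?M) (Comp (fst (T_ob B Q)) y x) = Comp (fst Q) (FAr (Fn ?M) y) (FAr (Fn ?M) x)"
        using t.Comp_Ar[OF x y yx] unfolding T_ob_Ar_iff by (auto simp: a.ma_Comp)
    qed
  qed (auto simp: T_ob_over assms T_ob_Ob_iff T_ob_Ar_iff a.q_mo a.q_ma)
  moreover have "over_comp ?M (T_mult B Q) = over_comp ?M (T_ar B ?M)"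
    by (auto simp: over_comp_def fcomp_eq_iff T_ob_Ob_iff T_ob_Ar_iff a.mo_mult a.ma_mult typing
        sq_hcomp_Ar sq_hcomp_simps a.mo_Ob a.ma_Ar a.q_mo a.q_ma)
  moreover have "over_comp ?M (T_unit B Q) = \<lparr>Src = Q, Tgt = Q, Fn = fid (fst Q)\<rparr>"
    by (auto simp: over_comp_def fcomp_eq_fid_iff a.mo_unit a.ma_unit a.q.functor_simps typing sq_hid_Ar
        sq_hid_simps)
  ultimately show ?thesis using assms by (simp add: algebras_iff)
qed

lemma algebra_arrows_iff:
  "H \<in> algebra_arrows \<longleftrightarrow> Src H \<in> algebras \<and> Tgt H \<in> algebras \<and> Fn H \<in> over_arrows \<and>
    Src (Fn H) = fst (Src H) \<and> Tgt (Fn H) = fst (Tgt H) \<and>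
    (\<forall>f X. f \<in> Ar B \<and> X \<in> Ob (fst (fst (Src H))) \<and> Cod B f = FOb (snd (fst (Src H))) X \<longrightarrow>
      FOb (Fn (Fn H)) (mo_of (snd (Src H)) f X) = mo_of (snd (Tgt H)) f (FOb (Fn (Fn H)) X)) \<and>
    (\<forall>s u. s \<in> Ar (Sq B) \<and> u \<in> Ar (fst (fst (Src H))) \<and> sqk s = FAr (snd (fst (Src H))) u \<longrightarrow>
      FAr (Fn (Fn H)) (ma_of (snd (Src H)) s u) = ma_of (snd (Tgt H)) s (FAr (Fn (Fn H)) u))"
    (is "_ \<longleftrightarrow> ?R")
proof -
  have "over_comp (Fn H) (snd (Src H)) = over_comp (snd (Tgt H)) (T_ar B (Fn H)) \<longleftrightarrow>
    (\<forall>f X. f \<in> Ar B \<and> X \<in> Ob (fst (fst (Src H))) \<and> Cod B f = FOb (snd (fst (Src H))) X \<longrightarrow>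
      FOb (Fn (Fn H)) (mo_of (snd (Src H)) f X) = mo_of (snd (Tgt H)) f (FOb (Fn (Fn H)) X)) \<and>
    (\<forall>s u. s \<in> Ar (Sq B) \<and> u \<in> Ar (fst (fst (Src H))) \<and> sqk s = FAr (snd (fst (Src H))) u \<longrightarrow>
      FAr (Fn (Fn H)) (ma_of (snd (Src H)) s u) = ma_of (snd (Tgt H)) s (FAr (Fn (Fn H)) u))"
    if "Src H \<in> algebras" "Tgt H \<in> algebras" "Src (Fn H) = fst (Src H)" "Tgt (Fn H) = fst (Tgt H)"
  proof -
    have [simp]: "Src (snd (Src H)) = T_ob B (fst (Src H))" "Tgt (snd (Tgt H)) = fst (Tgt H)"
      using algebrasD(3)[of "fst (Src H)" "snd (Src H)"] algebrasD(4)[of "fst (Tgt H)" "snd (Tgt H)"] that by simp_all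
    show ?thesis
      using that by (auto simp: over_comp_def fcomp_eq_iff Ball_def T_ob_Ob_iff T_ob_Ar_iff)
  qed
  then show ?thesis
    by (auto simp: alg_Ar_def Cat_over_simps sq_monad_def)
qed

text \<open>At \<open>(f, X)\<close> one whiskering has the component at \<open>mo_of M f X\<close>,
  the other the action of the identity square of \<open>f\<close> on the component at
  \<open>X\<close>, since \<open>T_ce\<close> pairs components with identity squares.\<close>

lemma algebra_cells_iff:
  "\<theta> \<in> algebra_cells \<longleftrightarrow> Src \<theta> \<in> algebra_arrows \<and> Tgt \<theta> \<in> algebra_arrows \<and>
    Src (Tgt \<theta>) = Src (Src \<theta>) \<and> Tgt (Tgt \<theta>) = Tgt (Src \<theta>) \<and>
    Fn \<theta> \<in> over_cells \<and> Src (Fn \<theta>) = Fn (Src \<theta>) \<and> Tgt (Fn \<theta>) = Fn (Tgt \<theta>) \<and>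
    (\<forall>f X. f \<in> Ar B \<and> X \<in> Ob (fst (fst (Src (Src \<theta>)))) \<and> Cod B f = FOb (snd (fst (Src (Src \<theta>)))) X \<longrightarrow>
      Fn (Fn \<theta>) (mo_of (snd (Src (Src \<theta>))) f X) = ma_of (snd (Tgt (Src \<theta>))) (Idn (Sq B) f) (Fn (Fn \<theta>) X))"
proof -
  let ?S = "Cat_over U (under B)"
  have "HComp ?S (Fn \<theta>) (Idn2 ?S (snd (Src (Src \<theta>)))) = HComp ?S (Idn2 ?S (snd (Tgt (Src \<theta>)))) (T_ce B (Fn \<theta>)) \<longleftrightarrow>
    (\<forall>f X. f \<in> Ar B \<and> X \<in> Ob (fst (fst (Src (Src \<theta>)))) \<and> Cod B f = FOb (snd (fst (Src (Src \<theta>)))) X \<longrightarrow>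
      Fn (Fn \<theta>) (mo_of (snd (Src (Src \<theta>))) f X) = ma_of (snd (Tgt (Src \<theta>))) (Idn (Sq B) f) (Fn (Fn \<theta>) X))"
    if *: "Src \<theta> \<in> algebra_arrows" "Tgt \<theta> \<in> algebra_arrows" "Src (Tgt \<theta>) = Src (Src \<theta>)" "Tgt (Tgt \<theta>) = Tgt (Src \<theta>)"
      "Fn \<theta> \<in> over_cells" "Src (Fn \<theta>) = Fn (Src \<theta>)" "Tgt (Fn \<theta>) = Fn (Tgt \<theta>)"
  proof -
    obtain Q M where QM: "Src (Src \<theta>) = (Q, M)" by (cases "Src (Src \<theta>)")
    obtain R N where RN: "Tgt (Src \<theta>) = (R, N)" by (cases "Tgt (Src \<theta>)")
    have a: "(Q, M) \<in> algebras" "(R, N) \<in> algebras"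
      using *(1) QM RN by (auto simp: alg_Ar_def)
    note M = algebrasD[OF a(1)] and N = algebrasD[OF a(2)]
    interpret M: sq_algebra B "fst Q" "snd Q" "mo_of M" "ma_of M" by (rule M)
    interpret N: sq_algebra B "fst R" "snd R" "mo_of N" "ma_of N" by (rule N)
    define F where "F = Fn (Src \<theta>)"
    define G where "G = Fn (Tgt \<theta>)"
    define t where "t = Fn (Fn \<theta>)"
    have FG: "F \<in> over_arrows" "G \<in> over_arrows" "Src F = Q" "Tgt F = R" "Src G = Q" "Tgt G = R"
      "over_comp F M = over_comp N (T_ar B F)" "over_comp G M = over_comp N (T_ar B G)"
      using * QM RN by (auto simp: alg_Ar_def Cat_over_simps sq_monad_def F_def G_def)
    note c = over_CeD[OF *(5), unfolded *(6,7), folded F_def G_def t_def, unfolded FG(3-6)]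
    interpret t: nat_transformation "fst Q" "fst R" "Fn F" "Fn G" t using c(5) .
    interpret S: category "Sq B" by (rule category_Sq)
    have v: "Idn (Sq B) f \<in> Ar (Sq B)" "sqk (Idn (Sq B) f) = Idn B (Cod B f)" 
      "sqf (Idn (Sq B) f) = f" "sqg (Idn (Sq B) f) = f" if "f \<in> Ar B" for f
      using S.Idn_Ar[of f] that by (simp_all add: Sq_simps)
    \<comment> \<open>The formula for horizontal composites leaves an identity factor in each
      component; these equations remove it.\<close>
    have l: "Comp (fst R) (t (mo_of M f X)) (FAr (Fn F) (Idn (fst Q) (mo_of M f X))) = t (mo_of M f X)"
      and r: "Comp (fst R) (Idn (fst R) (mo_of N f (FOb (Fn G) X))) (ma_of N (Idn (Sq B) f) (t X)) =
         ma_of N (Idn (Sq B) f) (t X)"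
      if "f \<in> Ar B" "X \<in> Ob (fst Q)" "Cod B f = FOb (snd Q) X" for f X
      using that v c(6) by (simp_all add: t.F.functor_simps t.nt_simps N.A.Comp_Idn' N.A.Idn_Comp' M.mo_Ob N.ma_Ar N.ma_Cod)
    have q: "FOb (snd R) (FOb (Fn F) X) = FOb (snd Q) X" "FOb (snd R) (FOb (Fn G) X) = FOb (snd Q) X" if "X \<in> Ob (fst Q)" for X
      using over_ArD(4)[OF FG(1), unfolded FG(3,4), OF that] over_ArD(4)[OF FG(2), unfolded FG(5,6), OF that] by auto
    have m: "FOb (Fn G) X \<in> Ob (fst R)" if "X \<in> Ob (fst Q)" for X
      using that by (rule t.G.F_Ob)
    have sel: "Src (Fn \<theta>) = F" "Tgt (Fn \<theta>) = G" "Fn (Fn \<theta>) = t"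
      using * by (simp_all add: F_def G_def t_def)
    have "HComp ?S (Fn \<theta>) (Idn2 ?S M) = \<lparr>Src = over_comp F M, Tgt = over_comp G M,
        Fn = \<lambda>z\<in>Ob (fst (T_ob B Q)). t (FOb (Fn M) z)\<rparr>"
      using l by (auto simp: Cat_over_simps sel M FG T_ob_Ob_iff intro!: restrict_ext)
    moreover have "HComp ?S (Idn2 ?S N) (T_ce B (Fn \<theta>)) = \<lparr>Src = over_comp N (T_ar B F),
        Tgt = over_comp N (T_ar B G), Fn = \<lambda>z\<in>Ob (fst (T_ob B Q)). FAr (Fn N) (Fn (T_ce B (Fn \<theta>)) z)\<rparr>"
      using r q m by (auto simp: Cat_over_simps sel N FG T_ob_Ob_iff intro!: restrict_ext)
    moreover have "(\<lambda>z\<in>Z. h z) = (\<lambda>z\<in>Z. k z) \<longleftrightarrow> (\<forall>z\<in>Z. h z = k z)" for Z :: "'u set" and h k :: "'u \<Rightarrow> 'u"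
      by (auto simp: restrict_def fun_eq_iff)
    \<comment> \<open>The boundaries of the two whiskerings agree because \<open>F\<close> and
      \<open>G\<close> commute with the structure maps, so only the components have to be
      compared.\<close>
    ultimately show ?thesis
      using FG(7,8) unfolding QM RN
      by (auto simp: sel FG T_ob_Ob_iff)
  qed
  then show ?thesis
    by (auto simp: alg_Ce_def Cat_over_simps(7-9) sq_monad_def)
qed

end

section \<open>The algebra of a discrete 2-fibration\<close>

text \<open>The action of \<open>cell_sq \<alpha>\<close> on \<open>u\<close> gives the target of the lift of \<open>\<alpha>\<close> to a 2-cell out of \<open>u\<close>; the
  action of \<open>cart_sq f\<close> on the identity of \<open>X\<close> gives the chosen arrow over \<open>f\<close>.\<close>

definition cell_sq :: "('o, 'a, 'c) twocat \<Rightarrow> 'c \<Rightarrow> ('a, 'c) square" where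
  "cell_sq B \<alpha> = \<lparr>sqf = Idn B (Dom B (Dom2 B \<alpha>)), sqg = Idn B (Cod B (Dom2 B \<alpha>)),
     sqh = Cod2 B \<alpha>, sqk = Dom2 B \<alpha>, sqc = \<alpha>\<rparr>"

definition cart_sq :: "('o, 'a, 'c) twocat \<Rightarrow> 'a \<Rightarrow> ('a, 'c) square" where
  "cart_sq B f = \<lparr>sqf = f, sqg = Idn B (Cod B f), sqh = f, sqk = Idn B (Cod B f), sqc = Idn2 B f\<rparr>"

lemma cell_sq_simps:
  "sqf (cell_sq B \<alpha>) = Idn B (Dom B (Dom2 B \<alpha>))" "sqg (cell_sq B \<alpha>) = Idn B (Cod B (Dom2 B \<alpha>))"
  "sqh (cell_sq B \<alpha>) = Cod2 B \<alpha>" "sqk (cell_sq B \<alpha>) = Dom2 B \<alpha>" "sqc (cell_sq B \<alpha>) = \<alpha>"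
  by (simp_all add: cell_sq_def)

lemma cart_sq_simps:
  "sqf (cart_sq B f) = f" "sqg (cart_sq B f) = Idn B (Cod B f)"
  "sqh (cart_sq B f) = f" "sqk (cart_sq B f) = Idn B (Cod B f)" "sqc (cart_sq B f) = Idn2 B f"
  by (simp_all add: cart_sq_def)

context two_category begin

lemma cell_sq_Ar: "\<alpha> \<in> Ce B \<Longrightarrow> cell_sq B \<alpha> \<in> Ar (Sq B)"
  by (simp add: cell_sq_simps Sq_Ar_iff typing unit_laws)

lemma cart_sq_Ar: "f \<in> Ar B \<Longrightarrow> cart_sq B f \<in> Ar (Sq B)"
  by (simp add: cart_sq_simps Sq_Ar_iff typing unit_laws)

end

definition under_proj :: "('o, 'a, 'c, 'p, 'b, 'd) twofunctr \<Rightarrow> ('o, 'a, 'p, 'b) functr" where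
  "under_proj P = \<lparr>FOb = FOb P, FAr = FAr P\<rparr>"

lemma under_proj_simps [simp]: "FOb (under_proj P) = FOb P" "FAr (under_proj P) = FAr P"
  by (simp_all add: under_proj_def)

locale discrete_two_fib = two_category B + E: two_category E + P: two_functor E B P
  for B :: "('o, 'a, 'c) twocat" and E :: "('p, 'b, 'd) twocat" and P :: "('p, 'b, 'd, 'o, 'a, 'c) twofunctr" +
  fixes cl :: "'a \<Rightarrow> 'p \<Rightarrow> 'b"
  assumes d2f: "discrete_two_fibration E B P cl"
begin

lemma
  assumes "f \<in> Ar B" "X \<in> Ob E" "Cod B f = FOb P X"
  shows cl_Ar: "cl f X \<in> Ar E" and cl_Cod: "Cod E (cl f X) = X" and P_cl: "FAr P (cl f X) = f"
    and P_Dom_cl: "FOb P (Dom E (cl f X)) = Dom B f"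
proof -
  have "cartesian E B P (cl f X) \<and> Cod E (cl f X) = X \<and> FAr P (cl f X) = f"
    using d2f assms by (simp add: discrete_two_fibration_def split_fibration_def cartesian_def)
  then show "cl f X \<in> Ar E" "Cod E (cl f X) = X" "FAr P (cl f X) = f"
    by (auto simp: cartesian_def)
  then show "FOb P (Dom E (cl f X)) = Dom B f"
    using P.F_Dom by metis
qed

lemma cl_Idn: "X \<in> Ob E \<Longrightarrow> cl (Idn B (FOb P X)) X = Idn E X"
  using d2f by (simp add: discrete_two_fibration_def split_fibration_def)

lemma cl_Comp: "\<lbrakk>f \<in> Ar B; g \<in> Ar B; Cod B f = Dom B g; X \<in> Ob E; Cod B g = FOb P X\<rbrakk>
    \<Longrightarrow> cl (Comp B g f) X = Comp E (cl g X) (cl f (Dom E (cl g X)))"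
  using d2f by (simp add: discrete_two_fibration_def split_fibration_def)

text \<open>The conditions on domains in the definition of cartesian arrows follow from the
  composites, so factorisations can be found and recognised by composites alone.\<close>

lemma cl_factor:
  assumes f: "f \<in> Ar B" "X \<in> Ob E" "Cod B f = FOb P X"
    and "h \<in> Ar E" "Cod E h = X" "w \<in> Ar B" "Cod B w = Dom B f" "Comp B f w = FAr P h"
  shows "\<exists>!v. v \<in> Ar E \<and> Cod E v = Dom E (cl f X) \<and> FAr P v = w \<and> Comp E (cl f X) v = h"
proof -
  have "cartesian E B P (cl f X)"
    using d2f f by (simp add: discrete_two_fibration_def split_fibration_def cartesian_def)
  moreover have "Dom B w = FOb P (Dom E h)"
    using assms typing(7)[of w f] P.F_Dom[of h] by simp
  ultimately have "\<exists>!v. v \<in> Ar E \<and> Dom E v = Dom E h \<and> Cod E v = Dom E (cl f X) \<and> FAr P v = w \<and> Comp E (cl f X) v = h"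
    using assms by (simp add: cartesian_def cl_Cod P_cl P_Dom_cl)
  moreover have "Dom E v = Dom E h" if "v \<in> Ar E" "Cod E v = Dom E (cl f X)" "Comp E (cl f X) v = h" for v
    using that E.typing(7)[of v "cl f X"] cl_Ar[OF f] by simp
  ultimately show ?thesis by metis
qed

text \<open>The opfibration property in the hom-category containing \<open>u\<close>. Every 2-cell
  with source \<open>u\<close> belongs to that hom-category, so uniqueness holds among all 2-cells
  of \<open>E\<close>.\<close>

lemma ex1_lift:
  assumes "u \<in> Ar E" "\<alpha> \<in> Ce B" "Dom2 B \<alpha> = FAr P u"
  shows "\<exists>!a. a \<in> Ce E \<and> Dom2 E a = u \<and> FCe P a = \<alpha>"
proof -
  have "discrete_opfibration (hom_cat E (Dom E u) (Cod E u)) (hom_cat B (FOb P (Dom E u)) (FOb P (Cod E u)))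
        (hom_functor E P (Dom E u) (Cod E u))"
    using d2f assms by (simp add: discrete_two_fibration_def E.typing)
  then have "\<exists>!a. (a \<in> Ce E \<and> Dom E (Dom2 E a) = Dom E u \<and> Cod E (Dom2 E a) = Cod E u) \<and>
      Dom2 E a = u \<and> FAr (hom_functor E P (Dom E u) (Cod E u)) a = \<alpha>"
    using assms by (simp add: discrete_opfibration_def hom_cat_def hom_functor_def P.two_functor_simps)
  moreover have "FAr (hom_functor E P (Dom E u) (Cod E u)) a = FCe P a" if "a \<in> Ce E" "Dom2 E a = u" for a
    using that by (simp add: hom_functor_def hom_cat_def)
  ultimately show ?thesis by metis
qed

text \<open>Targets need not be compared beforehand. Equations between 2-cells of \<open>E\<close>
  are thus reduced to a common source and an equation in \<open>B\<close>.\<close>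

lemma lift_unique:
  "\<lbrakk>a \<in> Ce E; b \<in> Ce E; Dom2 E a = Dom2 E b; FCe P a = FCe P b\<rbrakk> \<Longrightarrow> a = b"
  using ex1_lift[of "Dom2 E b" "FCe P b"] by (metis E.typing(9) P.F_Ce P.F_Dom2)

definition lift :: "'b \<Rightarrow> 'c \<Rightarrow> 'd" where
  "lift u \<alpha> = (THE a. a \<in> Ce E \<and> Dom2 E a = u \<and> FCe P a = \<alpha>)"

lemma
  assumes "u \<in> Ar E" "\<alpha> \<in> Ce B" "Dom2 B \<alpha> = FAr P u"
  shows lift_Ce: "lift u \<alpha> \<in> Ce E" and Dom2_lift: "Dom2 E (lift u \<alpha>) = u" and P_lift: "FCe P (lift u \<alpha>) = \<alpha>"
  using theI'[OF ex1_lift[OF assms]] by (auto simp: lift_def)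

text \<open>The codomain of \<open>v\<close> is prescribed so that its composite with the chosen
  arrow makes sense; its domain is then forced by the 2-cell, whose source and target share their
  domain.\<close>

definition act_rel :: "('a, 'c) square \<Rightarrow> 'b \<Rightarrow> 'b \<Rightarrow> bool" where
  "act_rel s u v \<longleftrightarrow> v \<in> Ar E \<and> Cod E v = Dom E (cl (sqg s) (Cod E u)) \<and> FAr P v = sqh s \<and>
     (\<exists>a\<in>Ce E. Dom2 E a = Comp E u (cl (sqf s) (Dom E u)) \<and>
        Cod2 E a = Comp E (cl (sqg s) (Cod E u)) v \<and> FCe P a = sqc s)"

definition act :: "('a, 'c) square \<Rightarrow> 'b \<Rightarrow> 'b" where
  "act s u = (THE v. act_rel s u v)"

lemma ex1_act_rel:
  assumes s: "s \<in> Ar (Sq B)" and u: "u \<in> Ar E" "sqk s = FAr P u"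
  shows "\<exists>!v. act_rel s u v"
proof -
  note s = s[unfolded Sq_Ar_iff]
  have "Cod B (sqf s) = FOb P (Dom E u)" "Cod B (sqg s) = FOb P (Cod E u)"
    using s u by (auto simp: P.two_functor_simps)
  then have f: "sqf s \<in> Ar B" "Dom E u \<in> Ob E" "Cod B (sqf s) = FOb P (Dom E u)"
    and g: "sqg s \<in> Ar B" "Cod E u \<in> Ob E" "Cod B (sqg s) = FOb P (Cod E u)"
    using s u E.typing by auto
  note [simp] = cl_Ar[OF f] cl_Cod[OF f] P_cl[OF f] cl_Ar[OF g] cl_Cod[OF g] P_cl[OF g] E.typing u P.two_functor_simps
  let ?uf = "Comp E u (cl (sqf s) (Dom E u))"
  have uf: "?uf \<in> Ar E" "sqc s \<in> Ce B" "Dom2 B (sqc s) = FAr P ?uf"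
    using s by auto
  define a where "a = lift ?uf (sqc s)"
  have a: "a \<in> Ce E" "Dom2 E a = ?uf" "FCe P a = sqc s"
    using lift_Ce[OF uf] Dom2_lift[OF uf] P_lift[OF uf] by (simp_all add: a_def)
  have c: "Cod2 E a \<in> Ar E" "Cod E (Cod2 E a) = Cod E u" "Comp B (sqg s) (sqh s) = FAr P (Cod2 E a)"
    using a s P.F_Cod2[of a] E.Cod_globular[of a] by auto
  have "\<exists>!v. v \<in> Ar E \<and> Cod E v = Dom E (cl (sqg s) (Cod E u)) \<and> FAr P v = sqh s \<and>
      Comp E (cl (sqg s) (Cod E u)) v = Cod2 E a"
    using s c by (intro cl_factor g) auto
  \<comment> \<open>By uniqueness of lifts any witnessing 2-cell is \<open>a\<close>, so only the
    factorisation of its target remains.\<close>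
  moreover have "act_rel s u v \<longleftrightarrow> v \<in> Ar E \<and> Cod E v = Dom E (cl (sqg s) (Cod E u)) \<and> FAr P v = sqh s \<and>
      Comp E (cl (sqg s) (Cod E u)) v = Cod2 E a" for v
    unfolding act_rel_def using a lift_unique by metis
  ultimately show ?thesis by simp
qed

lemma act_rel_act: "\<lbrakk>s \<in> Ar (Sq B); u \<in> Ar E; sqk s = FAr P u\<rbrakk> \<Longrightarrow> act_rel s u (act s u)"
  unfolding act_def by (rule theI', rule ex1_act_rel)

lemma act_eqI: "\<lbrakk>s \<in> Ar (Sq B); u \<in> Ar E; sqk s = FAr P u; act_rel s u v\<rbrakk> \<Longrightarrow> act s u = v"
  using act_rel_act ex1_act_rel by metis

lemma actE:
  assumes "s \<in> Ar (Sq B)" "u \<in> Ar E" "sqk s = FAr P u"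
  obtains a where "a \<in> Ce E" "Dom2 E a = Comp E u (cl (sqf s) (Dom E u))"
    "Cod2 E a = Comp E (cl (sqg s) (Cod E u)) (act s u)" "FCe P a = sqc s"
  using act_rel_act[OF assms] by (auto simp: act_rel_def)

lemma
  assumes "s \<in> Ar (Sq B)" "u \<in> Ar E" "sqk s = FAr P u"
  shows square_cl_f: "cl (sqf s) (Dom E u) \<in> Ar E" "Cod E (cl (sqf s) (Dom E u)) = Dom E u"
      "FAr P (cl (sqf s) (Dom E u)) = sqf s"
    and square_cl_g: "cl (sqg s) (Cod E u) \<in> Ar E" "Cod E (cl (sqg s) (Cod E u)) = Cod E u"
      "FAr P (cl (sqg s) (Cod E u)) = sqg s"
proof -
  have *: "sqf s \<in> Ar B" "Dom E u \<in> Ob E" "Cod B (sqf s) = FOb P (Dom E u)"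
    "sqg s \<in> Ar B" "Cod E u \<in> Ob E" "Cod B (sqg s) = FOb P (Cod E u)"
    using assms by (auto simp: P.two_functor_simps Sq_Ar_iff E.typing)
  show "cl (sqf s) (Dom E u) \<in> Ar E" "Cod E (cl (sqf s) (Dom E u)) = Dom E u"
      "FAr P (cl (sqf s) (Dom E u)) = sqf s"
    using cl_Ar[OF *(1-3)] cl_Cod[OF *(1-3)] P_cl[OF *(1-3)] by simp_all
  show "cl (sqg s) (Cod E u) \<in> Ar E" "Cod E (cl (sqg s) (Cod E u)) = Cod E u"
      "FAr P (cl (sqg s) (Cod E u)) = sqg s"
    using cl_Ar[OF *(4-6)] cl_Cod[OF *(4-6)] P_cl[OF *(4-6)] by simp_all
qed

lemma
  assumes s: "s \<in> Ar (Sq B)" "u \<in> Ar E" "sqk s = FAr P u"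
  shows act_Ar: "act s u \<in> Ar E" and act_Cod: "Cod E (act s u) = Dom E (cl (sqg s) (Cod E u))"
    and act_Dom: "Dom E (act s u) = Dom E (cl (sqf s) (Dom E u))" and P_act: "FAr P (act s u) = sqh s"
proof -
  show *: "act s u \<in> Ar E" "Cod E (act s u) = Dom E (cl (sqg s) (Cod E u))" "FAr P (act s u) = sqh s"
    using act_rel_act[OF s] by (auto simp: act_rel_def)
  obtain a where a: "a \<in> Ce E" "Dom2 E a = Comp E u (cl (sqf s) (Dom E u))"
    "Cod2 E a = Comp E (cl (sqg s) (Cod E u)) (act s u)" using actE[OF s] by blast
  show "Dom E (act s u) = Dom E (cl (sqf s) (Dom E u))"
    using E.Dom_globular[OF a(1)] a * square_cl_f[OF s] square_cl_g[OF s] s by (simp add: E.typing)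
qed

text \<open>Chosen arrows over identities are identities, so \<open>a\<close> itself witnesses the
  relation.\<close>

lemma act_cell_sq: "a \<in> Ce E \<Longrightarrow> act (cell_sq B (FCe P a)) (Dom2 E a) = Cod2 E a"
proof -
  assume a: "a \<in> Ce E"
  note [simp] = P.two_functor_simps E.typing a
  show ?thesis
    by (rule act_eqI)
      (auto simp: cell_sq_Ar cell_sq_simps act_rel_def cl_Idn E.unit_laws intro!: bexI[of _ a])
qed

text \<open>Everything in the relation apart from the chosen arrow is an identity, so its identity
  2-cell is a witness.\<close>

lemma act_cart_sq:
  assumes f: "f \<in> Ar B" "X \<in> Ob E" "Cod B f = FOb P X"
  shows "act (cart_sq B f) (Idn E X) = cl f X"
proof -
  note [simp] = P.two_functor_simps E.typing f cl_Ar[OF f] cl_Cod[OF f] P_cl[OF f]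
  show ?thesis
    by (rule act_eqI)
      (auto simp: cart_sq_Ar cart_sq_simps act_rel_def cl_Idn E.unit_laws intro!: bexI[of _ "Idn2 E (cl f X)"])
qed

lemma act_Comp:
  assumes s: "s \<in> Ar (Sq B)" "u \<in> Ar E" "sqk s = FAr P u" and t: "t \<in> Ar (Sq B)" "v \<in> Ar E" "sqk t = FAr P v"
    and st: "sqf t = sqg s" "Dom E v = Cod E u"
  shows "act (Comp (Sq B) t s) (Comp E v u) = Comp E (act t v) (act s u)"
proof -
  interpret S: category "Sq B" by (rule category_Sq)
  obtain a where a: "a \<in> Ce E" "Dom2 E a = Comp E u (cl (sqf s) (Dom E u))"
    "Cod2 E a = Comp E (cl (sqg s) (Cod E u)) (act s u)" "FCe P a = sqc s" using actE[OF s] .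
  obtain b where b: "b \<in> Ce E" "Dom2 E b = Comp E v (cl (sqf t) (Dom E v))"
    "Cod2 E b = Comp E (cl (sqg t) (Cod E v)) (act t v)" "FCe P b = sqc t" using actE[OF t] .
  note [simp] = square_cl_f[OF s] square_cl_g[OF s] square_cl_f[OF t] square_cl_g[OF t]
    act_Ar[OF s] act_Cod[OF s] act_Dom[OF s] P_act[OF s] act_Ar[OF t] act_Cod[OF t] act_Dom[OF t] P_act[OF t]
  note [simp] = a b s(2) t(2) st s(3)[symmetric] t(3)[symmetric] E.typing P.two_functor_simps
  have stC: "Comp (Sq B) t s \<in> Ar (Sq B)" "sqk (Comp (Sq B) t s) = FAr P (Comp E v u)"
    using S.Comp_Ar[OF s(1) t(1)] st by (simp_all add: Sq_simps)
  \<comment> \<open>The composition formula of \<open>Sq\<close> upstairs: \<open>v\<close> lies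
    over the right side of \<open>t\<close>, and \<open>act s u\<close> over the left side of
    \<open>s\<close>.\<close>
  let ?c = "VComp E (HComp E b (Idn2 E (act s u))) (HComp E (Idn2 E v) a)"
  have "act_rel (Comp (Sq B) t s) (Comp E v u) (Comp E (act t v) (act s u))"
    unfolding act_rel_def
    by (auto simp: Sq_simps E.Comp_assoc intro!: bexI[of _ ?c])
  then show ?thesis using stC by (intro act_eqI) auto
qed

lemma act_mult:
  assumes s: "s \<in> Ar (Sq B)" and t: "t \<in> Ar (Sq B)" "u \<in> Ar E" "sqk t = FAr P u" and st: "sqk s = sqh t"
  shows "act (sq_hcomp B t s) u = act s (act t u)"
proof -
  have s: "s \<in> Ar (Sq B)" "act t u \<in> Ar E" "sqk s = FAr P (act t u)"
    using s st act_Ar[OF t] P_act[OF t] by simp_all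
  obtain a where a: "a \<in> Ce E" "Dom2 E a = Comp E (act t u) (cl (sqf s) (Dom E (act t u)))"
    "Cod2 E a = Comp E (cl (sqg s) (Cod E (act t u))) (act s (act t u))" "FCe P a = sqc s" using actE[OF s] .
  obtain b where b: "b \<in> Ce E" "Dom2 E b = Comp E u (cl (sqf t) (Dom E u))"
    "Cod2 E b = Comp E (cl (sqg t) (Cod E u)) (act t u)" "FCe P b = sqc t" using actE[OF t] .
  have S: "sqf s \<in> Ar B" "sqf t \<in> Ar B" "sqg s \<in> Ar B" "sqg t \<in> Ar B" "Cod B (sqf s) = Dom B (sqf t)"
    "Cod B (sqg s) = Dom B (sqg t)" "Cod B (sqf t) = FOb P (Dom E u)" "Cod B (sqg t) = FOb P (Cod E u)"
    "Dom E u \<in> Ob E" "Cod E u \<in> Ob E"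
    using s(1) t st by (auto simp: Sq_Ar_iff P.two_functor_simps E.typing)
  note [simp] = square_cl_f[OF t] square_cl_g[OF t]
    act_Ar[OF s] act_Cod[OF s] act_Dom[OF s] P_act[OF s] act_Ar[OF t] act_Cod[OF t] act_Dom[OF t] P_act[OF t]
  note [simp] = square_cl_f[OF s, simplified act_Dom[OF t]] square_cl_g[OF s, simplified act_Cod[OF t]]
  note [simp] = a b t(2) t(3)[symmetric] st E.typing P.two_functor_simps
  \<comment> \<open>The formula for horizontal pasting upstairs, whiskered with the chosen arrows
    over \<open>sqg t\<close> and \<open>sqf s\<close>.\<close>
  let ?c = "VComp E (HComp E (Idn2 E (cl (sqg t) (Cod E u))) a) (HComp E b (Idn2 E (cl (sqf s) (Dom E (cl (sqf t) (Dom E u))))))"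
  \<comment> \<open>Splitness decomposes the chosen arrows over the pasted sides, which gives
    \<open>?c\<close> the boundary that \<open>act_rel\<close> demands.\<close>
  have cc: "cl (Comp B (sqf t) (sqf s)) (Dom E u) = Comp E (cl (sqf t) (Dom E u)) (cl (sqf s) (Dom E (cl (sqf t) (Dom E u))))"
    "cl (Comp B (sqg t) (sqg s)) (Cod E u) = Comp E (cl (sqg t) (Cod E u)) (cl (sqg s) (Dom E (cl (sqg t) (Cod E u))))"
    using S by (auto intro: cl_Comp)
  have "act_rel (sq_hcomp B t s) u (act s (act t u))"
    unfolding act_rel_def
    by (auto simp: sq_hcomp_simps E.Comp_assoc cc intro!: bexI[of _ ?c])
  then show ?thesis
    using s(1) t st by (intro act_eqI) (auto simp: sq_hcomp_simps intro: sq_hcomp_Ar)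
qed

text \<open>Identity and unit laws are witnessed by identity 2-cells, the composition laws by the
  pastings in \<open>act_Comp\<close> and \<open>act_mult\<close>.\<close>

lemma sq_algebra: "sq_algebra B (under E) (under_proj P) (\<lambda>f X. Dom E (cl f X)) act"
proof -
  have "functor_on (under E) B (under_proj P)"
    using P.is_functor by unfold_locales (simp add: is_functor_def)
  moreover have "category (under E)" by (simp add: E.category_self)
  ultimately show ?thesis
  proof (intro sq_algebra.intro sq_algebra_axioms.intro, simp_all only: under_simps under_proj_simps)
    show "two_category B" by unfold_locales
    fix f X assume f: "f \<in> Ar B" "X \<in> Ob E" "Cod B f = FOb P X"
    note [simp] = P.two_functor_simps E.typing f cl_Ar[OF f] cl_Cod[OF f] P_cl[OF f] P_Dom_cl[OF f]
    show "Dom E (cl f X) \<in> Ob E" "FOb P (Dom E (cl f X)) = Dom B f" by simp_all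
    interpret S: category "Sq B" by (rule category_Sq)
    have v: "Idn (Sq B) f \<in> Ar (Sq B)" "sqk (Idn (Sq B) f) = FAr P (Idn E X)"
      using S.Idn_Ar[of f] by (simp_all add: Sq_simps)
    have "act_rel (Idn (Sq B) f) (Idn E X) (Idn E (Dom E (cl f X)))"
      by (auto simp: act_rel_def Sq_simps E.unit_laws intro!: bexI[of _ "Idn2 E (cl f X)"])
    then show "act (Idn (Sq B) f) (Idn E X) = Idn E (Dom E (cl f X))"
      by (intro act_eqI v) simp_all
  next
    show "Dom E (cl (Idn B (FOb P X)) X) = X" if "X \<in> Ob E" for X
      using that by (simp add: cl_Idn E.typing)
    show "Dom E (cl (Comp B g f) X) = Dom E (cl f (Dom E (cl g X)))"
      if "f \<in> Ar B" "g \<in> Ar B" "Cod B f = Dom B g" "X \<in> Ob E" "Cod B g = FOb P X" for f g X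
      using that by (simp add: cl_Comp E.typing cl_Ar cl_Cod P_Dom_cl)
    show "act (sq_hid B (FAr P u)) u = u" if u: "u \<in> Ar E" for u
    proof -
      note [simp] = P.two_functor_simps E.typing u
      show ?thesis
        by (rule act_eqI)
          (auto simp: sq_hid_Ar sq_hid_simps act_rel_def cl_Idn E.unit_laws intro!: bexI[of _ "Idn2 E u"])
    qed
  qed (simp_all add: act_Ar act_Dom act_Cod P_act act_Comp act_mult)
qed

end

section \<open>Morphisms of discrete 2-fibrations\<close>

locale two_discrete_two_fibs = two_category B + E: discrete_two_fib B E P cl + E': discrete_two_fib B E' P' cl'
  for B :: "('o, 'a, 'c) twocat" and E :: "('p, 'b, 'd) twocat" and P and cl
    and E' :: "('p', 'b', 'd') twocat" and P' and cl'
begin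

text \<open>\<open>H\<close> carries a witnessing 2-cell to a witnessing 2-cell, since it respects
  projections and chosen arrows.\<close>

lemma act_preserved:
  assumes "is_two_functor E E' H"
    and H_Ob: "\<And>X. X \<in> Ob E \<Longrightarrow> FOb P' (FOb H X) = FOb P X"
    and H_Ar: "\<And>u. u \<in> Ar E \<Longrightarrow> FAr P' (FAr H u) = FAr P u"
    and H_Ce: "\<And>a. a \<in> Ce E \<Longrightarrow> FCe P' (FCe H a) = FCe P a"
    and H_cl: "\<And>f X. \<lbrakk>f \<in> Ar B; X \<in> Ob E; Cod B f = FOb P X\<rbrakk> \<Longrightarrow> FAr H (cl f X) = cl' f (FOb H X)"
    and s: "s \<in> Ar (Sq B)" "u \<in> Ar E" "sqk s = FAr P u"
  shows "FAr H (E.act s u) = E'.act s (FAr H u)"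
proof -
  interpret H: two_functor E E' H by unfold_locales fact
  note [simp] = H.two_functor_simps H_Ob H_Ar H_Ce E.E.typing
  have *: "sqf s \<in> Ar B" "Cod B (sqf s) = FOb P (Dom E u)" "sqg s \<in> Ar B" "Cod B (sqg s) = FOb P (Cod E u)"
    using s by (auto simp: E.P.two_functor_simps Sq_Ar_iff)
  have c: "cl' (sqf s) (FOb H (Dom E u)) = FAr H (cl (sqf s) (Dom E u))"
    "cl' (sqg s) (FOb H (Cod E u)) = FAr H (cl (sqg s) (Cod E u))"
    using * s by (simp_all add: H_cl)
  note [simp] = E.square_cl_f[OF s] E.square_cl_g[OF s] E.act_Ar[OF s] E.act_Cod[OF s] E.act_Dom[OF s] E.P_act[OF s]
  obtain a where a: "a \<in> Ce E" "Dom2 E a = Comp E u (cl (sqf s) (Dom E u))"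
    "Cod2 E a = Comp E (cl (sqg s) (Cod E u)) (E.act s u)" "FCe P a = sqc s" using E.actE[OF s] .
  have "E'.act_rel s (FAr H u) (FAr H (E.act s u))"
    unfolding E'.act_rel_def using a s(2) by (auto simp: c intro!: bexI[of _ "FCe H a"])
  then show ?thesis using s by (intro E'.act_eqI[symmetric]) auto
qed

text \<open>There is no freedom in the 2-cells: a 2-functor over \<open>B\<close> must send
  \<open>a\<close> to the lift of \<open>FCe P a\<close> out of
  \<open>FAr H (Dom2 E a)\<close>.\<close>

definition extend :: "('p, 'b, 'p', 'b') functr \<Rightarrow> ('p, 'b, 'd, 'p', 'b', 'd') twofunctr" where
  "extend H = \<lparr>FOb = FOb H, FAr = FAr H, FCe = (\<lambda>a\<in>Ce E. E'.lift (FAr H (Dom2 E a)) (FCe P a))\<rparr>"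

lemma extend_simps [simp]: "FOb (extend H) = FOb H" "FAr (extend H) = FAr H"
  by (simp_all add: extend_def)

context
  fixes H :: "('p, 'b, 'p', 'b') functr"
  assumes H: "is_functor E E' H"
    and H_Ob: "\<And>X. X \<in> Ob E \<Longrightarrow> FOb P' (FOb H X) = FOb P X"
    and H_Ar: "\<And>u. u \<in> Ar E \<Longrightarrow> FAr P' (FAr H u) = FAr P u"
    and H_act: "\<And>s u. \<lbrakk>s \<in> Ar (Sq B); u \<in> Ar E; sqk s = FAr P u\<rbrakk> \<Longrightarrow> FAr H (E.act s u) = E'.act s (FAr H u)"
begin

text \<open>The target is the point at issue, as the lift is prescribed by its source and projection
  only. It is read off from the action of \<open>cell_sq\<close>, which returns targets and is
  preserved by \<open>H\<close>.\<close>

lemma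
  assumes a: "a \<in> Ce E"
  shows extend_Ce: "FCe (extend H) a \<in> Ce E'" and Dom2_extend: "Dom2 E' (FCe (extend H) a) = FAr H (Dom2 E a)"
    and P_extend: "FCe P' (FCe (extend H) a) = FCe P a" and Cod2_extend: "Cod2 E' (FCe (extend H) a) = FAr H (Cod2 E a)"
proof -
  interpret H: functor_on E E' H by unfold_locales fact
  have *: "FAr H (Dom2 E a) \<in> Ar E'" "FCe P a \<in> Ce B" "Dom2 B (FCe P a) = FAr P' (FAr H (Dom2 E a))"
    using a by (simp_all add: H.functor_simps E.E.typing E.P.two_functor_simps H_Ar)
  show **: "FCe (extend H) a \<in> Ce E'" "Dom2 E' (FCe (extend H) a) = FAr H (Dom2 E a)"
    "FCe P' (FCe (extend H) a) = FCe P a"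
    using E'.lift_Ce[OF *] E'.Dom2_lift[OF *] E'.P_lift[OF *] a by (simp_all add: extend_def)
  show "Cod2 E' (FCe (extend H) a) = FAr H (Cod2 E a)"
    using E'.act_cell_sq[OF **(1)] E.act_cell_sq[OF a] ** a
      H_act[of "cell_sq B (FCe P a)" "Dom2 E a"]
    by (simp add: E.P.two_functor_simps cell_sq_Ar cell_sq_simps E.E.typing)
qed

text \<open>The two sides of every law for 2-cells have the same source and lie over the same 2-cell
  of \<open>B\<close>.\<close>

lemma is_two_functor_extend: "is_two_functor E E' (extend H)"
proof -
  interpret H: functor_on E E' H by unfold_locales fact
  note [simp] = extend_Ce Dom2_extend P_extend Cod2_extend H.functor_simps H_Ob H_Ar E.E.typing E'.E.typing
    E.P.two_functor_simps E'.P.two_functor_simps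
  show ?thesis
  proof (rule is_two_functorI)
    show "is_functor E E' (extend H)" using H by (simp add: is_functor_def)
    show "FCe (extend H) \<in> Ce E \<rightarrow>\<^sub>E Ce E'"
      by (rule PiE_I) (rule extend_Ce, simp_all add: extend_def)
  qed (auto intro!: E'.lift_unique)
qed

text \<open>Chosen arrows are instances of the action on identities, and \<open>H\<close> preserves
  both.\<close>

lemma extend_cl:
  assumes "f \<in> Ar B" "X \<in> Ob E" "Cod B f = FOb P X"
  shows "FAr H (cl f X) = cl' f (FOb H X)"
proof -
  interpret H: functor_on E E' H by unfold_locales fact
  show ?thesis
    using assms E.act_cart_sq[OF assms] E'.act_cart_sq[of f "FOb H X"] H_act[of "cart_sq B f" "Idn E X"]
    by (simp add: H.functor_simps H_Ob cart_sq_Ar cart_sq_simps E.E.typing E.P.two_functor_simps)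
qed

end

context
  fixes H K :: "('p, 'b, 'd, 'p', 'b', 'd') twofunctr" and \<theta>
  assumes H: "is_two_functor E E' H" and K: "is_two_functor E E' K"
    and H_Ob: "\<And>X. X \<in> Ob E \<Longrightarrow> FOb P' (FOb H X) = FOb P X"
    and K_Ob: "\<And>X. X \<in> Ob E \<Longrightarrow> FOb P' (FOb K X) = FOb P X"
    and H_Ce: "\<And>a. a \<in> Ce E \<Longrightarrow> FCe P' (FCe H a) = FCe P a"
    and K_Ce: "\<And>a. a \<in> Ce E \<Longrightarrow> FCe P' (FCe K a) = FCe P a"
    and nt: "nat_trans E E' H K \<theta>"
    and vertical: "\<And>X. X \<in> Ob E \<Longrightarrow> FAr P' (\<theta> X) = Idn B (FOb P X)"
begin

text \<open>By naturality the two whiskered 2-cells have the same source, and since the components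
  are vertical both lie over \<open>FCe P a\<close>.\<close>

lemma two_nat_trans: "two_nat_trans E E' H K \<theta>"
proof -
  interpret H: two_functor E E' H by unfold_locales fact
  interpret K: two_functor E E' K by unfold_locales fact
  interpret t: nat_transformation E E' H K \<theta>
    using nt by (simp add: nat_transformation_def nat_transformation_axioms_def E.E.category_self E'.E.category_self
        H.functor_on_axioms K.functor_on_axioms)
  have nat: "Comp E' (FAr K (Dom2 E a)) (\<theta> (Dom E (Dom2 E a))) = Comp E' (\<theta> (Cod E (Dom2 E a))) (FAr H (Dom2 E a))"
    if "a \<in> Ce E" for a using that t.naturality by (simp add: E.E.typing)
  note [simp] = H.two_functor_simps K.two_functor_simps t.nt_simps E.E.typing E'.E.typing vertical H_Ob K_Ob H_Ce K_Ce
    E.P.two_functor_simps E'.P.two_functor_simps nat unit_laws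
  have "HComp E' (FCe K a) (Idn2 E' (\<theta> (Dom E (Dom2 E a)))) = HComp E' (Idn2 E' (\<theta> (Cod E (Dom2 E a)))) (FCe H a)"
    if "a \<in> Ce E" for a
    by (rule E'.lift_unique) (use that in simp_all)
  with nt show ?thesis by (simp add: two_nat_trans_def)
qed

text \<open>Naturality at the chosen arrow equates the composite of that arrow with
  \<open>\<theta> X\<close> and the composite of the component at \<open>Dom E (cl f X)\<close> with
  a chosen arrow. The identity 2-cell of this common arrow is the witness over the identity
  square.\<close>

lemma act_component:
  assumes H_cl: "\<And>f X. \<lbrakk>f \<in> Ar B; X \<in> Ob E; Cod B f = FOb P X\<rbrakk> \<Longrightarrow> FAr H (cl f X) = cl' f (FOb H X)"
    and K_cl: "\<And>f X. \<lbrakk>f \<in> Ar B; X \<in> Ob E; Cod B f = FOb P X\<rbrakk> \<Longrightarrow> FAr K (cl f X) = cl' f (FOb K X)"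
    and f: "f \<in> Ar B" "X \<in> Ob E" "Cod B f = FOb P X"
  shows "\<theta> (Dom E (cl f X)) = E'.act (Idn (Sq B) f) (\<theta> X)"
proof -
  interpret S: category "Sq B" by (rule category_Sq)
  interpret H: two_functor E E' H by unfold_locales fact
  interpret K: two_functor E E' K by unfold_locales fact
  interpret t: nat_transformation E E' H K \<theta>
    using nt by (simp add: nat_transformation_def nat_transformation_axioms_def E.E.category_self E'.E.category_self
        H.functor_on_axioms K.functor_on_axioms)
  note [simp] = H.two_functor_simps K.two_functor_simps t.nt_simps E.E.typing E'.E.typing vertical H_Ob K_Ob H_Ce K_Ce
    E.P.two_functor_simps E'.P.two_functor_simps unit_laws E.cl_Ar[OF f] E.cl_Cod[OF f] E.P_cl[OF f] f
    H_cl[OF f, symmetric] K_cl[OF f, symmetric]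
  have nat: "Comp E' (FAr K (cl f X)) (\<theta> (Dom E (cl f X))) = Comp E' (\<theta> X) (FAr H (cl f X))"
    using t.naturality[of "cl f X"] by simp
  have P_H: "FAr P' (FAr H (cl f X)) = f"
    using E'.P_cl[of f "FOb H X"] by simp
  have v: "Idn (Sq B) f \<in> Ar (Sq B)" using S.Idn_Ar[of f] by (simp add: Sq_simps)
  have "E'.act_rel (Idn (Sq B) f) (\<theta> X) (\<theta> (Dom E (cl f X)))"
    unfolding E'.act_rel_def
    by (auto simp: Sq_simps nat P_H E.P_Dom_cl[OF f] intro!: bexI[of _ "Idn2 E' (Comp E' (\<theta> X) (FAr H (cl f X)))"])
  then show ?thesis
    by (intro E'.act_eqI[symmetric]) (auto simp: v, simp add: Sq_simps)
qed

end

end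

section \<open>The discrete 2-fibration of an algebra\<close>

lemma is_functor_hom_functor:
  assumes "two_category E" "is_two_functor E B P"
  shows "is_functor (hom_cat E X Y) (hom_cat B (FOb P X) (FOb P Y)) (hom_functor E P X Y)"
proof -
  interpret E: two_category E by fact
  interpret P: two_functor E B P by unfold_locales fact
  show ?thesis
    by (rule is_functorI) (auto simp: hom_functor_def hom_cat_def P.two_functor_simps E.typing)
qed

section \<open>Relations among cell squares, cartesian squares and factoring squares\<close>

context two_category begin

lemma cell_sq_Idn2: "k \<in> Ar B \<Longrightarrow> cell_sq B (Idn2 B k) = sq_hid B k"
  by (simp add: cell_sq_def sq_hid_def typing)

text \<open>A cell square has the source of its 2-cell on the right and the target on the left, so
  vertical composition becomes horizontal pasting with the factors in the opposite order.\<close>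

lemma cell_sq_VComp:
  "\<lbrakk>\<alpha> \<in> Ce B; \<beta> \<in> Ce B; Dom2 B \<beta> = Cod2 B \<alpha>\<rbrakk>
    \<Longrightarrow> sq_hcomp B (cell_sq B \<alpha>) (cell_sq B \<beta>) = cell_sq B (VComp B \<beta> \<alpha>)"
  by (simp add: cell_sq_def sq_hcomp_def typing unit_laws)

lemma cell_sq_HComp:
  "\<lbrakk>\<alpha> \<in> Ce B; \<beta> \<in> Ce B; Dom B (Dom2 B \<beta>) = Cod B (Dom2 B \<alpha>)\<rbrakk>
    \<Longrightarrow> Comp (Sq B) (cell_sq B \<beta>) (cell_sq B \<alpha>) = cell_sq B (HComp B \<beta> \<alpha>)"
  by (simp add: cell_sq_def Sq_simps typing HComp_conv_left_right[symmetric])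

lemma cart_sq_Idn: "X \<in> Ob B \<Longrightarrow> cart_sq B (Idn B X) = Idn (Sq B) (Idn B X)"
  by (simp add: cart_sq_def Sq_simps typing)

lemma Sq_Idn_Ar: "f \<in> Ar B \<Longrightarrow> Idn (Sq B) f \<in> Ar (Sq B)"
  by (simp add: Sq_simps Sq_Ar_iff typing unit_laws)

text \<open>The square behind the splitting law; pasting with the identity square of
  \<open>g\<close> accounts for taking the chosen arrow over \<open>f\<close> at
  \<open>mo g X\<close>.\<close>

lemma cart_sq_Comp:
  "\<lbrakk>f \<in> Ar B; g \<in> Ar B; Dom B g = Cod B f\<rbrakk>
    \<Longrightarrow> Comp (Sq B) (cart_sq B g) (sq_hcomp B (Idn (Sq B) g) (cart_sq B f)) = cart_sq B (Comp B g f)"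
  by (simp add: cart_sq_def sq_hcomp_def Sq_simps typing unit_laws HComp_Idn2)

text \<open>The square through which an arrow \<open>h\<close> over \<open>f \<circ> w\<close> factors along the chosen arrow over \<open>f\<close>.\<close>

definition factor_sq :: "'a \<Rightarrow> 'a \<Rightarrow> ('a, 'c) square" where
  "factor_sq f w = \<lparr>sqf = Idn B (Dom B w), sqg = f, sqh = w, sqk = Comp B f w, sqc = Idn2 B (Comp B f w)\<rparr>"

lemma factor_sq_Ar: "\<lbrakk>f \<in> Ar B; w \<in> Ar B; Cod B w = Dom B f\<rbrakk> \<Longrightarrow> factor_sq f w \<in> Ar (Sq B)"
  by (simp add: factor_sq_def Sq_Ar_iff typing unit_laws)

text \<open>Gives existence of factorisations: the square on the right acts as the identity on an
  arrow over \<open>Comp B f w\<close>.\<close>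

lemma cart_sq_factor_sq:
  "\<lbrakk>f \<in> Ar B; w \<in> Ar B; Cod B w = Dom B f\<rbrakk>
    \<Longrightarrow> Comp (Sq B) (cart_sq B f) (factor_sq f w) = sq_hid B (Comp B f w)"
  by (simp add: factor_sq_def cart_sq_def sq_hid_def Sq_simps typing unit_laws HComp_Idn2)

text \<open>First half of uniqueness: on a composite of the chosen arrow with \<open>v\<close>, the
  factoring action separates into an action on the chosen arrow and the identity action on
  \<open>v\<close>.\<close>

lemma factor_sq_sq_hid:
  "\<lbrakk>f \<in> Ar B; w \<in> Ar B; Cod B w = Dom B f\<rbrakk>
    \<Longrightarrow> Comp (Sq B) (factor_sq f (Idn B (Dom B f))) (sq_hid B w) = factor_sq f w"
  by (simp add: factor_sq_def sq_hid_def Sq_simps typing unit_laws HComp_Idn2)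

text \<open>Second half of uniqueness: the factoring action for an identity \<open>w\<close> sends
  the chosen arrow over \<open>f\<close> to an identity.\<close>

lemma factor_sq_cart_sq:
  "f \<in> Ar B \<Longrightarrow> sq_hcomp B (cart_sq B f) (factor_sq f (Idn B (Dom B f))) = Idn (Sq B) f"
  by (simp add: factor_sq_def cart_sq_def sq_hcomp_def Sq_simps typing unit_laws HComp_Idn2)

text \<open>Both sides are the square from \<open>sqf s\<close> to an identity with the 2-cell of
  \<open>s\<close>. Its left side, \<open>sqg s\<close> after \<open>sqh s\<close>, arises on one
  hand as the target of the 2-cell and on the other as a composite of squares.\<close>

lemma sq_decomposition:
  assumes "s \<in> Ar (Sq B)"
  shows "sq_hcomp B (Comp (Sq B) (sq_hid B (sqk s)) (cart_sq B (sqf s))) (cell_sq B (sqc s)) =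
    Comp (Sq B) (cart_sq B (sqg s)) s"
  using assms
  by (simp add: Sq_Ar_iff sq_hid_def cart_sq_def cell_sq_def sq_hcomp_def Sq_simps typing unit_laws HComp_Idn2)

end

section \<open>Chosen arrows and transport along 2-cells from an action\<close>

context sq_algebra begin

abbreviation chosen :: "'a \<Rightarrow> 'p \<Rightarrow> 'b" where
  "chosen f X \<equiv> ma (cart_sq B f) (Idn A X)"

abbreviation push :: "'b \<Rightarrow> 'c \<Rightarrow> 'b" where
  "push u \<alpha> \<equiv> ma (cell_sq B \<alpha>) u"

lemma
  assumes "f \<in> Ar B" "X \<in> Ob A" "Cod B f = FOb q X"
  shows chosen_Ar: "chosen f X \<in> Ar A" and chosen_Dom: "Dom A (chosen f X) = mo f X"
    and chosen_Cod: "Cod A (chosen f X) = X" and q_chosen: "FAr q (chosen f X) = f"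
  using assms by (simp_all add: ma_Ar ma_Dom ma_Cod q_ma cart_sq_Ar cart_sq_simps A.cat_typing q.functor_simps mo_unit)

lemma
  assumes "u \<in> Ar A" "\<alpha> \<in> Ce B" "Dom2 B \<alpha> = FAr q u"
  shows push_Ar: "push u \<alpha> \<in> Ar A" and push_Dom: "Dom A (push u \<alpha>) = Dom A u"
    and push_Cod: "Cod A (push u \<alpha>) = Cod A u" and q_push: "FAr q (push u \<alpha>) = Cod2 B \<alpha>"
  using assms by (simp_all add: ma_Ar ma_Dom ma_Cod q_ma cell_sq_Ar cell_sq_simps A.cat_typing q.functor_simps mo_unit)

lemma push_Idn2: "u \<in> Ar A \<Longrightarrow> push u (Idn2 B (FAr q u)) = u"
  by (simp add: cell_sq_Idn2 q.functor_simps ma_unit)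

lemma push_VComp:
  assumes "u \<in> Ar A" "\<alpha> \<in> Ce B" "Dom2 B \<alpha> = FAr q u" "\<beta> \<in> Ce B" "Dom2 B \<beta> = Cod2 B \<alpha>"
  shows "push u (VComp B \<beta> \<alpha>) = push (push u \<alpha>) \<beta>"
  using assms ma_mult[of "cell_sq B \<beta>" "cell_sq B \<alpha>" u] by (simp add: cell_sq_VComp cell_sq_Ar cell_sq_simps)

lemma push_HComp:
  assumes "u \<in> Ar A" "\<alpha> \<in> Ce B" "Dom2 B \<alpha> = FAr q u" "v \<in> Ar A" "\<beta> \<in> Ce B" "Dom2 B \<beta> = FAr q v" "Dom A v = Cod A u"
  shows "push (Comp A v u) (HComp B \<beta> \<alpha>) = Comp A (push v \<beta>) (push u \<alpha>)"
  using assms ma_Comp[of "cell_sq B \<alpha>" u "cell_sq B \<beta>" v]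
  by (simp add: cell_sq_HComp cell_sq_Ar cell_sq_simps q.functor_simps)

lemma chosen_Idn: "X \<in> Ob A \<Longrightarrow> chosen (Idn B (FOb q X)) X = Idn A X"
  by (simp add: cart_sq_Idn ma_Idn mo_unit q.functor_simps typing)

lemma chosen_Comp:
  assumes "f \<in> Ar B" "g \<in> Ar B" "Cod B f = Dom B g" "X \<in> Ob A" "Cod B g = FOb q X"
  shows "chosen (Comp B g f) X = Comp A (chosen g X) (chosen f (mo g X))"
proof -
  note [simp] = assms Sq_Idn_Ar cart_sq_Ar cart_sq_simps sq_hcomp_simps Sq_simps(2,3) A.cat_typing q.functor_simps typing
  have [simp]: "sqf (Idn (Sq B) h) = h" "sqg (Idn (Sq B) h) = h" "sqh (Idn (Sq B) h) = Idn B (Dom B h)"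
    "sqk (Idn (Sq B) h) = Idn B (Cod B h)" for h
    by (simp_all add: Sq_simps)
  \<comment> \<open>The identity of \<open>mo g X\<close> is the action of the identity square of
    \<open>g\<close>, so both chosen arrows become actions on the identity of
    \<open>X\<close>.\<close>
  have "chosen f (mo g X) = ma (cart_sq B f) (ma (Idn (Sq B) g) (Idn A X))"
    by (simp add: ma_Idn)
  also have "\<dots> = ma (sq_hcomp B (Idn (Sq B) g) (cart_sq B f)) (Idn A X)"
    by (rule ma_mult[symmetric]) simp_all
  finally have "Comp A (chosen g X) (chosen f (mo g X)) =
      Comp A (chosen g X) (ma (sq_hcomp B (Idn (Sq B) g) (cart_sq B f)) (Idn A X))" by simp
  also have "\<dots> = ma (Comp (Sq B) (cart_sq B g) (sq_hcomp B (Idn (Sq B) g) (cart_sq B f))) (Comp A (Idn A X) (Idn A X))"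
    by (rule ma_Comp[symmetric]) (simp_all add: sq_hcomp_Ar unit_laws)
  also have "\<dots> = chosen (Comp B g f) X"
    by (simp add: cart_sq_Comp A.Idn_Idn)
  finally show ?thesis by simp
qed

text \<open>The factorisation is an explicit action, that of \<open>factor_sq f w\<close> on
  \<open>h\<close>.\<close>

lemma ex1_factor:
  assumes f: "f \<in> Ar B" "X \<in> Ob A" "Cod B f = FOb q X"
    and h: "h \<in> Ar A" "Cod A h = X" and w: "w \<in> Ar B" "Cod B w = Dom B f" "Comp B f w = FAr q h"
  shows "\<exists>!v. v \<in> Ar A \<and> Dom A v = Dom A h \<and> Cod A v = mo f X \<and> FAr q v = w \<and> Comp A (chosen f X) v = h"
proof (rule ex1I)
  have "Dom B (Comp B f w) = Dom B w" using typing(7)[of w f] w f by metis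
  then have Dw: "FOb q (Dom A h) = Dom B w" unfolding w(3) using q.F_Dom[OF h(1)] by metis
  note [simp] = f h w(1,2) w(3)[symmetric] cart_sq_Ar cart_sq_simps factor_sq_Ar Sq_simps(2,3)
    A.cat_typing q.functor_simps typing sq_hid_Ar sq_hid_simps chosen_Ar chosen_Dom chosen_Cod q_chosen
  have fs [simp]: "sqf (factor_sq f w') = Idn B (Dom B w')" "sqg (factor_sq f w') = f" "sqh (factor_sq f w') = w'"
    "sqk (factor_sq f w') = Comp B f w'" for w'
    by (simp_all add: factor_sq_def)
  have "Comp A (chosen f X) (ma (factor_sq f w) h) = ma (Comp (Sq B) (cart_sq B f) (factor_sq f w)) (Comp A (Idn A X) h)"
    by (rule ma_Comp[symmetric]) simp_all
  also have "\<dots> = h" 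
    using ma_unit[of h] by (simp add: cart_sq_factor_sq A.Idn_Comp')
  finally show "ma (factor_sq f w) h \<in> Ar A \<and> Dom A (ma (factor_sq f w) h) = Dom A h \<and>
      Cod A (ma (factor_sq f w) h) = mo f X \<and> FAr q (ma (factor_sq f w) h) = w \<and>
      Comp A (chosen f X) (ma (factor_sq f w) h) = h"
    using mo_unit[of "Dom A h"] by (simp add: ma_Ar ma_Dom ma_Cod q_ma Dw)
  fix v assume v: "v \<in> Ar A \<and> Dom A v = Dom A h \<and> Cod A v = mo f X \<and> FAr q v = w \<and> Comp A (chosen f X) v = h"
  \<comment> \<open>For uniqueness \<open>h\<close> is replaced by its factorisation through
    \<open>v\<close>. The action splits accordingly, into an identity from the chosen arrow and
    \<open>v\<close> itself.\<close>
  have "ma (factor_sq f w) h = ma (Comp (Sq B) (factor_sq f (Idn B (Dom B f))) (sq_hid B w)) (Comp A (chosen f X) v)"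
    using v by (simp add: factor_sq_sq_hid)
  also have "\<dots> = Comp A (ma (factor_sq f (Idn B (Dom B f))) (chosen f X)) (ma (sq_hid B w) v)"
    using v by (intro ma_Comp) (simp_all add: unit_laws)
  also have "ma (factor_sq f (Idn B (Dom B f))) (chosen f X) = ma (sq_hcomp B (cart_sq B f) (factor_sq f (Idn B (Dom B f)))) (Idn A X)"
    by (rule ma_mult[symmetric]) (simp_all add: unit_laws)
  also have "\<dots> = Idn A (mo f X)" by (simp add: factor_sq_cart_sq ma_Idn)
  also have "ma (sq_hid B w) v = v" using v ma_unit[of v] by simp
  also have "Comp A (Idn A (mo f X)) v = v" using v by (simp add: A.Idn_Comp')
  finally show "v = ma (factor_sq f w) h" by simp
qed

text \<open>\<open>sq_decomposition\<close> read as an action on \<open>u\<close>. It identifies the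
  target of the 2-cell by which \<open>ma s u\<close> is later recognised as the action of the
  constructed 2-fibration.\<close>

lemma push_chosen:
  assumes s: "s \<in> Ar (Sq B)" "u \<in> Ar A" "sqk s = FAr q u"
  shows "push (Comp A u (chosen (sqf s) (Dom A u))) (sqc s) = Comp A (chosen (sqg s) (Cod A u)) (ma s u)"
proof -
  note S = s(1)[unfolded Sq_Ar_iff]
  have f: "sqf s \<in> Ar B" "Dom A u \<in> Ob A" "Cod B (sqf s) = FOb q (Dom A u)"
    and g: "sqg s \<in> Ar B" "Cod A u \<in> Ob A" "Cod B (sqg s) = FOb q (Cod A u)"
    using s S by (auto simp: A.cat_typing q.functor_simps)
  note [simp] = f g cart_sq_Ar cart_sq_simps Sq_simps(2,3)
    A.cat_typing q.functor_simps typing sq_hid_Ar sq_hid_simps cell_sq_Ar cell_sq_simps s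
  interpret S: category "Sq B" by (rule category_Sq)
  let ?\<sigma> = "Comp (Sq B) (sq_hid B (sqk s)) (cart_sq B (sqf s))"
  have \<sigma>: "?\<sigma> \<in> Ar (Sq B)" "sqh ?\<sigma> = Comp B (sqk s) (sqf s)" "sqk ?\<sigma> = FAr q u"
    using S S.Comp_Ar[of "cart_sq B (sqf s)" "sq_hid B (sqk s)"] by (simp, simp_all add: Sq_simps unit_laws)
  have "Comp A u (chosen (sqf s) (Dom A u)) = Comp A (ma (sq_hid B (sqk s)) u) (chosen (sqf s) (Dom A u))"
    by (simp add: ma_unit)
  also have "\<dots> = ma ?\<sigma> (Comp A u (Idn A (Dom A u)))"
    by (rule ma_Comp[symmetric]) (use S in simp_all)
  also have "\<dots> = ma ?\<sigma> u" by (simp add: A.Comp_Idn')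
  finally have "push (Comp A u (chosen (sqf s) (Dom A u))) (sqc s) = push (ma ?\<sigma> u) (sqc s)" by simp
  also have "\<dots> = ma (sq_hcomp B ?\<sigma> (cell_sq B (sqc s))) u"
    by (rule ma_mult[symmetric]) (use S \<sigma> in simp_all)
  also have "\<dots> = ma (Comp (Sq B) (cart_sq B (sqg s)) s) (Comp A (Idn A (Cod A u)) u)"
    using sq_decomposition[OF s(1)] by (simp add: A.Idn_Comp')
  also have "\<dots> = Comp A (chosen (sqg s) (Cod A u)) (ma s u)"
    by (rule ma_Comp) (use S in simp_all)
  finally show ?thesis .
qed

end

text \<open>A 2-cell of the total 2-category is a 2-cell of \<open>B\<close> together with a lift of its source; the
  pair is coded by \<open>e\<close>.\<close>

locale sq_algebra_code = sq_algebra B A q mo ma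
  for B :: "('o, 'a, 'c) twocat" and A :: "('p, 'b) cat" and q :: "('p, 'b, 'o, 'a) functr" and mo ma +
  fixes e :: "'b \<times> 'c \<Rightarrow> 'd" and d :: "'d \<Rightarrow> 'b \<times> 'c"
  assumes d_e [simp]: "d (e x) = x"
begin

definition tot :: "('p, 'b, 'd) twocat" where
  "tot = \<lparr>Ob = Ob A, Ar = Ar A, Dom = Dom A, Cod = Cod A, Idn = Idn A, Comp = Comp A,
     Ce = e ` {(u, \<alpha>). u \<in> Ar A \<and> \<alpha> \<in> Ce B \<and> Dom2 B \<alpha> = FAr q u},
     Dom2 = (\<lambda>c. fst (d c)), Cod2 = (\<lambda>c. push (fst (d c)) (snd (d c))),
     Idn2 = (\<lambda>u. e (u, Idn2 B (FAr q u))),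
     VComp = (\<lambda>b a. e (fst (d a), VComp B (snd (d b)) (snd (d a)))),
     HComp = (\<lambda>b a. e (Comp A (fst (d b)) (fst (d a)), HComp B (snd (d b)) (snd (d a))))\<rparr>"

definition tot_proj :: "('p, 'b, 'd, 'o, 'a, 'c) twofunctr" where
  "tot_proj = \<lparr>FOb = FOb q, FAr = FAr q, FCe = (\<lambda>c\<in>Ce tot. snd (d c))\<rparr>"

lemma tot_simps:
  "Ob tot = Ob A" "Ar tot = Ar A" "Dom tot = Dom A" "Cod tot = Cod A" "Idn tot = Idn A" "Comp tot = Comp A"
  "Ce tot = e ` {(u, \<alpha>). u \<in> Ar A \<and> \<alpha> \<in> Ce B \<and> Dom2 B \<alpha> = FAr q u}"
  "Dom2 tot (e (u, \<alpha>)) = u" "Cod2 tot (e (u, \<alpha>)) = push u \<alpha>" "Idn2 tot u = e (u, Idn2 B (FAr q u))"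
  "VComp tot (e (v, \<beta>)) (e (u, \<alpha>)) = e (u, VComp B \<beta> \<alpha>)"
  "HComp tot (e (v, \<beta>)) (e (u, \<alpha>)) = e (Comp A v u, HComp B \<beta> \<alpha>)"
  by (simp_all add: tot_def)

lemma e_eq_iff [simp]: "e x = e y \<longleftrightarrow> x = y"
  by (metis d_e)

lemma under_tot: "under tot = A"
  by (simp add: under_def cat.truncate_def tot_def)

lemma tot_CeE:
  assumes "c \<in> Ce tot"
  obtains u \<alpha> where "c = e (u, \<alpha>)" "u \<in> Ar A" "\<alpha> \<in> Ce B" "Dom2 B \<alpha> = FAr q u"
  using assms by (auto simp: tot_simps)

lemma pre_two_category_tot: "pre_two_category tot"
proof
  note [simp] = tot_simps A.cat_typing push_Ar push_Dom push_Cod push_Idn2 push_VComp push_HComp q_push typing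
    q.functor_simps
  show "Dom2 tot c \<in> Ar tot" "Cod2 tot c \<in> Ar tot" "Dom tot (Cod2 tot c) = Dom tot (Dom2 tot c)"
    "Cod tot (Cod2 tot c) = Cod tot (Dom2 tot c)" if "c \<in> Ce tot" for c
    using that by (auto elim!: tot_CeE)
  show "Idn2 tot u \<in> Ce tot" "Dom2 tot (Idn2 tot u) = u" "Cod2 tot (Idn2 tot u) = u" if "u \<in> Ar tot" for u
    using that by auto
  show "VComp tot b a \<in> Ce tot" "Dom2 tot (VComp tot b a) = Dom2 tot a" "Cod2 tot (VComp tot b a) = Cod2 tot b"
    if "a \<in> Ce tot" "b \<in> Ce tot" "Dom2 tot b = Cod2 tot a" for a b
    using that by (auto elim!: tot_CeE)
  show "HComp tot b a \<in> Ce tot" "Dom2 tot (HComp tot b a) = Comp tot (Dom2 tot b) (Dom2 tot a)"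
    "Cod2 tot (HComp tot b a) = Comp tot (Cod2 tot b) (Cod2 tot a)"
    if "a \<in> Ce tot" "b \<in> Ce tot" "Dom tot (Dom2 tot b) = Cod tot (Dom2 tot a)" for a b
    using that by (auto elim!: tot_CeE)
qed (simp_all add: tot_simps A.cat_typing)

text \<open>2-cells are coded pairs from \<open>A\<close> and \<open>B\<close>, so the laws hold
  componentwise.\<close>

lemma two_category_tot: "two_category tot"
proof -
  note [simp] = tot_simps A.cat_typing push_Ar push_Dom push_Cod push_Idn2 push_VComp push_HComp q_push typing
    q.functor_simps unit_laws A.Comp_Idn' A.Idn_Comp'
  show ?thesis
    by (rule pre_two_category.two_categoryI[OF pre_two_category_tot])
      (auto elim!: tot_CeE simp: A.Comp_assoc VComp_assoc HComp_assoc HComp_Idn2 interchange)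
qed

lemma is_two_functor_tot_proj: "is_two_functor tot B tot_proj"
proof (rule is_two_functorI)
  note [simp] = tot_proj_def q.functor_simps typing push_Ar q_push
  note t = pre_two_category.typing[OF pre_two_category_tot]
  show "is_functor tot B tot_proj"
    using q.is_functor by (simp add: is_functor_def tot_simps(1-6))
  show "FCe tot_proj \<in> Ce tot \<rightarrow>\<^sub>E Ce B"
    by (auto elim!: tot_CeE)
  show "Dom2 B (FCe tot_proj c) = FAr tot_proj (Dom2 tot c)" "Cod2 B (FCe tot_proj c) = FAr tot_proj (Cod2 tot c)"
    if "c \<in> Ce tot" for c
    using that by (auto elim!: tot_CeE simp: tot_simps)
  show "FCe tot_proj (Idn2 tot u) = Idn2 B (FAr tot_proj u)" if "u \<in> Ar tot" for u
    using t(13)[OF that] by (simp add: tot_simps(10))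
  show "FCe tot_proj (VComp tot b a) = VComp B (FCe tot_proj b) (FCe tot_proj a)"
    if "a \<in> Ce tot" "b \<in> Ce tot" "Dom2 tot b = Cod2 tot a" for a b
    using t(16)[OF that] that by (auto elim!: tot_CeE simp: tot_simps(11))
  show "FCe tot_proj (HComp tot b a) = HComp B (FCe tot_proj b) (FCe tot_proj a)"
    if "a \<in> Ce tot" "b \<in> Ce tot" "Dom tot (Dom2 tot b) = Cod tot (Dom2 tot a)" for a b
    using t(19)[OF that] that by (auto elim!: tot_CeE simp: tot_simps(12))
qed

lemma discrete_two_fib_tot: "discrete_two_fib B tot tot_proj chosen"
proof -
  have "split_fibration (under tot) (under B) tot_proj chosen"
    unfolding split_fibration_def cartesian_def
  proof (intro conjI ballI impI)
    show "is_functor (under tot) (under B) tot_proj"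
      using is_two_functor_tot_proj by (simp add: is_two_functor_def)
  next
    fix X f assume "X \<in> Ob (under tot)" "f \<in> Ar (under B)" "Cod (under B) f = FOb tot_proj X"
    then have f: "f \<in> Ar B" "X \<in> Ob A" "Cod B f = FOb q X"
      by (simp_all add: tot_simps tot_proj_def)
    note [simp] = chosen_Ar[OF f] chosen_Dom[OF f] chosen_Cod[OF f] q_chosen[OF f]
    show "chosen f X \<in> Ar (under tot)" "Cod (under tot) (chosen f X) = X" "FAr tot_proj (chosen f X) = f"
      by (simp_all add: tot_simps tot_proj_def)
    fix h w assume "h \<in> Ar (under tot)" "w \<in> Ar (under B)"
      and "Cod (under tot) h = Cod (under tot) (chosen f X) \<and> Dom (under B) w = FOb tot_proj (Dom (under tot) h) \<and>
        Cod (under B) w = FOb tot_proj (Dom (under tot) (chosen f X)) \<and>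
        Comp (under B) (FAr tot_proj (chosen f X)) w = FAr tot_proj h"
    then show "\<exists>!v. v \<in> Ar (under tot) \<and> Dom (under tot) v = Dom (under tot) h \<and>
        Cod (under tot) v = Dom (under tot) (chosen f X) \<and> FAr tot_proj v = w \<and>
        Comp (under tot) (chosen f X) v = h"
      using ex1_factor[OF f, of h w] q_mo[OF f] by (simp add: tot_simps tot_proj_def)
  next
    show "chosen (Idn (under B) (FOb tot_proj X)) X = Idn (under tot) X" if "X \<in> Ob (under tot)" for X
      using that by (simp add: chosen_Idn tot_simps tot_proj_def)
    show "chosen (Comp (under B) g f) X = Comp (under tot) (chosen g X) (chosen f (Dom (under tot) (chosen g X)))"
      if "X \<in> Ob (under tot)" "g \<in> Ar (under B)" "f \<in> Ar (under B)"
        "Cod (under B) g = FOb tot_proj X \<and> Cod (under B) f = Dom (under B) g" for X g f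
      using that by (simp add: chosen_Comp chosen_Dom tot_simps tot_proj_def)
  qed
  moreover have "discrete_opfibration (hom_cat tot X Y) (hom_cat B (FOb tot_proj X) (FOb tot_proj Y))
      (hom_functor tot tot_proj X Y)" for X Y
    unfolding discrete_opfibration_def
  proof (intro conjI ballI impI is_functor_hom_functor two_category_tot is_two_functor_tot_proj)
    fix u \<alpha> assume "u \<in> Ob (hom_cat tot X Y)" "\<alpha> \<in> Ar (hom_cat B (FOb tot_proj X) (FOb tot_proj Y))"
      "Dom (hom_cat B (FOb tot_proj X) (FOb tot_proj Y)) \<alpha> = FOb (hom_functor tot tot_proj X Y) u"
    then have u: "u \<in> Ar A" "Dom A u = X" "Cod A u = Y" "\<alpha> \<in> Ce B" "Dom2 B \<alpha> = FAr q u"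
      by (auto simp: hom_cat_def hom_functor_def tot_simps tot_proj_def)
    show "\<exists>!a. a \<in> Ar (hom_cat tot X Y) \<and> Dom (hom_cat tot X Y) a = u \<and> FAr (hom_functor tot tot_proj X Y) a = \<alpha>"
    \<comment> \<open>A 2-cell is by construction its source together with its projection, so this
      pair is the only candidate.\<close>
    proof (rule ex1I[of _ "e (u, \<alpha>)"])
      have c: "e (u, \<alpha>) \<in> Ce tot" using u by (simp add: tot_simps)
      then show "e (u, \<alpha>) \<in> Ar (hom_cat tot X Y) \<and> Dom (hom_cat tot X Y) (e (u, \<alpha>)) = u \<and>
          FAr (hom_functor tot tot_proj X Y) (e (u, \<alpha>)) = \<alpha>"
        using u by (simp add: hom_cat_def hom_functor_def tot_proj_def tot_simps(3,4,8))
      show "a = e (u, \<alpha>)" if "a \<in> Ar (hom_cat tot X Y) \<and> Dom (hom_cat tot X Y) a = u \<and>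
          FAr (hom_functor tot tot_proj X Y) a = \<alpha>" for a
      proof -
        have a: "a \<in> Ce tot" "Dom2 tot a = u" "FCe tot_proj a = \<alpha>"
          using that by (auto simp: hom_cat_def hom_functor_def)
        then show ?thesis by (auto elim!: tot_CeE simp: tot_simps(8) tot_proj_def)
      qed
    qed
  qed
  ultimately have "discrete_two_fibration tot B tot_proj chosen"
    using is_two_functor_tot_proj by (simp add: discrete_two_fibration_def)
  then show ?thesis
    using two_category_axioms two_category_tot is_two_functor_tot_proj
    by (simp add: discrete_two_fib_def discrete_two_fib_axioms_def two_functor_def)
qed

text \<open>The pair \<open>?c\<close> is the witness, its target being supplied by
  \<open>push_chosen\<close>. Hence building the 2-fibration and extracting its action returns the
  action one started from.\<close>

lemma act_tot:
  assumes s: "s \<in> Ar (Sq B)" "u \<in> Ar A" "sqk s = FAr q u"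
  shows "discrete_two_fib.act tot tot_proj chosen s u = ma s u"
proof -
  interpret D: discrete_two_fib B tot tot_proj chosen by (rule discrete_two_fib_tot)
  note S = s(1)[unfolded Sq_Ar_iff]
  have f: "sqf s \<in> Ar B" "Dom A u \<in> Ob A" "Cod B (sqf s) = FOb q (Dom A u)"
    and g: "sqg s \<in> Ar B" "Cod A u \<in> Ob A" "Cod B (sqg s) = FOb q (Cod A u)"
    using s S by (auto simp: A.cat_typing q.functor_simps)
  note [simp] = chosen_Ar[OF f] chosen_Dom[OF f] chosen_Cod[OF f] q_chosen[OF f]
    chosen_Ar[OF g] chosen_Dom[OF g] chosen_Cod[OF g] q_chosen[OF g]
  let ?c = "e (Comp A u (chosen (sqf s) (Dom A u)), sqc s)"
  have c: "?c \<in> Ce tot"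
    using s S by (simp add: tot_simps A.cat_typing q.functor_simps)
  have "D.act_rel s u (ma s u)"
    unfolding D.act_rel_def
    using s push_chosen[OF s] c
    by (auto simp: tot_simps(1-6,8,9) ma_Ar ma_Cod q_ma tot_proj_def intro!: bexI[of _ ?c])
  then show ?thesis
    using s by (intro D.act_eqI) (simp_all add: tot_simps tot_proj_def)
qed

end

section \<open>The comparison 2-functor\<close>

lemma tfcomp_simps [simp]:
  "X \<in> Ob C \<Longrightarrow> FOb (tfcomp C G F) X = FOb G (FOb F X)"
  "f \<in> Ar C \<Longrightarrow> FAr (tfcomp C G F) f = FAr G (FAr F f)"
  "\<alpha> \<in> Ce C \<Longrightarrow> FCe (tfcomp C G F) \<alpha> = FCe G (FCe F \<alpha>)"
  by (simp_all add: tfcomp_def compose_def)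

lemma tfid_simps [simp]:
  "X \<in> Ob C \<Longrightarrow> FOb (tfid C) X = X" "f \<in> Ar C \<Longrightarrow> FAr (tfid C) f = f" "\<alpha> \<in> Ce C \<Longrightarrow> FCe (tfid C) \<alpha> = \<alpha>"
  by (simp_all add: tfid_def)

lemma twofunctr_eqI:
  fixes F G :: "('o, 'a, 'c, 'p, 'b, 'd) twofunctr"
  assumes "is_two_functor C D F" "is_two_functor C D' G"
    and "\<And>X. X \<in> Ob C \<Longrightarrow> FOb F X = FOb G X" "\<And>f. f \<in> Ar C \<Longrightarrow> FAr F f = FAr G f"
    "\<And>\<alpha>. \<alpha> \<in> Ce C \<Longrightarrow> FCe F \<alpha> = FCe G \<alpha>"
  shows "F = G"
proof -
  interpret F: two_functor C D F by unfold_locales fact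
  interpret G: two_functor C D' G by unfold_locales fact
  have "FOb F = FOb G" "FAr F = FAr G" "FCe F = FCe G"
    using assms(3-5) F.FOb_ext F.FAr_ext F.FCe_ext G.FOb_ext G.FAr_ext G.FCe_ext by (auto intro: PiE_ext)
  then show ?thesis by simp
qed

lemma is_two_functor_tfid:
  assumes "two_category C"
  shows "is_two_functor C C (tfid C)"
proof -
  interpret two_category C by fact
  have "is_functor C C (tfid C)" by (rule is_functorI) (auto simp: tfid_def typing)
  then show ?thesis by (rule is_two_functorI) (auto simp: tfid_def typing)
qed

lemma is_two_functor_tfcomp:
  assumes "two_category C" "is_two_functor C D F" "is_two_functor D E G"
  shows "is_two_functor C E (tfcomp C G F)"
proof -
  interpret two_category C by fact
  interpret F: two_functor C D F by unfold_locales fact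
  interpret G: two_functor D E G by unfold_locales fact
  note [simp] = F.two_functor_simps G.two_functor_simps typing
  have "is_functor C E (tfcomp C G F)"
    by (rule is_functorI) (auto simp: tfcomp_def compose_def PiE_def)
  then show ?thesis
    by (rule is_two_functorI) (auto simp: tfcomp_def compose_def PiE_def)
qed

lemma is_functor_under_proj:
  "is_functor C D F \<Longrightarrow> is_functor C D (under_proj F)"
  by (simp add: is_functor_def)

lemma under_proj_tfid: "under_proj (tfid C) = fid (under C)"
  by (simp add: under_proj_def tfid_def fid_def)

lemma under_proj_tfcomp: "under_proj (tfcomp C G F) = fcomp (under C) (under_proj G) (under_proj F)"
  by (simp add: under_proj_def tfcomp_def fcomp_def)

lemma D2Fib_simps:
  "Ob (D2Fib U B) = d2fib_Ob U B" "Ar (D2Fib U B) = d2fib_Ar U B" "Dom (D2Fib U B) = Src" "Cod (D2Fib U B) = Tgt"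
  "Idn (D2Fib U B) = (\<lambda>E. \<lparr>Src = E, Tgt = E, Fn = tfid (Tot E)\<rparr>)"
  "Comp (D2Fib U B) = d2fib_comp"
  "Ce (D2Fib U B) = d2fib_Ce U B" "Dom2 (D2Fib U B) = Src" "Cod2 (D2Fib U B) = Tgt"
  "Idn2 (D2Fib U B) = (\<lambda>H. \<lparr>Src = H, Tgt = H,
       Fn = (\<lambda>X\<in>Ob (Tot (Src H)). Idn (Tot (Tgt H)) (FOb (Fn H) X))\<rparr>)"
  "VComp (D2Fib U B) = (\<lambda>\<tau> \<theta>. \<lparr>Src = Src \<theta>, Tgt = Tgt \<tau>,
       Fn = (\<lambda>X\<in>Ob (Tot (Src (Src \<theta>))). Comp (Tot (Tgt (Src \<theta>))) (Fn \<tau> X) (Fn \<theta> X))\<rparr>)"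
  "HComp (D2Fib U B) = (\<lambda>\<tau> \<theta>. \<lparr>Src = d2fib_comp (Src \<tau>) (Src \<theta>), Tgt = d2fib_comp (Tgt \<tau>) (Tgt \<theta>),
       Fn = (\<lambda>X\<in>Ob (Tot (Src (Src \<theta>))). Comp (Tot (Tgt (Src \<tau>)))
              (Fn \<tau> (FOb (Fn (Tgt \<theta>)) X)) (FAr (Fn (Src \<tau>)) (Fn \<theta> X)))\<rparr>)"
  by (simp_all add: D2Fib_def)

lemma d2fib_comp_simps [simp]:
  "Src (d2fib_comp G F) = Src F" "Tgt (d2fib_comp G F) = Tgt G"
  "Fn (d2fib_comp G F) = tfcomp (Tot (Src F)) (Fn G) (Fn F)"
  by (simp_all add: d2fib_comp_def)

section \<open>Discrete 2-fibrations as algebras\<close>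

context small_base begin

abbreviation "fibrations \<equiv> d2fib_Ob U B"
abbreviation "fibration_arrows \<equiv> d2fib_Ar U B"
abbreviation "fibration_cells \<equiv> d2fib_Ce U B"

lemma fibrationsD:
  assumes "R \<in> fibrations"
  shows "discrete_two_fib B (Tot R) (Proj R) (Cl R)" "two_category (Tot R)" "is_two_functor (Tot R) B (Proj R)"
    "Ob (Tot R) \<in> U" "Ar (Tot R) \<in> U"
  using assms two_category_axioms
  by (auto simp: d2fib_Ob_def small_two_category_def discrete_two_fib_def discrete_two_fib_axioms_def
      two_functor_def discrete_two_fibration_def)

lemma two_fibrations:
  "\<lbrakk>R \<in> fibrations; S \<in> fibrations\<rbrakk>
    \<Longrightarrow> two_discrete_two_fibs B (Tot R) (Proj R) (Cl R) (Tot S) (Proj S) (Cl S)"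
  using fibrationsD two_category_axioms by (simp add: two_discrete_two_fibs_def)

lemma fibration_arrowsD:
  assumes "H \<in> fibration_arrows"
  shows "Src H \<in> fibrations" "Tgt H \<in> fibrations" "is_two_functor (Tot (Src H)) (Tot (Tgt H)) (Fn H)"
    "X \<in> Ob (Tot (Src H)) \<Longrightarrow> FOb (Proj (Tgt H)) (FOb (Fn H) X) = FOb (Proj (Src H)) X"
    "u \<in> Ar (Tot (Src H)) \<Longrightarrow> FAr (Proj (Tgt H)) (FAr (Fn H) u) = FAr (Proj (Src H)) u"
    "a \<in> Ce (Tot (Src H)) \<Longrightarrow> FCe (Proj (Tgt H)) (FCe (Fn H) a) = FCe (Proj (Src H)) a"
    "\<lbrakk>f \<in> Ar B; X \<in> Ob (Tot (Src H)); Cod B f = FOb (Proj (Src H)) X\<rbrakk>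
      \<Longrightarrow> FAr (Fn H) (Cl (Src H) f X) = Cl (Tgt H) f (FOb (Fn H) X)"
proof -
  show "Src H \<in> fibrations" "Tgt H \<in> fibrations" "is_two_functor (Tot (Src H)) (Tot (Tgt H)) (Fn H)"
    "\<lbrakk>f \<in> Ar B; X \<in> Ob (Tot (Src H)); Cod B f = FOb (Proj (Src H)) X\<rbrakk>
      \<Longrightarrow> FAr (Fn H) (Cl (Src H) f X) = Cl (Tgt H) f (FOb (Fn H) X)"
    using assms by (auto simp: d2fib_Ar_def)
  have "tfcomp (Tot (Src H)) (Proj (Tgt H)) (Fn H) = Proj (Src H)"
    using assms by (simp add: d2fib_Ar_def)
  from this[symmetric]
  show "X \<in> Ob (Tot (Src H)) \<Longrightarrow> FOb (Proj (Tgt H)) (FOb (Fn H) X) = FOb (Proj (Src H)) X"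
    "u \<in> Ar (Tot (Src H)) \<Longrightarrow> FAr (Proj (Tgt H)) (FAr (Fn H) u) = FAr (Proj (Src H)) u"
    "a \<in> Ce (Tot (Src H)) \<Longrightarrow> FCe (Proj (Tgt H)) (FCe (Fn H) a) = FCe (Proj (Src H)) a"
    by simp_all
qed

lemma fibration_arrowsI:
  assumes "Src H \<in> fibrations" "Tgt H \<in> fibrations" and F: "is_two_functor (Tot (Src H)) (Tot (Tgt H)) (Fn H)"
    and "\<And>X. X \<in> Ob (Tot (Src H)) \<Longrightarrow> FOb (Proj (Tgt H)) (FOb (Fn H) X) = FOb (Proj (Src H)) X"
    "\<And>u. u \<in> Ar (Tot (Src H)) \<Longrightarrow> FAr (Proj (Tgt H)) (FAr (Fn H) u) = FAr (Proj (Src H)) u"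
    "\<And>a. a \<in> Ce (Tot (Src H)) \<Longrightarrow> FCe (Proj (Tgt H)) (FCe (Fn H) a) = FCe (Proj (Src H)) a"
    and "\<And>f X. \<lbrakk>f \<in> Ar B; X \<in> Ob (Tot (Src H)); Cod B f = FOb (Proj (Src H)) X\<rbrakk>
      \<Longrightarrow> FAr (Fn H) (Cl (Src H) f X) = Cl (Tgt H) f (FOb (Fn H) X)"
  shows "H \<in> fibration_arrows"
proof -
  have "tfcomp (Tot (Src H)) (Proj (Tgt H)) (Fn H) = Proj (Src H)"
    by (rule twofunctr_eqI[OF is_two_functor_tfcomp[OF _ F] fibrationsD(3)])
      (use assms fibrationsD in simp_all)
  with assms show ?thesis by (simp add: d2fib_Ar_def)
qed

definition base :: "'u d2fib \<Rightarrow> 'u over" where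
  "base R = (under (Tot R), under_proj (Proj R))"

abbreviation "fib_act R \<equiv> discrete_two_fib.act (Tot R) (Proj R) (Cl R)"

definition phi_ob :: "'u d2fib \<Rightarrow> 'u over \<times> 'u over_arr" where
  "phi_ob R = (base R, alg_of (base R) (\<lambda>f X. Dom (Tot R) (Cl R f X)) (fib_act R))"

definition phi_ar :: "'u d2fib_arr \<Rightarrow> ('u over, 'u over_arr) alg_arr" where
  "phi_ar H = \<lparr>Src = phi_ob (Src H), Tgt = phi_ob (Tgt H),
     Fn = \<lparr>Src = base (Src H), Tgt = base (Tgt H), Fn = under_proj (Fn H)\<rparr>\<rparr>"

definition phi_ce :: "'u d2fib_cell \<Rightarrow> ('u over, 'u over_arr, 'u over_cell) alg_cell" where
  "phi_ce \<theta> = \<lparr>Src = phi_ar (Src \<theta>), Tgt = phi_ar (Tgt \<theta>),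
     Fn = \<lparr>Src = Fn (phi_ar (Src \<theta>)), Tgt = Fn (phi_ar (Tgt \<theta>)), Fn = Fn \<theta>\<rparr>\<rparr>"

lemma base_simps [simp]: "fst (base R) = under (Tot R)" "snd (base R) = under_proj (Proj R)"
  by (simp_all add: base_def)

lemma phi_simps [simp]:
  "fst (phi_ob R) = base R" "snd (phi_ob R) = alg_of (base R) (\<lambda>f X. Dom (Tot R) (Cl R f X)) (fib_act R)"
  "Src (phi_ar H) = phi_ob (Src H)" "Tgt (phi_ar H) = phi_ob (Tgt H)"
  "Fn (phi_ar H) = \<lparr>Src = base (Src H), Tgt = base (Tgt H), Fn = under_proj (Fn H)\<rparr>"
  "Src (phi_ce \<theta>) = phi_ar (Src \<theta>)" "Tgt (phi_ce \<theta>) = phi_ar (Tgt \<theta>)"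
  "Fn (phi_ce \<theta>) = \<lparr>Src = Fn (phi_ar (Src \<theta>)), Tgt = Fn (phi_ar (Tgt \<theta>)), Fn = Fn \<theta>\<rparr>"
  by (simp_all add: phi_ob_def phi_ar_def phi_ce_def)

lemma base_over: "R \<in> fibrations \<Longrightarrow> base R \<in> over_objects"
  using fibrationsD[of R]
  by (simp add: over_Ob_def base_def small_category_def two_category.category_self is_two_functor_def
      is_functor_under_proj)

lemma phi_ob_algebra: "R \<in> fibrations \<Longrightarrow> phi_ob R \<in> algebras"
  using algebrasI[OF base_over[of R], of "\<lambda>f X. Dom (Tot R) (Cl R f X)" "fib_act R"]
    discrete_two_fib.sq_algebra[OF fibrationsD(1)[of R]]
  by (simp add: phi_ob_def)

lemma phi_ar_algebra:
  assumes "H \<in> fibration_arrows"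
  shows "phi_ar H \<in> algebra_arrows"
proof -
  note H = fibration_arrowsD[OF assms]
  interpret RS: two_discrete_two_fibs B "Tot (Src H)" "Proj (Src H)" "Cl (Src H)" "Tot (Tgt H)" "Proj (Tgt H)" "Cl (Tgt H)"
    by (rule two_fibrations[OF H(1,2)])
  interpret H: two_functor "Tot (Src H)" "Tot (Tgt H)" "Fn H" by unfold_locales (rule H)
  have "Fn (phi_ar H) \<in> over_arrows"
    by (rule over_ArI) (use H in \<open>simp_all add: base_over is_functor_under_proj H.is_functor\<close>)
  moreover have "FAr (Fn H) (fib_act (Src H) s u) = fib_act (Tgt H) s (FAr (Fn H) u)"
    if "s \<in> Ar (Sq B)" "u \<in> Ar (Tot (Src H))" "sqk s = FAr (Proj (Src H)) u" for s u
    using that by (intro RS.act_preserved H)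
  moreover have "FOb (Fn H) (Dom (Tot (Src H)) (Cl (Src H) f X)) = Dom (Tot (Tgt H)) (Cl (Tgt H) f (FOb (Fn H) X))"
    if "f \<in> Ar B" "X \<in> Ob (Tot (Src H))" "Cod B f = FOb (Proj (Src H)) X" for f X
    using that H(7)[OF that] H.F_Dom[of "Cl (Src H) f X"] RS.E.cl_Ar[OF that] by simp
  ultimately show ?thesis
    using H phi_ob_algebra by (auto simp: algebra_arrows_iff H.F_Ob H.F_Ar)
qed

text \<open>\<open>act_component\<close> gives compatibility with the actions and
  \<open>two_nat_trans\<close> gives 2-naturality back. Cells of \<open>D2Fib\<close> can therefore
  be recognised by their images, which serves both for closure under composition and for fullness on
  2-cells.\<close>

lemma fibration_cells_iff:
  "\<theta> \<in> fibration_cells \<longleftrightarrow> Src \<theta> \<in> fibration_arrows \<and> Tgt \<theta> \<in> fibration_arrows \<and>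
     Src (Tgt \<theta>) = Src (Src \<theta>) \<and> Tgt (Tgt \<theta>) = Tgt (Src \<theta>) \<and> phi_ce \<theta> \<in> algebra_cells"
proof -
  have "two_nat_trans (Tot (Src (Src \<theta>))) (Tot (Tgt (Src \<theta>))) (Fn (Src \<theta>)) (Fn (Tgt \<theta>)) (Fn \<theta>) \<and>
     (\<forall>X\<in>Ob (Tot (Src (Src \<theta>))).
        FAr (Proj (Tgt (Src \<theta>))) (Fn \<theta> X) = Idn B (FOb (Proj (Src (Src \<theta>))) X)) \<longleftrightarrow> phi_ce \<theta> \<in> algebra_cells"
    (is "?l \<longleftrightarrow> ?r")
    if *: "Src \<theta> \<in> fibration_arrows" "Tgt \<theta> \<in> fibration_arrows" and e: "Src (Tgt \<theta>) = Src (Src \<theta>)" "Tgt (Tgt \<theta>) = Tgt (Src \<theta>)"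
  proof -
    let ?R = "Src (Src \<theta>)" and ?S = "Tgt (Src \<theta>)" and ?H = "Fn (Src \<theta>)" and ?K = "Fn (Tgt \<theta>)"
    note H = fibration_arrowsD[OF *(1)] and K = fibration_arrowsD[OF *(2), unfolded e]
    note PH = phi_ar_algebra[OF *(1)] and PK = phi_ar_algebra[OF *(2)]
    interpret RS: two_discrete_two_fibs B "Tot ?R" "Proj ?R" "Cl ?R" "Tot ?S" "Proj ?S" "Cl ?S"
      by (rule two_fibrations[OF H(1,2)])
    interpret H: two_functor "Tot ?R" "Tot ?S" ?H by unfold_locales (rule H)
    interpret K: two_functor "Tot ?R" "Tot ?S" ?K by unfold_locales (rule K)
    have o: "Fn (phi_ar (Src \<theta>)) \<in> over_arrows" "Fn (phi_ar (Tgt \<theta>)) \<in> over_arrows"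
      using PH PK by (simp_all add: algebra_arrows_iff)
    have nt: "nat_trans (under (Tot ?R)) (under (Tot ?S)) (under_proj ?H) (under_proj ?K) (Fn \<theta>) \<longleftrightarrow>
        nat_trans (Tot ?R) (Tot ?S) ?H ?K (Fn \<theta>)"
      by (simp add: nat_trans_def)
    have over: "Fn (phi_ce \<theta>) \<in> over_cells \<longleftrightarrow> nat_trans (Tot ?R) (Tot ?S) ?H ?K (Fn \<theta>) \<and>
       (\<forall>X\<in>Ob (Tot ?R). FAr (Proj ?S) (Fn \<theta> X) = Idn B (FOb (Proj ?R) X))"
      using o by (simp add: over_Ce_def e nt)
    show ?thesis
    proof
      assume l: ?l
      then have n: "nat_trans (Tot ?R) (Tot ?S) ?H ?K (Fn \<theta>)" by (simp add: two_nat_trans_def)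
      have v: "\<And>X. X \<in> Ob (Tot ?R) \<Longrightarrow> FAr (Proj ?S) (Fn \<theta> X) = Idn B (FOb (Proj ?R) X)" using l by simp
      have "Fn \<theta> (Dom (Tot ?R) (Cl ?R f X)) = fib_act ?S (Idn (Sq B) f) (Fn \<theta> X)"
        if "f \<in> Ar B" "X \<in> Ob (Tot ?R)" "Cod B f = FOb (Proj ?R) X" for f X
        by (rule RS.act_component[OF H(3) K(3) H(4) K(4) H(6) K(6) n v H(7) K(7) that])
      moreover have "Idn (Sq B) f \<in> Ar (Sq B)" "sqk (Idn (Sq B) f) = Idn B (Cod B f)" if "f \<in> Ar B" for f
        using Sq_Idn_Ar[OF that] by (simp, simp add: Sq_simps)
      moreover have "Fn \<theta> X \<in> Ar (Tot ?S)" if "X \<in> Ob (Tot ?R)" for X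
        using n that by (auto simp: nat_trans_def)
      moreover have "Fn (phi_ce \<theta>) \<in> over_cells" using over n v by blast
      ultimately show ?r
        using PH PK v e by (auto simp: algebra_cells_iff)
    next
      assume ?r
      then have "Fn (phi_ce \<theta>) \<in> over_cells" by (simp add: algebra_cells_iff)
      then have n: "nat_trans (Tot ?R) (Tot ?S) ?H ?K (Fn \<theta>)"
        and v: "\<And>X. X \<in> Ob (Tot ?R) \<Longrightarrow> FAr (Proj ?S) (Fn \<theta> X) = Idn B (FOb (Proj ?R) X)"
        using over by simp_all
      have "two_nat_trans (Tot ?R) (Tot ?S) ?H ?K (Fn \<theta>)"
        by (rule RS.two_nat_trans[OF H(3) K(3) H(4) K(4) H(6) K(6) n v])
      with v show ?l by simp
    qed
  qed
  then show ?thesis by (auto simp: d2fib_Ce_def)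
qed

text \<open>This and the next four equations are identities of records, valid for arbitrary
  arguments. They are thus at hand before \<open>D2Fib\<close> is known to be closed under its
  operations, and those for cells transfer this closure from \<open>TAlg\<close>.\<close>

lemma phi_Idn: "phi_ar (Idn (D2Fib U B) R) = Idn (TAlg U B) (phi_ob R)"
  by (simp add: phi_ar_def D2Fib_simps TAlg_def Alg_simps Cat_over_simps under_proj_tfid)

lemma phi_Comp: "phi_ar (Comp (D2Fib U B) G F) = Comp (TAlg U B) (phi_ar G) (phi_ar F)"
  by (simp add: phi_ar_def D2Fib_simps TAlg_def Alg_simps Cat_over_simps under_proj_tfcomp alg_comp_def over_comp_def)

lemma phi_Idn2: "phi_ce (Idn2 (D2Fib U B) H) = Idn2 (TAlg U B) (phi_ar H)"
  by (simp add: phi_ce_def D2Fib_simps TAlg_def Alg_simps Cat_over_simps)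

lemma phi_VComp: "phi_ce (VComp (D2Fib U B) \<tau> \<theta>) = VComp (TAlg U B) (phi_ce \<tau>) (phi_ce \<theta>)"
  by (simp add: phi_ce_def D2Fib_simps TAlg_def Alg_simps Cat_over_simps)

lemma phi_HComp: "phi_ce (HComp (D2Fib U B) \<tau> \<theta>) = HComp (TAlg U B) (phi_ce \<tau>) (phi_ce \<theta>)"
  using phi_Comp by (simp add: phi_ce_def D2Fib_simps TAlg_def Alg_simps Cat_over_simps over_comp_def under_proj_tfcomp)

lemma two_category_TAlg: "two_category (TAlg U B)"
  unfolding TAlg_def
  by (intro two_category_Alg two_category_Cat_over is_two_functor_T) (simp add: category_self)

lemma TAlg_simps:
  "Ob (TAlg U B) = algebras" "Ar (TAlg U B) = algebra_arrows" "Ce (TAlg U B) = algebra_cells"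
  "Dom (TAlg U B) = Src" "Cod (TAlg U B) = Tgt" "Dom2 (TAlg U B) = Src" "Cod2 (TAlg U B) = Tgt"
  by (simp_all add: TAlg_def Alg_simps)

lemma fibration_comp_arrow:
  assumes "F \<in> fibration_arrows" "G \<in> fibration_arrows" "Src G = Tgt F"
  shows "d2fib_comp G F \<in> fibration_arrows"
proof -
  note F = fibration_arrowsD[OF assms(1)] and G = fibration_arrowsD[OF assms(2), unfolded assms(3)]
  interpret F: two_functor "Tot (Src F)" "Tot (Tgt F)" "Fn F" by unfold_locales (rule F)
  interpret D: discrete_two_fib B "Tot (Src F)" "Proj (Src F)" "Cl (Src F)" by (rule fibrationsD[OF F(1)])
  show ?thesis
    by (rule fibration_arrowsI)
      (use F G in \<open>auto intro!: is_two_functor_tfcomp D.E.two_category_axioms simp: F.two_functor_simps D.cl_Ar\<close>)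
qed

text \<open>Arrows are treated directly. An identity or composite of cells has as image the
  corresponding cell of \<open>TAlg\<close>, and \<open>fibration_cells_iff\<close> brings it
  back.\<close>

lemma pre_two_category_D2Fib: "pre_two_category (D2Fib U B)"
proof
  interpret A: two_category "TAlg U B" by (rule two_category_TAlg)
  let ?D = "D2Fib U B"
  have sel: "Ar ?D = fibration_arrows" "Ce ?D = fibration_cells" "Ob ?D = fibrations" "Dom ?D = Src" "Cod ?D = Tgt"
    "Dom2 ?D = Src" "Cod2 ?D = Tgt" "Comp ?D = d2fib_comp" by (simp_all add: D2Fib_simps)
  show "Idn ?D R \<in> Ar ?D" if R: "R \<in> Ob ?D" for R
  proof -
    have R: "R \<in> fibrations" using that by (simp add: sel)
    interpret D: discrete_two_fib B "Tot R" "Proj R" "Cl R" by (rule fibrationsD[OF R])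
    show ?thesis
      unfolding D2Fib_simps
      by (rule fibration_arrowsI)
        (use R in \<open>auto intro!: is_two_functor_tfid D.E.two_category_axioms simp: D.cl_Ar\<close>)
  qed
  show "Idn2 ?D H \<in> Ce ?D" if H: "H \<in> Ar ?D" for H
  proof -
    have "phi_ce (Idn2 ?D H) \<in> Ce (TAlg U B)"
      unfolding phi_Idn2 using phi_ar_algebra[of H] H by (intro A.typing) (simp add: TAlg_simps sel)
    then show ?thesis using H by (simp add: sel fibration_cells_iff TAlg_simps) (simp add: D2Fib_simps)
  qed
  show "VComp ?D \<beta> \<alpha> \<in> Ce ?D" if H: "\<alpha> \<in> Ce ?D" "\<beta> \<in> Ce ?D" "Dom2 ?D \<beta> = Cod2 ?D \<alpha>" for \<alpha> \<beta>
  proof -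
    note H = H[unfolded sel fibration_cells_iff]
    have "phi_ce (VComp ?D \<beta> \<alpha>) \<in> Ce (TAlg U B)"
      unfolding phi_VComp using H by (intro A.typing) (simp_all add: TAlg_simps)
    then show ?thesis using H by (simp add: sel fibration_cells_iff TAlg_simps) (simp add: D2Fib_simps)
  qed
  show "HComp ?D \<beta> \<alpha> \<in> Ce ?D" if H: "\<alpha> \<in> Ce ?D" "\<beta> \<in> Ce ?D" "Dom ?D (Dom2 ?D \<beta>) = Cod ?D (Dom2 ?D \<alpha>)" for \<alpha> \<beta>
  proof -
    note H = H[unfolded sel fibration_cells_iff]
    have "phi_ce (HComp ?D \<beta> \<alpha>) \<in> Ce (TAlg U B)"
      unfolding phi_HComp using H by (intro A.typing) (simp_all add: TAlg_simps)
    then show ?thesis using H by (simp add: sel fibration_cells_iff TAlg_simps) (simp add: D2Fib_simps fibration_comp_arrow)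
  qed
qed (auto simp: D2Fib_simps fibration_cells_iff fibration_arrowsD fibration_comp_arrow)

section \<open>Faithfulness, surjectivity and fullness of the comparison\<close>

definition phi :: "('u d2fib, 'u d2fib_arr, 'u d2fib_cell, 'u over \<times> 'u over_arr,
    ('u over, 'u over_arr) alg_arr, ('u over, 'u over_arr, 'u over_cell) alg_cell) twofunctr" where
  "phi = \<lparr>FOb = restrict phi_ob fibrations, FAr = restrict phi_ar fibration_arrows, FCe = restrict phi_ce fibration_cells\<rparr>"

lemma is_two_functor_phi: "is_two_functor (D2Fib U B) (TAlg U B) phi"
proof -
  note t = pre_two_category.typing[OF pre_two_category_D2Fib]
  let ?D = "D2Fib U B"
  have sel: "Ar ?D = fibration_arrows" "Ce ?D = fibration_cells" "Ob ?D = fibrations" by (simp_all add: D2Fib_simps)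
  have bd: "Dom ?D = Src" "Cod ?D = Tgt" "Dom2 ?D = Src" "Cod2 ?D = Tgt" by (simp_all add: D2Fib_simps)
  have p: "phi = \<lparr>FOb = restrict phi_ob (Ob ?D), FAr = restrict phi_ar (Ar ?D), FCe = restrict phi_ce (Ce ?D)\<rparr>"
    by (simp add: phi_def sel)
  have ce: "\<And>\<theta>. \<theta> \<in> Ce ?D \<Longrightarrow> phi_ce \<theta> \<in> Ce (TAlg U B)"
    by (simp add: sel TAlg_simps fibration_cells_iff)
  have ar: "\<And>H. H \<in> Ar ?D \<Longrightarrow> phi_ar H \<in> Ar (TAlg U B)"
    by (simp add: sel TAlg_simps phi_ar_algebra)
  have ob: "\<And>R. R \<in> Ob ?D \<Longrightarrow> phi_ob R \<in> Ob (TAlg U B)"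
    by (simp add: sel TAlg_simps phi_ob_algebra)
  have b: "Dom (TAlg U B) (phi_ar H) = phi_ob (Dom ?D H)" "Cod (TAlg U B) (phi_ar H) = phi_ob (Cod ?D H)"
    "Dom2 (TAlg U B) (phi_ce \<theta>) = phi_ar (Dom2 ?D \<theta>)" "Cod2 (TAlg U B) (phi_ce \<theta>) = phi_ar (Cod2 ?D \<theta>)" for H \<theta>
    by (simp_all add: bd TAlg_simps)
  have "is_functor ?D (TAlg U B) phi"
    by (rule is_functorI) (auto simp: p t b ce ar ob phi_Idn phi_Comp)
  then show ?thesis
    by (rule is_two_functorI) (auto simp: p t b ce ar ob phi_Idn2 phi_VComp phi_HComp)
qed

text \<open>\<open>phi_ar\<close> forgets only the effect on 2-cells, which uniqueness of lifts
  recovers from sources and projections.\<close>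

lemma phi_ar_inj:
  assumes H: "H \<in> fibration_arrows" and K: "K \<in> fibration_arrows"
    and eq: "Src H = Src K" "Tgt H = Tgt K" "phi_ar H = phi_ar K"
  shows "H = K"
proof -
  note H' = fibration_arrowsD[OF H, unfolded eq(1,2)] and K' = fibration_arrowsD[OF K]
  interpret D: discrete_two_fib B "Tot (Tgt K)" "Proj (Tgt K)" "Cl (Tgt K)" by (rule fibrationsD[OF K'(2)])
  interpret H: two_functor "Tot (Src K)" "Tot (Tgt K)" "Fn H" by unfold_locales (rule H')
  interpret K: two_functor "Tot (Src K)" "Tot (Tgt K)" "Fn K" by unfold_locales (rule K')
  interpret C: two_category "Tot (Src K)" by (rule fibrationsD[OF K'(1)])
  have "Fn (Fn (phi_ar H)) = Fn (Fn (phi_ar K))" using eq(3) by simp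
  then have e: "FOb (Fn H) = FOb (Fn K)" "FAr (Fn H) = FAr (Fn K)"
    by (simp_all add: under_proj_def)
  have "FCe (Fn H) a = FCe (Fn K) a" if "a \<in> Ce (Tot (Src K))" for a
    by (rule D.lift_unique) (use that e H'(6) K'(6) in \<open>simp_all add: H.two_functor_simps K.two_functor_simps\<close>)
  then have "Fn H = Fn K"
    by (intro twofunctr_eqI[OF H'(3) K'(3)]) (simp_all add: e)
  with eq show ?thesis by simp
qed

lemma phi_ob_surj:
  assumes "A \<in> algebras"
  shows "\<exists>R\<in>fibrations. phi_ob R = A"
proof -
  obtain Q M where A: "A = (Q, M)" by (cases A)
  note M = algebrasD[OF assms[unfolded A]]
  interpret sq_algebra B "fst Q" "snd Q" "mo_of M" "ma_of M" by (rule M)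
  \<comment> \<open>The 2-cells of the total 2-category must again be members of \<open>'u\<close>;
    the injection on pairs provides their codes.\<close>
  interpret C: sq_algebra_code B "fst Q" "snd Q" "mo_of M" "ma_of M" "enc :: 'u \<times> 'u \<Rightarrow> 'u" dec
    by unfold_locales simp
  let ?R = "\<lparr>Tot = C.tot, Proj = C.tot_proj, Cl = chosen\<rparr>"
  interpret D: discrete_two_fib B C.tot C.tot_proj chosen by (rule C.discrete_two_fib_tot)
  have QU: "Ob (fst Q) \<in> U" "Ar (fst Q) \<in> U"
    using over_ObD(2)[OF M(1)] by (simp_all add: small_category_def)
  have "Ce C.tot \<subseteq> enc ` (Ar (fst Q) \<times> Ce B)" by (auto simp: C.tot_simps)
  then have "Ce C.tot \<in> U"
    by (intro universe_lepoll[OF universe universe_enc_Times[OF universe QU(2) small(3)] subset_imp_lepoll])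
  then have R: "?R \<in> fibrations"
    using QU C.two_category_tot D.d2f by (simp add: d2fib_Ob_def small_two_category_def C.tot_simps(1,2))
  \<comment> \<open>The total 2-category takes over the objects and arrows of \<open>fst Q\<close>
    unchanged, so its base is \<open>Q\<close> itself and not merely an isomorphic copy.\<close>
  have base: "base ?R = Q"
    by (simp add: base_def C.under_tot under_proj_def C.tot_proj_def prod_eq_iff functr.equality)
  \<comment> \<open>Both are arrows of the slice, hence equal once they agree on codes, where
    \<open>act_tot\<close> identifies the actions.\<close>
  have "alg_of Q (\<lambda>f X. Dom C.tot (chosen f X)) D.act = M"
  proof (rule over_Ar_eqI)
    show "alg_of Q (\<lambda>f X. Dom C.tot (chosen f X)) D.act \<in> over_arrows"
      using phi_ob_algebra[OF R] algebrasD(2) base unfolding phi_ob_def by (simp del: phi_simps)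
  qed (auto simp: M T_ob_Ob_iff T_ob_Ar_iff C.tot_simps chosen_Dom C.act_tot)
  with base have "phi_ob ?R = A"
    by (simp add: phi_ob_def A)
  with R show ?thesis by blast
qed

text \<open>A morphism of algebras is a functor over the base that preserves the actions, which is
  what \<open>extend\<close> needs in order to act on 2-cells.\<close>

lemma phi_ar_full:
  assumes R: "R \<in> fibrations" and S: "S \<in> fibrations" and g: "g \<in> algebra_arrows" "Src g = phi_ob R" "Tgt g = phi_ob S"
  shows "\<exists>H\<in>fibration_arrows. Src H = R \<and> Tgt H = S \<and> phi_ar H = g"
proof -
  interpret RS: two_discrete_two_fibs B "Tot R" "Proj R" "Cl R" "Tot S" "Proj S" "Cl S"
    by (rule two_fibrations[OF R S])
  let ?H = "Fn (Fn g)"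
  have o: "Fn g \<in> over_arrows" and b: "Src (Fn g) = base R" "Tgt (Fn g) = base S"
    using g by (auto simp: algebra_arrows_iff)
  note o = over_ArD[OF o, unfolded b, simplified]
  have H: "is_functor (Tot R) (Tot S) ?H"
    using o(3) by (simp add: functor_on_def)
  interpret H: functor_on "Tot R" "Tot S" ?H by unfold_locales (rule H)
  have act: "FAr ?H (RS.E.act s u) = RS.E'.act s (FAr ?H u)"
    if "s \<in> Ar (Sq B)" "u \<in> Ar (Tot R)" "sqk s = FAr (Proj R) u" for s u
    using g that o(5) H.F_Ar[of u] by (auto simp: algebra_arrows_iff)
  let ?K = "\<lparr>Src = R, Tgt = S, Fn = RS.extend ?H\<rparr>"
  have "?K \<in> fibration_arrows"
    by (rule fibration_arrowsI)
      (use R S o act in \<open>simp_all add: RS.is_two_functor_extend[OF H] RS.P_extend[OF H] RS.extend_cl[OF H]\<close>)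
  moreover have "phi_ar ?K = g"
    using g(2,3) b by (simp add: phi_ar_def under_proj_def)
  ultimately show ?thesis by (intro bexI[of _ ?K]) simp_all
qed

lemma two_equivalent_D2Fib_TAlg: "two_equivalent (D2Fib U B) (TAlg U B)"
proof (rule two_equivalentI)
  have sel: "Ob (D2Fib U B) = fibrations" "Ar (D2Fib U B) = fibration_arrows" "Ce (D2Fib U B) = fibration_cells"
    "Dom (D2Fib U B) = Src" "Cod (D2Fib U B) = Tgt" "Dom2 (D2Fib U B) = Src" "Cod2 (D2Fib U B) = Tgt"
    by (simp_all add: D2Fib_simps)
  have p: "FOb phi = restrict phi_ob fibrations" "FAr phi = restrict phi_ar fibration_arrows"
    "FCe phi = restrict phi_ce fibration_cells" by (simp_all add: phi_def)
  show "faithful_two_functor (D2Fib U B) (TAlg U B) phi"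
    unfolding faithful_two_functor_def faithful_two_functor_axioms_def two_functor_def
  proof (intro conjI allI impI pre_two_category_D2Fib two_category_TAlg is_two_functor_phi)
    show "H = K" if "H \<in> Ar (D2Fib U B)" "K \<in> Ar (D2Fib U B)" "Dom (D2Fib U B) H = Dom (D2Fib U B) K"
      "Cod (D2Fib U B) H = Cod (D2Fib U B) K" "FAr phi H = FAr phi K" for H K
      using that phi_ar_inj by (simp add: sel p)
    show "\<alpha> = \<beta>" if "\<alpha> \<in> Ce (D2Fib U B)" "\<beta> \<in> Ce (D2Fib U B)" "Dom2 (D2Fib U B) \<alpha> = Dom2 (D2Fib U B) \<beta>"
      "Cod2 (D2Fib U B) \<alpha> = Cod2 (D2Fib U B) \<beta>" "FCe phi \<alpha> = FCe phi \<beta>" for \<alpha> \<beta>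
    proof -
      have "Fn (Fn (phi_ce \<alpha>)) = Fn (Fn (phi_ce \<beta>))" using that by (simp only: sel p restrict_apply')
      then show ?thesis using that by (simp add: sel)
    qed
  qed
  show "\<exists>R\<in>Ob (D2Fib U B). FOb phi R = A" if "A \<in> Ob (TAlg U B)" for A
    using phi_ob_surj that by (auto simp: sel p TAlg_simps)
  show "\<exists>H\<in>Ar (D2Fib U B). Dom (D2Fib U B) H = R \<and> Cod (D2Fib U B) H = S \<and> FAr phi H = g"
    if "R \<in> Ob (D2Fib U B)" "S \<in> Ob (D2Fib U B)" "g \<in> Ar (TAlg U B)" "Dom (TAlg U B) g = FOb phi R"
      "Cod (TAlg U B) g = FOb phi S" for R S g
    using phi_ar_full[of R S g] that by (auto simp: sel p TAlg_simps)
  show "\<exists>\<alpha>\<in>Ce (D2Fib U B). Dom2 (D2Fib U B) \<alpha> = H \<and> Cod2 (D2Fib U B) \<alpha> = K \<and> FCe phi \<alpha> = \<beta>"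
    if H: "H \<in> Ar (D2Fib U B)" "K \<in> Ar (D2Fib U B)" "Dom (D2Fib U B) H = Dom (D2Fib U B) K"
      "Cod (D2Fib U B) H = Cod (D2Fib U B) K" "\<beta> \<in> Ce (TAlg U B)" "Dom2 (TAlg U B) \<beta> = FAr phi H"
      "Cod2 (TAlg U B) \<beta> = FAr phi K" for H K \<beta>
  proof -
    \<comment> \<open>The components are kept and the boundaries replaced by \<open>H\<close> and
      \<open>K\<close>, which are known to have the right images.\<close>
    let ?a = "\<lparr>Src = H, Tgt = K, Fn = Fn (Fn \<beta>)\<rparr>"
    have b: "Src \<beta> = phi_ar H" "Tgt \<beta> = phi_ar K" "Src (Fn \<beta>) = Fn (phi_ar H)" "Tgt (Fn \<beta>) = Fn (phi_ar K)"
      using H by (auto simp: sel p TAlg_simps algebra_cells_iff)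
    then have "phi_ce ?a = \<beta>" by (simp add: phi_ce_def)
    moreover from this have "?a \<in> fibration_cells"
      using H by (simp add: fibration_cells_iff sel TAlg_simps)
    ultimately show ?thesis by (intro bexI[of _ ?a]) (simp_all add: sel p)
  qed
qed

end

theorem theorem4p13:
  fixes U :: "'u set set" and B :: "('u, 'u, 'u) twocat"
  assumes "universe U" and "small_two_category U B"
  shows "two_equivalent (D2Fib U B) (TAlg U B)"
proof -
  interpret small_base B U
    using assms by (simp add: small_base_def small_base_axioms_def small_two_category_def)
  show ?thesis by (rule two_equivalent_D2Fib_TAlg)
qed

end
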